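(* Let $c>0$, $E=[0,1]$, and for each $N$ let $\{Z^N_k\}_{k\ge 0}$ be the number of explored vertices after $k$ steps of the greedy exploration algorithm on the Erdős–Rényi graph $G(N,c/N)$. Put $Y^N_t=\frac{1}{N}Z^N_{[Nt]}$ for $t\in[0,1]$. Then the sequence of processes $\{Y^N\}_N$, $Y^N=\{Y^N_t\}_{0\le t\le 1}$, satisfies a large deviation principle (with speed $N$) on $D_E[0,1]$ with good rate function $I:D_E[0,1]\to[0,+\infty]$ given by $$I(\varphi)=\begin{cases}\displaystyle\int_0^1 L(\varphi(t),\dot\varphi(t))\,dt & \text{if }\varphi\in\mathcal H_L,\\ +\infty & \text{otherwise,}\end{cases}$$ where $L:E\times\mathbb R\to[0,+\infty]$ is $$L(x,\beta)=\begin{cases}(\beta-1)\left[\log\left(\frac{\beta-1}{c(1-x)}\right)-1\right]+c(1-x) & \text{if }x<1,\ \beta>1,\\ c(1-x) & \text{if }x<1,\ \beta=1,\\ 0 & \text{if }x=1,\ \beta=0,\\ +\infty & \text{in all other cases,}\end{cases}$$ and $\mathcal H_L$ is the set of all absolutely continuous functions $\varphi:[0,1]\to[0,1]$ with $\varphi(0)=0$ such that the integral $\int_0^1 L(\varphi(t),\dot\varphi(t))\,dt$ exists and is finite.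
   Context: Greedy exploration algorithm on $G(N,c/N)$ (the random graph on $N$ vertices in which each edge is present independently with probability $c/N$): initially all vertices are unexplored. At each step a vertex is selected uniformly among the unexplored ones and becomes active; all its unexplored neighbours become blocked. Active and blocked vertices are called explored. $Z^N_k$ is the number of explored vertices after step $k$. Then $\{Z^N_k\}_k$ is a time-homogeneous Markov chain on $\{0,1,\dots,N\}$ with $Z^N_0=0$, absorbed at $N$, and such that, when $Z^N_k<N$, $Z^N_{k+1}=Z^N_k+1+\zeta^N_{k+1}$, where conditionally on $Z^N_k$ the variable $\zeta^N_{k+1}$ is Binomial with parameters $N-Z^N_k-1$ and $c/N$. $[\cdot]$ denotes the integer part. $D_E[0,1]$ is the space of càdlàg functions from $[0,1]$ to $E=[0,1]$ with the Skorohod topology. A rate function is good if its sublevel sets are compact. *)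

theory Defs
  imports "HOL-Probability.Probability"
begin

section \<open>The Skorohod space of cadlag functions from [0,1] to [0,1]\<close>

text \<open>Functions on [0,1] are represented as extensional functions on the reals, so that equality
  in the type is equality on [0,1].\<close>

definition cadlag_functions :: "(real \<Rightarrow> real) set" where
  "cadlag_functions =
     {f \<in> {0..1} \<rightarrow>\<^sub>E {0..1}.
        (\<forall>t\<in>{0..<1}. (f \<longlongrightarrow> f t) (at_right t)) \<and>
        (\<forall>t\<in>{0<..1}. \<exists>l. (f \<longlongrightarrow> l) (at_left t))}"

typedef cadlag = cadlag_functions
  morphisms path_of Abs_cadlag
proof
  show "restrict (\<lambda>_. 0) {0..1} \<in> cadlag_functions"
    unfolding cadlag_functions_def
  proof (intro CollectI conjI ballI)
    show "restrict (\<lambda>_. 0) {0..1} \<in> {0..1} \<rightarrow>\<^sub>E {0..1::real}" by auto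
    fix t :: real assume t: "t \<in> {0..<1}"
    have "\<forall>\<^sub>F s in at_right t. s \<in> {t<..<1}"
      using t by (intro eventually_at_right_real) auto
    then have "\<forall>\<^sub>F s in at_right t. restrict (\<lambda>_. 0::real) {0..1} s = 0"
      by eventually_elim (use t in auto)
    then have "((restrict (\<lambda>_. 0::real) {0..1}) \<longlongrightarrow> 0) (at_right t)"
      by (rule tendsto_eventually)
    then show "((restrict (\<lambda>_. 0::real) {0..1}) \<longlongrightarrow> restrict (\<lambda>_. 0) {0..1} t) (at_right t)"
      using t by auto
  next
    fix t :: real assume t: "t \<in> {0<..1}"
    have "\<forall>\<^sub>F s in at_left t. s \<in> {0<..<t}"
      using t by (intro eventually_at_left_real) auto
    then have "\<forall>\<^sub>F s in at_left t. restrict (\<lambda>_. 0::real) {0..1} s = 0"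
      by eventually_elim (use t in auto)
    then show "\<exists>l. ((restrict (\<lambda>_. 0::real) {0..1}) \<longlongrightarrow> l) (at_left t)"
      using tendsto_eventually by blast
  qed
qed

definition time_change :: "(real \<Rightarrow> real) \<Rightarrow> bool" where
  "time_change \<tau> \<longleftrightarrow>
     \<tau> 0 = 0 \<and> \<tau> 1 = 1 \<and> strict_mono_on {0..1} \<tau> \<and> continuous_on {0..1} \<tau>"

definition skorohod_within :: "(real \<Rightarrow> real) \<Rightarrow> (real \<Rightarrow> real) \<Rightarrow> real \<Rightarrow> bool" where
  "skorohod_within f g e \<longleftrightarrow>
     (\<exists>\<tau>. time_change \<tau> \<and> (\<forall>t\<in>{0..1}. \<bar>\<tau> t - t\<bar> \<le> e \<and> \<bar>f t - g (\<tau> t)\<bar> \<le> e))"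

definition skorohod_dist :: "(real \<Rightarrow> real) \<Rightarrow> (real \<Rightarrow> real) \<Rightarrow> real" where
  "skorohod_dist f g = Inf {e. skorohod_within f g e}"

lemma skorohod_within_nonneg: "skorohod_within f g e \<Longrightarrow> 0 \<le> e"
  unfolding skorohod_within_def by (meson abs_ge_zero atLeastAtMost_iff order.refl order_trans zero_le_one)

lemma skorohod_bdd: "bdd_below {e. skorohod_within f g e}"
  by (rule bdd_belowI[of _ 0]) (auto dest: skorohod_within_nonneg)

lemma time_change_id: "time_change (\<lambda>t. t)"
  by (auto simp: time_change_def strict_mono_on_def)

lemma time_change_mem:
  assumes "time_change \<tau>" "t \<in> {0..1}" shows "\<tau> t \<in> {0..1}"
proof -
  have m: "mono_on {0..1} \<tau>" using assms strict_mono_on_imp_mono_on unfolding time_change_def by blast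
  show ?thesis using assms mono_onD[OF m, of 0 t] mono_onD[OF m, of t 1] by (auto simp: time_change_def)
qed

lemma time_change_comp:
  assumes "time_change \<sigma>" "time_change \<tau>" shows "time_change (\<lambda>t. \<tau> (\<sigma> t))"
proof -
  have "continuous_on {0..1} (\<lambda>t. \<tau> (\<sigma> t))"
  proof (rule continuous_on_compose2[of "{0..1}" \<tau>])
    show "continuous_on {0..1} \<tau>" "continuous_on {0..1} \<sigma>"
      using assms by (auto simp: time_change_def)
    show "\<sigma> ` {0..1} \<subseteq> {0..1}" using time_change_mem[OF assms(1)] by blast
  qed
  moreover have "strict_mono_on {0..1} (\<lambda>t. \<tau> (\<sigma> t))"
    using assms time_change_mem[OF assms(1)] unfolding time_change_def strict_mono_on_def by blast
  ultimately show ?thesis using assms by (auto simp: time_change_def)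
qed

lemma time_change_image:
  assumes "time_change \<tau>" shows "\<tau> ` {0..1} = {0..1}"
proof
  show "\<tau> ` {0..1} \<subseteq> {0..1}" using time_change_mem[OF assms] by blast
  show "{0..1} \<subseteq> \<tau> ` {0..1}"
  proof
    fix y :: real assume "y \<in> {0..1}"
    then have "\<exists>x\<ge>0. x \<le> 1 \<and> \<tau> x = y"
      using assms by (intro IVT') (auto simp: time_change_def)
    then show "y \<in> \<tau> ` {0..1}" by auto
  qed
qed

lemma time_change_inverse:
  assumes "time_change \<tau>"
  obtains \<sigma> where "time_change \<sigma>" "\<And>t. t \<in> {0..1} \<Longrightarrow> \<tau> (\<sigma> t) = t"
proof -
  have inj: "inj_on \<tau> {0..1}"
    using assms strict_mono_on_imp_inj_on unfolding time_change_def by blast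
  define \<sigma> where "\<sigma> = the_inv_into {0..1} \<tau>"
  have im: "\<tau> ` {0..1} = {0..1}" by (rule time_change_image[OF assms])
  have right: "\<tau> (\<sigma> t) = t" if "t \<in> {0..1}" for t
    using f_the_inv_into_f[OF inj, of t] im that by (simp add: \<sigma>_def)
  have left: "\<sigma> (\<tau> t) = t" if "t \<in> {0..1}" for t
    using the_inv_into_f_f[OF inj that] by (simp add: \<sigma>_def)
  have mem: "\<sigma> t \<in> {0..1}" if "t \<in> {0..1}" for t
    using the_inv_into_into[OF inj, of t "{0..1}"] im that by (simp add: \<sigma>_def)
  have "continuous_on (\<tau> ` {0..1}) \<sigma>"
    using assms left by (intro continuous_on_inv) (auto simp: time_change_def)
  moreover have "strict_mono_on {0..1} \<sigma>"
  proof (rule strict_mono_onI)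
    fix r s :: real assume rs: "r \<in> {0..1}" "s \<in> {0..1}" "r < s"
    have m: "mono_on {0..1} \<tau>" using assms strict_mono_on_imp_mono_on unfolding time_change_def by blast
    show "\<sigma> r < \<sigma> s"
    proof (rule ccontr)
      assume "\<not> \<sigma> r < \<sigma> s"
      then have "\<tau> (\<sigma> s) \<le> \<tau> (\<sigma> r)" using mono_onD[OF m mem mem] rs by auto
      then show False using right rs by auto
    qed
  qed
  moreover have "\<sigma> 0 = 0" "\<sigma> 1 = 1" using left[of 0] left[of 1] assms by (auto simp: time_change_def)
  ultimately have "time_change \<sigma>" using im by (simp add: time_change_def)
  then show thesis using right that by blast
qed

lemma skorohod_within_refl: "skorohod_within f f 0"
  unfolding skorohod_within_def using time_change_id by (intro exI[of _ "\<lambda>t. t"]) auto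

lemma skorohod_within_sym:
  assumes "skorohod_within f g e" shows "skorohod_within g f e"
proof -
  obtain \<tau> where \<tau>: "time_change \<tau>" "\<And>t. t\<in>{0..1} \<Longrightarrow> \<bar>\<tau> t - t\<bar> \<le> e \<and> \<bar>f t - g (\<tau> t)\<bar> \<le> e"
    using assms unfolding skorohod_within_def by blast
  obtain \<sigma> where \<sigma>: "time_change \<sigma>" "\<And>t. t \<in> {0..1} \<Longrightarrow> \<tau> (\<sigma> t) = t"
    using time_change_inverse[OF \<tau>(1)] by blast
  have "\<bar>\<sigma> t - t\<bar> \<le> e \<and> \<bar>g t - f (\<sigma> t)\<bar> \<le> e" if "t \<in> {0..1}" for t
    using \<tau>(2)[OF time_change_mem[OF \<sigma>(1) that]] \<sigma>(2)[OF that] by (simp add: abs_minus_commute)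
  then show ?thesis using \<sigma>(1) unfolding skorohod_within_def by blast
qed

lemma skorohod_within_trans:
  assumes "skorohod_within f g a" "skorohod_within g h b" shows "skorohod_within f h (a + b)"
proof -
  obtain \<sigma> where \<sigma>: "time_change \<sigma>" "\<And>t. t\<in>{0..1} \<Longrightarrow> \<bar>\<sigma> t - t\<bar> \<le> a \<and> \<bar>f t - g (\<sigma> t)\<bar> \<le> a"
    using assms unfolding skorohod_within_def by blast
  obtain \<tau> where \<tau>: "time_change \<tau>" "\<And>t. t\<in>{0..1} \<Longrightarrow> \<bar>\<tau> t - t\<bar> \<le> b \<and> \<bar>g t - h (\<tau> t)\<bar> \<le> b"
    using assms unfolding skorohod_within_def by blast
  have "\<bar>\<tau> (\<sigma> t) - t\<bar> \<le> a + b \<and> \<bar>f t - h (\<tau> (\<sigma> t))\<bar> \<le> a + b" if "t \<in> {0..1}" for t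
    using \<sigma>(2)[OF that] \<tau>(2)[OF time_change_mem[OF \<sigma>(1) that]] by linarith
  then show ?thesis using time_change_comp[OF \<sigma>(1) \<tau>(1)] unfolding skorohod_within_def
    by (intro exI[of _ "\<lambda>t. \<tau> (\<sigma> t)"]) auto
qed

lemma skorohod_within_1:
  assumes "f \<in> cadlag_functions" "g \<in> cadlag_functions" shows "skorohod_within f g 1"
  unfolding skorohod_within_def
proof (intro exI[of _ "\<lambda>t. t"] conjI ballI time_change_id)
  fix t :: real assume "t \<in> {0..1}"
  then have "f t \<in> {0..1}" "g t \<in> {0..1}" using assms by (auto simp: cadlag_functions_def PiE_iff)
  then show "\<bar>f t - g t\<bar> \<le> 1" by auto
qed auto

lemma skorohod_dist_less_iff:
  assumes "f \<in> cadlag_functions" "g \<in> cadlag_functions"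
  shows "skorohod_dist f g < e \<longleftrightarrow> (\<exists>d<e. skorohod_within f g d)"
  unfolding skorohod_dist_def
  using skorohod_within_1[OF assms] skorohod_bdd by (subst cInf_less_iff) auto

lemma skorohod_dist_nonneg:
  assumes "f \<in> cadlag_functions" "g \<in> cadlag_functions"
  shows "0 \<le> skorohod_dist f g"
  unfolding skorohod_dist_def
  using skorohod_within_1[OF assms] skorohod_within_nonneg by (intro cInf_greatest) auto

lemma skorohod_dist_sym: "skorohod_dist f g = skorohod_dist g f"
proof -
  have "skorohod_within f g = skorohod_within g f" using skorohod_within_sym by blast
  then show ?thesis by (simp add: skorohod_dist_def)
qed

lemma skorohod_dist_triangle:
  assumes "f \<in> cadlag_functions" "g \<in> cadlag_functions" "h \<in> cadlag_functions"
  shows "skorohod_dist f h \<le> skorohod_dist f g + skorohod_dist g h"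
proof (rule field_le_epsilon)
  fix e :: real assume "e > 0"
  obtain a where a: "a < skorohod_dist f g + e/2" "skorohod_within f g a"
    using skorohod_dist_less_iff[OF assms(1,2), of "skorohod_dist f g + e/2"] \<open>e > 0\<close> by auto
  obtain b where b: "b < skorohod_dist g h + e/2" "skorohod_within g h b"
    using skorohod_dist_less_iff[OF assms(2,3), of "skorohod_dist g h + e/2"] \<open>e > 0\<close> by auto
  have "skorohod_dist f h \<le> a + b"
    unfolding skorohod_dist_def
    using skorohod_within_trans[OF a(2) b(2)] skorohod_bdd by (intro cInf_lower) auto
  then show "skorohod_dist f h \<le> skorohod_dist f g + skorohod_dist g h + e" using a b by linarith
qed

text \<open>If the distance vanishes, then every value of f is a value or a left limit of g; hence f and g
  agree by right continuity.\<close>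

lemma skorohod_dist_zero_near:
  assumes fg: "f \<in> cadlag_functions" "g \<in> cadlag_functions" and z: "skorohod_dist f g = 0"
    and t: "t \<in> {0..1}" and e: "e > 0"
  shows "\<exists>u\<in>{0..1}. \<bar>u - t\<bar> < e \<and> \<bar>f t - g u\<bar> < e"
proof -
  obtain d where "d < e" "skorohod_within f g d"
    using skorohod_dist_less_iff[OF fg, of e] z e by auto
  then obtain \<tau> where "time_change \<tau>" "\<bar>\<tau> t - t\<bar> \<le> d" "\<bar>f t - g (\<tau> t)\<bar> \<le> d"
    using t unfolding skorohod_within_def by blast
  then show ?thesis using time_change_mem[of \<tau> t] t \<open>d < e\<close> by (intro bexI[of _ "\<tau> t"]) auto
qed

lemma skorohod_dist_zero:
  assumes fg: "f \<in> cadlag_functions" "g \<in> cadlag_functions" and z: "skorohod_dist f g = 0"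
  shows "f = g"
proof -
  have "f t = g t" if t: "t \<in> {0..1}" for t
  proof (cases "t = 1")
    case True
    show ?thesis
    proof (rule ccontr)
      assume ne: "f t \<noteq> g t"
      then have "0 < \<bar>f t - g t\<bar>" by simp
      then obtain d where d: "d < \<bar>f t - g t\<bar>" "skorohod_within f g d"
        using skorohod_dist_less_iff[OF fg] z by metis
      then obtain \<tau> where "time_change \<tau>" "\<bar>f t - g (\<tau> t)\<bar> \<le> d"
        using t unfolding skorohod_within_def by blast
      then show False using d True by (auto simp: time_change_def)
    qed
  next
    case False
    then have t1: "t \<in> {0..<1}" using t by auto
    have lf: "(f \<longlongrightarrow> f t) (at_right t)" and lg: "(g \<longlongrightarrow> g t) (at_right t)"
      using fg t1 by (auto simp: cadlag_functions_def)
    have "\<bar>f t - g t\<bar> \<le> e" if "e > 0" for e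
    proof -
      have "\<forall>\<^sub>F s in at_right t. dist (f s) (f t) < e/4" "\<forall>\<^sub>F s in at_right t. dist (g s) (g t) < e/4"
        using tendstoD[OF lf, of "e/4"] tendstoD[OF lg, of "e/4"] \<open>e > 0\<close> by auto
      then have "\<forall>\<^sub>F s in at_right t. dist (f s) (f t) < e/4 \<and> dist (g s) (g t) < e/4"
        by (rule eventually_conj)
      then obtain b where b: "b > t"
        "\<And>s. t < s \<Longrightarrow> s < b \<Longrightarrow> dist (f s) (f t) < e/4 \<and> dist (g s) (g t) < e/4"
        unfolding eventually_at_right_field by blast
      define b' where "b' = min b 1"
      define s where "s = (t + b') / 2"
      have s: "t < s" "s < b'" "b' \<le> b" "b' \<le> 1" using b(1) t1 by (auto simp: s_def b'_def)
      define r where "r = min (e/4) (min (s - t) (b' - s))"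
      have r: "r > 0" "r \<le> e/4" "r \<le> s - t" "r \<le> b' - s" using s \<open>e > 0\<close> unfolding r_def by linarith+
      obtain u where u: "\<bar>u - s\<bar> < r" "\<bar>f s - g u\<bar> < r"
        using skorohod_dist_zero_near[OF fg z, of s r] s t1 r(1) by auto
      have "t < u" "u < b" using u(1) r s by linarith+
      then have "dist (g u) (g t) < e/4" using b(2) by blast
      moreover have "dist (f s) (f t) < e/4" using b(2)[of s] s by auto
      ultimately show ?thesis using u(2) r(2) \<open>e > 0\<close> unfolding dist_real_def by linarith
    qed
    then have "\<bar>f t - g t\<bar> \<le> 0" by (rule field_le_epsilon[of _ 0, simplified]) 
    then show ?thesis by simp
  qed
  then show ?thesis
    using fg PiE_ext[of f "{0..1}" "\<lambda>_. {0..1}" g] by (auto simp: cadlag_functions_def)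
qed

instantiation cadlag :: metric_space
begin

definition dist_cadlag :: "cadlag \<Rightarrow> cadlag \<Rightarrow> real" where
  "dist_cadlag \<phi> \<psi> = skorohod_dist (path_of \<phi>) (path_of \<psi>)"

definition uniformity_cadlag :: "(cadlag \<times> cadlag) filter" where
  "uniformity_cadlag = (INF e\<in>{0 <..}. principal {(x, y). dist x y < e})"

definition open_cadlag :: "cadlag set \<Rightarrow> bool" where
  "open_cadlag U \<longleftrightarrow> (\<forall>x\<in>U. eventually (\<lambda>(x', y). x' = x \<longrightarrow> y \<in> U) uniformity)"

instance
proof
  fix x y z :: cadlag
  have "skorohod_dist (path_of x) (path_of x) = 0"
  proof -
    have "skorohod_dist (path_of x) (path_of x) \<le> 0"
      unfolding skorohod_dist_def using skorohod_within_refl skorohod_bdd by (intro cInf_lower) auto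
    then show ?thesis using skorohod_dist_nonneg[OF path_of path_of, of x x] by linarith
  qed
  then show "dist x y = 0 \<longleftrightarrow> x = y"
    unfolding dist_cadlag_def using skorohod_dist_zero[OF path_of path_of, of x y]
    by (auto simp: path_of_inject)
  show "dist x y \<le> dist x z + dist y z"
    unfolding dist_cadlag_def
    using skorohod_dist_triangle[OF path_of path_of path_of, of x y z]
      skorohod_dist_sym[of "path_of y" "path_of z"] by simp
qed (auto simp: uniformity_cadlag_def open_cadlag_def)

end


section \<open>Large deviation principles\<close>

definition ereal_log :: "real \<Rightarrow> ereal" where
  "ereal_log p = (if p = 0 then - \<infinity> else ereal (ln p))"

definition rate_function :: "('a::topological_space \<Rightarrow> ennreal) \<Rightarrow> bool" where
  "rate_function I \<longleftrightarrow> (\<forall>\<alpha>::real. 0 \<le> \<alpha> \<longrightarrow> closed {x. I x \<le> ennreal \<alpha>})"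

definition good_rate_function :: "('a::topological_space \<Rightarrow> ennreal) \<Rightarrow> bool" where
  "good_rate_function I \<longleftrightarrow>
     rate_function I \<and> (\<forall>\<alpha>::real. 0 \<le> \<alpha> \<longrightarrow> compact {x. I x \<le> ennreal \<alpha>})"

text \<open>The infimum over the empty set is infinite.\<close>

definition large_deviation_principle ::
    "(nat \<Rightarrow> real) \<Rightarrow> (nat \<Rightarrow> 'a::topological_space measure) \<Rightarrow> ('a \<Rightarrow> ennreal) \<Rightarrow> bool" where
  "large_deviation_principle a \<mu> I \<longleftrightarrow>
     filterlim a at_top sequentially \<and>
     (\<forall>n. prob_space (\<mu> n) \<and> sets (\<mu> n) = sets borel) \<and>
     rate_function I \<and>
     (\<forall>F. closed F \<longrightarrow>
        limsup (\<lambda>n. ereal (1 / a n) * ereal_log (measure (\<mu> n) F)) \<le> - enn2ereal (INF x\<in>F. I x)) \<and>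
     (\<forall>G. open G \<longrightarrow>
        - enn2ereal (INF x\<in>G. I x) \<le> liminf (\<lambda>n. ereal (1 / a n) * ereal_log (measure (\<mu> n) G)))"


section \<open>Greedy exploration of the random graph\<close>

type_synonym edges = "nat set set"

text \<open>The vertices are the numbers below N, the possible edges the two-element sets of vertices.
  For p outside [0,1] the library clamps the Bernoulli parameter to [0,1]; with p = c/N this
  concerns only the finitely many N < c.\<close>

definition random_graph :: "nat \<Rightarrow> real \<Rightarrow> edges pmf" where
  "random_graph N p =
     map_pmf (\<lambda>X. {e. X e})
       (Pi_pmf {e. e \<subseteq> {..<N} \<and> card e = 2} False (\<lambda>_. bernoulli_pmf p))"

definition neighbours :: "edges \<Rightarrow> nat \<Rightarrow> nat set" where
  "neighbours E v = {w. {v, w} \<in> E}"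

text \<open>A state consists of the active and the blocked vertices.\<close>

type_synonym state = "nat set \<times> nat set"

definition explored :: "state \<Rightarrow> nat set" where
  "explored s = fst s \<union> snd s"

definition greedy_step :: "nat \<Rightarrow> edges \<Rightarrow> state \<Rightarrow> state pmf" where
  "greedy_step N E s =
     (if explored s = {..<N} then return_pmf s
      else map_pmf (\<lambda>v. (insert v (fst s), snd s \<union> (neighbours E v - explored s)))
             (pmf_of_set ({..<N} - explored s)))"

text \<open>The law, given the graph, of the list of states after steps 0 to k.\<close>

primrec greedy_run :: "nat \<Rightarrow> edges \<Rightarrow> nat \<Rightarrow> state list pmf" where
  "greedy_run N E 0 = return_pmf [({}, {})]"
| "greedy_run N E (Suc k) =
     bind_pmf (greedy_run N E k)
       (\<lambda>ss. map_pmf (\<lambda>s. ss @ [s]) (greedy_step N E (last ss)))"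

text \<open>Only the first N steps matter for the rescaled process on [0,1].\<close>

definition greedy_exploration :: "nat \<Rightarrow> real \<Rightarrow> state list pmf" where
  "greedy_exploration N c = bind_pmf (random_graph N (c / real N)) (\<lambda>E. greedy_run N E N)"

definition Z :: "state list \<Rightarrow> nat \<Rightarrow> nat" where
  "Z ss k = card (explored (ss ! k))"

definition Y_fun :: "nat \<Rightarrow> state list \<Rightarrow> real \<Rightarrow> real" where
  "Y_fun N ss = (\<lambda>t\<in>{0..1}. real (Z ss (nat \<lfloor>real N * t\<rfloor>)) / real N)"

definition Y :: "nat \<Rightarrow> state list \<Rightarrow> cadlag" where
  "Y N ss = Abs_cadlag (Y_fun N ss)"

definition law_Y :: "real \<Rightarrow> nat \<Rightarrow> cadlag measure" where
  "law_Y c N = distr (measure_pmf (greedy_exploration N c)) borel (Y N)"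

text \<open>Almost surely the rescaled path is an element of the Skorohod space, so that the use of the
  abstraction function above is legitimate.\<close>

lemma finite_possible_edges: "finite {e::nat set. e \<subseteq> {..<N} \<and> card e = 2}"
  by (rule finite_subset[of _ "Pow {..<N}"]) auto

lemma random_graph_edges:
  assumes "E \<in> set_pmf (random_graph N p)" "e \<in> E" shows "e \<subseteq> {..<N} \<and> card e = 2"
proof -
  obtain X where X: "E = {e. X e}"
    "X \<in> set_pmf (Pi_pmf {e. e \<subseteq> {..<N} \<and> card e = 2} False (\<lambda>_. bernoulli_pmf p))"
    using assms(1) by (auto simp: random_graph_def)
  then have "\<And>e. e \<notin> {e. e \<subseteq> {..<N} \<and> card e = 2} \<Longrightarrow> X e = False"
    using set_Pi_pmf_subset[OF finite_possible_edges, of N False "\<lambda>_. bernoulli_pmf p"] by auto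
  then show ?thesis using X(1) assms(2) by blast
qed

lemma greedy_step_explored:
  assumes "\<And>e. e \<in> E \<Longrightarrow> e \<subseteq> {..<N}" "explored s \<subseteq> {..<N}" "s' \<in> set_pmf (greedy_step N E s)"
  shows "explored s' \<subseteq> {..<N}"
proof (cases "explored s = {..<N}")
  case True
  then show ?thesis using assms by (auto simp: greedy_step_def)
next
  case False
  then have "{..<N} - explored s \<noteq> {}" using assms(2) by auto
  then obtain v where v: "v \<in> {..<N} - explored s"
    "s' = (insert v (fst s), snd s \<union> (neighbours E v - explored s))"
    using assms(3) False by (auto simp: greedy_step_def)
  have "neighbours E v \<subseteq> {..<N}" using assms(1) by (auto simp: neighbours_def)
  then show ?thesis using v assms(2) by (auto simp: explored_def)
qed

lemma greedy_run_explored: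
  assumes "\<And>e. e \<in> E \<Longrightarrow> e \<subseteq> {..<N}" "ss \<in> set_pmf (greedy_run N E k)"
  shows "length ss = Suc k \<and> (\<forall>s\<in>set ss. explored s \<subseteq> {..<N})"
  using assms(2)
proof (induction k arbitrary: ss)
  case 0
  then show ?case by (auto simp: explored_def)
next
  case (Suc k)
  then obtain rs s where rs: "rs \<in> set_pmf (greedy_run N E k)" "s \<in> set_pmf (greedy_step N E (last rs))"
    "ss = rs @ [s]" by auto
  have *: "length rs = Suc k \<and> (\<forall>s\<in>set rs. explored s \<subseteq> {..<N})" using Suc.IH[OF rs(1)] .
  then have "last rs \<in> set rs" by (intro last_in_set) auto
  then have "explored s \<subseteq> {..<N}" using greedy_step_explored[OF assms(1) _ rs(2)] * by blast
  then show ?case using * rs(3) by auto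
qed

lemma Y_fun_cadlag:
  assumes "\<And>k. k \<le> N \<Longrightarrow> Z ss k \<le> N"
  shows "Y_fun N ss \<in> cadlag_functions"
proof -
  define h where "h i = real (Z ss (nat i)) / real N" for i :: int
  have Y: "Y_fun N ss t = h \<lfloor>real N * t\<rfloor>" if "t \<in> {0..1}" for t
    using that by (simp add: Y_fun_def h_def)
  show ?thesis
    unfolding cadlag_functions_def
  proof (intro CollectI conjI ballI)
    have "h \<lfloor>real N * t\<rfloor> \<in> {0..1}" if "t \<in> {0..1}" for t
    proof -
      have "real N * t \<le> real N * 1" using that by (intro mult_left_mono) auto
      then have "nat \<lfloor>real N * t\<rfloor> \<le> N" by linarith
      then show ?thesis using assms by (auto simp: h_def divide_le_eq_1)
    qed
    then show "Y_fun N ss \<in> {0..1} \<rightarrow>\<^sub>E {0..1}" using Y by (auto simp: Y_fun_def h_def)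
  next
    fix t :: real assume t: "t \<in> {0..<1}"
    have "((\<lambda>s. real N * s) \<longlongrightarrow> real N * t) (at_right t)" by (intro tendsto_intros)
    moreover have "real N * t < of_int \<lfloor>real N * t\<rfloor> + 1" by linarith
    ultimately have "\<forall>\<^sub>F s in at_right t. real N * s < of_int \<lfloor>real N * t\<rfloor> + 1"
      by (rule order_tendstoD(2))
    moreover have "\<forall>\<^sub>F s in at_right t. s \<in> {t<..<1}"
      using t by (intro eventually_at_right_real) auto
    ultimately have "\<forall>\<^sub>F s in at_right t. Y_fun N ss s = Y_fun N ss t"
    proof eventually_elim
      case (elim s)
      have "real N * t \<le> real N * s" using elim by (intro mult_left_mono) auto
      then have "\<lfloor>real N * s\<rfloor> = \<lfloor>real N * t\<rfloor>" using elim by linarith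
      then show ?case using Y[of s] Y[of t] elim t by auto
    qed
    then show "(Y_fun N ss \<longlongrightarrow> Y_fun N ss t) (at_right t)" by (rule tendsto_eventually)
  next
    fix t :: real assume t: "t \<in> {0<..1}"
    show "\<exists>l. (Y_fun N ss \<longlongrightarrow> l) (at_left t)"
    proof (cases "N = 0")
      case True
      have "\<forall>\<^sub>F s in at_left t. s \<in> {0<..<t}"
        using t by (intro eventually_at_left_real) auto
      then have "\<forall>\<^sub>F s in at_left t. Y_fun N ss s = 0"
        by eventually_elim (use t True in \<open>auto simp: Y_fun_def\<close>)
      then show ?thesis using tendsto_eventually by blast
    next
      case False
      have "((\<lambda>s. real N * s) \<longlongrightarrow> real N * t) (at_left t)" by (intro tendsto_intros)
      moreover have "of_int (\<lceil>real N * t\<rceil> - 1) < real N * t" by linarith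
      ultimately have "\<forall>\<^sub>F s in at_left t. of_int (\<lceil>real N * t\<rceil> - 1) < real N * s"
        by (rule order_tendstoD(1))
      moreover have "\<forall>\<^sub>F s in at_left t. s \<in> {0<..<t}"
        using t by (intro eventually_at_left_real) auto
      ultimately have "\<forall>\<^sub>F s in at_left t. Y_fun N ss s = h (\<lceil>real N * t\<rceil> - 1)"
      proof eventually_elim
        case (elim s)
        have "real N * s < real N * t" using elim False by (intro mult_strict_left_mono) auto
        then have "\<lfloor>real N * s\<rfloor> = \<lceil>real N * t\<rceil> - 1" using elim by linarith
        then show ?case using Y[of s] elim t by auto
      qed
      then show ?thesis using tendsto_eventually by blast
    qed
  qed
qed

lemma path_of_Y:
  assumes "ss \<in> set_pmf (greedy_exploration N c)"
  shows "path_of (Y N ss) = Y_fun N ss"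
proof -
  obtain E where E: "E \<in> set_pmf (random_graph N (c / real N))" "ss \<in> set_pmf (greedy_run N E N)"
    using assms by (auto simp: greedy_exploration_def)
  have *: "length ss = Suc N \<and> (\<forall>s\<in>set ss. explored s \<subseteq> {..<N})"
    using random_graph_edges[OF E(1)] by (intro greedy_run_explored[OF _ E(2)]) blast
  have "Z ss k \<le> N" if "k \<le> N" for k
  proof -
    have "explored (ss ! k) \<subseteq> {..<N}" using * that by auto
    then show ?thesis using card_mono[of "{..<N}" "explored (ss ! k)"] by (simp add: Z_def)
  qed
  then show ?thesis unfolding Y_def by (intro Abs_cadlag_inverse Y_fun_cadlag)
qed


section \<open>The rate function\<close>

text \<open>The real number in the first case is nonnegative by the lemma below, so no truncation takes
  place.\<close>

definition L :: "real \<Rightarrow> real \<Rightarrow> real \<Rightarrow> ennreal" where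
  "L c x \<beta> =
     (if x < 1 \<and> \<beta> > 1 then ennreal ((\<beta> - 1) * (ln ((\<beta> - 1) / (c * (1 - x))) - 1) + c * (1 - x))
      else if x < 1 \<and> \<beta> = 1 then ennreal (c * (1 - x))
      else if x = 1 \<and> \<beta> = 0 then 0
      else \<infinity>)"

lemma L_nonneg:
  fixes c x \<beta> :: real
  assumes "c > 0" "x < 1" "\<beta> > 1"
  shows "0 \<le> (\<beta> - 1) * (ln ((\<beta> - 1) / (c * (1 - x))) - 1) + c * (1 - x)"
proof -
  define u where "u = \<beta> - 1"
  define v where "v = c * (1 - x)"
  have uv: "u > 0" "v > 0" using assms by (auto simp: u_def v_def)
  have "ln (v / u) \<le> v / u - 1" using uv by (intro ln_le_minus_one) auto
  then have "u * ln (v / u) \<le> u * (v / u - 1)" using uv by (intro mult_left_mono) auto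
  also have "\<dots> = v - u" using uv by (simp add: field_simps)
  finally have "0 \<le> u * (ln (u / v) - 1) + v" using uv by (simp add: ln_div algebra_simps)
  then show ?thesis by (simp add: u_def v_def)
qed

definition absolutely_continuous_fun :: "real \<Rightarrow> real \<Rightarrow> (real \<Rightarrow> real) \<Rightarrow> bool" where
  "absolutely_continuous_fun u v f \<longleftrightarrow>
     (\<forall>\<epsilon>>0. \<exists>\<delta>>0. \<forall>(n::nat) a b.
        (\<forall>i<n. u \<le> a i \<and> a i \<le> b i \<and> b i \<le> v) \<longrightarrow>
        disjoint_family_on (\<lambda>i. {a i<..<b i}) {..<n} \<longrightarrow>
        (\<Sum>i<n. b i - a i) < \<delta> \<longrightarrow> (\<Sum>i<n. \<bar>f (b i) - f (a i)\<bar>) < \<epsilon>)"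

text \<open>An absolutely continuous function is differentiable almost everywhere; the values of the total
  operator \<^const>\<open>deriv\<close> at the other points do not affect the Lebesgue integral.\<close>

definition Lagrangian_along :: "real \<Rightarrow> cadlag \<Rightarrow> real \<Rightarrow> ennreal" where
  "Lagrangian_along c \<phi> t = L c (path_of \<phi> t) (deriv (path_of \<phi>) t)"

definition H_L :: "real \<Rightarrow> cadlag set" where
  "H_L c = {\<phi>. absolutely_continuous_fun 0 1 (path_of \<phi>) \<and> path_of \<phi> 0 = 0 \<and>
               Lagrangian_along c \<phi> \<in> borel_measurable (lebesgue_on {0..1}) \<and>
               (\<integral>\<^sup>+ t. Lagrangian_along c \<phi> t \<partial>lebesgue_on {0..1}) < \<infinity>}"

definition rate_I :: "real \<Rightarrow> cadlag \<Rightarrow> ennreal" where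
  "rate_I c \<phi> =
     (if \<phi> \<in> H_L c then \<integral>\<^sup>+ t. Lagrangian_along c \<phi> t \<partial>lebesgue_on {0..1} else \<infinity>)"

end

theory Submission
  imports Defs
begin

text \<open>The number of explored vertices is a Markov chain: at every step the edges between unexplored
  vertices are still independent of the past. An upper and a lower bound on its \<open>n\<close>-step transition
  probabilities, the former by an exponential Chebyshev argument and the latter by Vandermonde's identity,
  agree to first exponential order, so the probability of prescribed values at the dyadic times
  \<open>i / 2^r\<close> decays at a rate given by the Legendre transform of the Poisson cumulants.

  All of the analysis goes through the resulting inequality, called \<open>dyadic_bound\<close> below, which is closed under
  pointwise limits. By Jensen's inequality (in dual form) every path with \<open>I(\<phi>) \<le> \<alpha>\<close> satisfies it;
  conversely a monotone function that satisfies it is absolutely continuous, and Fatou's lemma together with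
  Lebesgue's differentiation theorem gives \<open>I(\<phi>) \<le> \<alpha>\<close>. Helly's selection principle then yields
  both the compactness of the sublevel sets and the upper bound, without a separate proof of exponential
  tightness. For the lower bound it suffices to follow \<open>\<phi>\<close> up to a level close to 1: the process is monotone and
  bounded by 1, so it stays close to \<open>\<phi>\<close> afterwards.\<close>

section \<open>Lebesgue differentiation\<close>

text \<open>The dual form of the block costs lets one inequality serve both bounds: for fixed tilts
  \<open>\<theta>\<close> it involves finitely many values of the path and is continuous in them,
  whereas the primal cost contains a logarithm and jumps to infinity at slopes below 1. What has to
  be paid for is that \<open>1 - f\<close>, the share of vertices that can still be blocked, changes
  within a block. Paths are monotone, so freezing it costs at most \<open>c / 2^r\<close> times the
  increment over the block, and these errors telescope to \<open>c / 2^r\<close>. The singular point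
  is level 1: below it slopes are at least 1, at it the only slope of finite cost is 0, and near it
  the cost of a jump involves \<open>ln (1 - f)\<close>. The lower bound therefore stops at a level
  \<open>1 - \<eta>\<close>, which keeps this logarithm under control. Since the rate uses the
  pointwise \<open>deriv\<close>, absolutely continuous functions have to be differentiated almost
  everywhere. Differentiation is stated for all small intervals that contain the point, because a
  dyadic cell around \<open>t\<close> is in general neither centred at \<open>t\<close> nor has
  \<open>t\<close> as an end.\<close>

lemma negligible_of_upper_density:
  fixes M :: "real measure"
  assumes fin: "finite_measure M" and sets: "sets M = sets borel"
    and A: "A \<in> sets borel" "emeasure M A = 0"
    and k: "k > 0" and SA: "S \<subseteq> A"
    and dens: "\<And>x e. x \<in> S \<Longrightarrow> e > 0 \<Longrightarrow> \<exists>r. 0 < r \<and> r < e \<and> measure M (ball x r) > k * r"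
  shows "negligible S"
  unfolding negligible_outer_le
proof (intro allI impI)
  interpret M: finite_measure M by (rule fin)
  have spaceM: "space M = UNIV" using sets_eq_imp_space_eq[OF sets] by simp
  fix e :: real assume e: "e > 0"
  have "(INF U\<in>{U. A \<subseteq> U \<and> open U}. emeasure M U) = 0"
    using outer_regular[OF sets _ A(1)] A(2) M.emeasure_finite by (simp add: spaceM)
  \<comment> \<open>The budget \<open>k * e / 2\<close> is dictated by the Vitali covering below: a
    ball of radius \<open>r\<close> in the family has length \<open>2 * r\<close>, less than
    \<open>2 / k\<close> times its mass, so disjoint balls inside \<open>U\<close> have total length
    at most \<open>2 / k * measure M U\<close>, hence at most \<open>e\<close>.\<close>
  then have "(INF U\<in>{U. A \<subseteq> U \<and> open U}. emeasure M U) < ennreal (k * e / 2)"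
    using k e by simp
  then obtain U where U: "A \<subseteq> U" "open U" "emeasure M U < ennreal (k * e / 2)"
    unfolding INF_less_iff by auto
  then have mU: "measure M U < k * e / 2"
    using k e by (simp add: M.emeasure_eq_measure ennreal_less_iff)
  define K where "K = {i. 0 < snd i \<and> ball (fst i) (snd i) \<subseteq> U \<and> measure M (ball (fst i) (snd i)) > k * snd i}"
  have 1: "\<exists>i. i \<in> K \<and> x \<in> ball (fst i) (snd i) \<and> snd i < d" if x: "x \<in> S" and d: "0 < d" for x d
  proof -
    obtain s where s: "s > 0" "ball x s \<subseteq> U" using U x SA openE by blast
    obtain r where r: "0 < r" "r < min d s" "measure M (ball x r) > k * r"
      using dens[OF x, of "min d s"] s d by auto
    have "ball x r \<subseteq> U" using s r by auto
    then show ?thesis using r by (intro exI[of _ "(x,r)"]) (auto simp: K_def)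
  qed
  obtain C where C: "countable C" "C \<subseteq> K"
     "pairwise (\<lambda>i j. disjnt (ball (fst i) (snd i)) (ball (fst j) (snd j))) C"
     "negligible (S - (\<Union>i \<in> C. ball (fst i) (snd i)))"
    using Vitali_covering_theorem_balls[of S K fst snd, OF 1] by blast
  let ?B = "\<lambda>i. ball (fst i) (snd i) :: real set"
  have bound: "measure lebesgue (\<Union>i\<in>D. ?B i) \<le> e" if D: "D \<subseteq> C" "finite D" for D
  proof -
    have DK: "i \<in> K" if "i \<in> D" for i using that D C by auto
    have "measure lebesgue (\<Union>i\<in>D. ?B i) \<le> (\<Sum>i\<in>D. measure lebesgue (?B i))"
      by (intro measure_UNION_le D) auto
    also have "\<dots> = (\<Sum>i\<in>D. 2 * snd i)"
    proof (intro sum.cong refl)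
      fix i assume "i \<in> D"
      then have "0 < snd i" using DK by (auto simp: K_def)
      then show "measure lebesgue (?B i) = 2 * snd i"
        by (simp add: ball_eq_greaterThanLessThan)
    qed
    also have "\<dots> \<le> (\<Sum>i\<in>D. 2 / k * measure M (?B i))"
    proof (intro sum_mono)
      fix i assume "i \<in> D"
      then have "k * snd i < measure M (?B i)" using DK by (auto simp: K_def)
      then show "2 * snd i \<le> 2 / k * measure M (?B i)" using k by (simp add: field_simps)
    qed
    also have "\<dots> = 2 / k * measure M (\<Union>i\<in>D. ?B i)"
    proof -
      have "disjoint_family_on ?B D"
        using C(3) D(1) unfolding disjoint_family_on_def pairwise_def disjnt_def by blast
      then have "measure M (\<Union>i\<in>D. ?B i) = (\<Sum>i\<in>D. measure M (?B i))"
        using D by (intro M.finite_measure_finite_Union) (auto simp: sets)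
      then show ?thesis by (simp add: sum_distrib_left)
    qed
    also have "\<dots> \<le> 2 / k * measure M U"
    proof -
      have "(\<Union>i\<in>D. ?B i) \<subseteq> U" using DK by (auto simp: K_def)
      then show ?thesis using k U(2)
        by (intro mult_left_mono M.finite_measure_mono) (auto simp: sets)
    qed
    also have "\<dots> \<le> 2 / k * (k * e / 2)" using mU k by (intro mult_left_mono) auto
    finally show ?thesis using k by simp
  qed
  let ?T = "(S - (\<Union>i \<in> C. ?B i)) \<union> (\<Union>i \<in> C. ?B i)"
  have fm: "(\<Union>i \<in> C. ?B i) \<in> lmeasurable \<and> measure lebesgue (\<Union>i \<in> C. ?B i) \<le> e"
    using fmeasurable_UN_bound[OF C(1), of ?B lebesgue e] bound
      measure_UN_bound[OF C(1), of ?B lebesgue e] by auto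
  have N: "S - (\<Union>i \<in> C. ?B i) \<in> lmeasurable" "measure lebesgue (S - (\<Union>i \<in> C. ?B i)) = 0"
    using negligible_imp_measurable[OF C(4)] negligible_imp_measure0[OF C(4)] by auto
  have "?T \<in> lmeasurable" using fm N by (intro fmeasurable.Un) blast+
  moreover have "measure lebesgue ?T \<le> measure lebesgue (S - (\<Union>i \<in> C. ?B i)) + measure lebesgue (\<Union>i \<in> C. ?B i)"
    using fm N by (intro measure_Un_le) (blast dest: fmeasurableD)+
  then have "measure lebesgue ?T \<le> e" using fm N(2) by linarith
  ultimately show "\<exists>T. S \<subseteq> T \<and> T \<in> lmeasurable \<and> measure lebesgue T \<le> e"
    by (intro exI[of _ ?T] conjI) auto
qed

text \<open>If averages near \<open>x\<close> keep exceeding \<open>g x + e\<close>, take a rational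
  \<open>p\<close> between \<open>g x\<close> and \<open>g x + e/2\<close>. The excess
  \<open>max 0 (g - p)\<close>, as a density, gives no mass to the set where
  \<open>g \<le> p\<close>, which contains \<open>x\<close>, yet has positive upper density at
  \<open>x\<close>. So the exceptional set is covered by countably many negligible sets, indexed by
  \<open>p\<close>, a density threshold and a window \<open>[-m, m]\<close>; the window makes the
  excess integrable even for negative \<open>p\<close>.\<close>

lemma Lebesgue_upper_differentiation:
  fixes g :: "real \<Rightarrow> real"
  assumes g: "integrable lborel g"
  shows "negligible {x. \<not> (\<forall>e>0. \<exists>d>0. \<forall>a b. a \<le> x \<longrightarrow> x \<le> b \<longrightarrow> a < b \<longrightarrow> b - a < d \<longrightarrow>
            (LINT u:{a..b}|lborel. g u) \<le> (g x + e) * (b - a))}" (is "negligible ?N")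
proof -
  have gm[measurable]: "g \<in> borel_measurable borel" using g by auto
  define w where "w m p u = indicator {- real m..real m} u * max 0 (g u - p)" for m :: nat and p u :: real
  have wm[measurable]: "w m p \<in> borel_measurable borel" for m p unfolding w_def by measurable
  define nu where "nu m p = density lborel (\<lambda>u. ennreal (w m p u))" for m p
  have wint: "integrable lborel (w m p)" for m p
  proof (rule Bochner_Integration.integrable_bound[where f="\<lambda>u. indicator {- real m..real m} u * (\<bar>g u\<bar> + \<bar>p\<bar>)"])
    have "integrable lborel (\<lambda>u. indicator {- real m..real m} u *\<^sub>R (\<bar>g u\<bar> + \<bar>p\<bar>))"
    proof -
      have "integrable lborel (\<lambda>u. indicator {- real m..real m} u *\<^sub>R \<bar>g u\<bar>)"
        using g by (intro integrable_mult_indicator) auto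
      moreover have "integrable lborel (\<lambda>u. indicator {- real m..real m} u *\<^sub>R \<bar>p\<bar>)"
        by (intro integrable_scaleR_left integrable_real_indicator) auto
      ultimately show ?thesis by (simp add: algebra_simps)
    qed
    then show "integrable lborel (\<lambda>u. indicator {- real m..real m} u * (\<bar>g u\<bar> + \<bar>p\<bar>))" by simp
  qed (auto simp: w_def split: split_indicator)
  have nu: "finite_measure (nu m p)" "sets (nu m p) = sets borel" for m p
  proof (rule finite_measureI)
    have "emeasure (nu m p) (space (nu m p)) = (\<integral>\<^sup>+u. ennreal (w m p u) \<partial>lborel)"
      by (simp add: nu_def emeasure_density)
    also have "\<dots> = ennreal (integral\<^sup>L lborel (w m p))"
      by (intro nn_integral_eq_integral wint) (auto simp: w_def)
    finally show "emeasure (nu m p) (space (nu m p)) \<noteq> \<infinity>" by simp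
  qed (simp add: nu_def)
  have nu_meas: "measure (nu m p) X = (LINT u:X|lborel. w m p u)" if [measurable]: "X \<in> sets borel" for m p X
  proof -
    have "emeasure (nu m p) X = (\<integral>\<^sup>+u. ennreal (w m p u) * indicator X u \<partial>lborel)"
      by (simp add: nu_def emeasure_density)
    also have "\<dots> = (\<integral>\<^sup>+u. ennreal (indicator X u *\<^sub>R w m p u) \<partial>lborel)"
      by (intro nn_integral_cong) (auto split: split_indicator)
    also have "\<dots> = ennreal (LINT u:X|lborel. w m p u)"
      unfolding set_lebesgue_integral_def
      by (intro nn_integral_eq_integral integrable_mult_indicator wint) (auto simp: w_def)
    finally show ?thesis
      by (simp add: measure_def set_lebesgue_integral_def w_def integral_nonneg_AE)
  qed
  define S where "S m p k = {x. - real m < x \<and> x < real m \<and> g x \<le> p \<and>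
      (\<forall>e>0. \<exists>r. 0 < r \<and> r < e \<and> measure (nu m p) (ball x r) > k * r)}" for m p k
  have negS: "negligible (S m p k)" if "k > 0" for m p k
  proof (rule negligible_of_upper_density[OF nu, of "{x. g x \<le> p}"])
    show "emeasure (nu m p) {x. g x \<le> p} = 0"
    proof -
      have "emeasure (nu m p) {x. g x \<le> p} = (\<integral>\<^sup>+u. ennreal (w m p u) * indicator {x. g x \<le> p} u \<partial>lborel)"
        by (simp add: nu_def emeasure_density)
      also have "\<dots> = (integral\<^sup>N lborel (\<lambda>_::real. 0))"
        by (intro nn_integral_cong) (auto simp: w_def split: split_indicator)
      finally show ?thesis by simp
    qed
  qed (use that in \<open>auto simp: S_def\<close>)
  have "negligible (\<Union>(m,p,n)\<in>UNIV \<times> \<rat> \<times> UNIV. S m p (1 / real (Suc n)))"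
  proof -
    have "countable ((UNIV::nat set) \<times> (\<rat>::real set) \<times> (UNIV::nat set))" using countable_rat by auto
    then have "countable ((\<lambda>(m,p,n). S m p (1 / real (Suc n))) ` (UNIV \<times> \<rat> \<times> UNIV))" by (rule countable_image)
    then show ?thesis using negS by (intro negligible_countable_Union) auto
  qed
  moreover have "?N \<subseteq> (\<Union>(m,p,n)\<in>UNIV \<times> \<rat> \<times> UNIV. S m p (1 / real (Suc n)))"
  proof
    fix x assume "x \<in> ?N"
    then obtain e where e: "e > 0" and ex: "\<And>d. d > 0 \<Longrightarrow> \<exists>a b. a \<le> x \<and> x \<le> b \<and> a < b \<and> b - a < d \<and>
            (LINT u:{a..b}|lborel. g u) > (g x + e) * (b - a)"
      by (auto simp: not_le)
    obtain p where p: "p \<in> \<rat>" "g x < p" "p < g x + e/2"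
      using Rats_dense_in_real[of "g x" "g x + e/2"] e by auto
    obtain n where n: "1 / real (Suc n) < e / 4"
      using e by (metis reals_Archimedean inverse_eq_divide zero_less_divide_iff zero_less_numeral)
    obtain m where m: "\<bar>x\<bar> + 1 < real m" using reals_Archimedean2 by blast
    have "x \<in> S m p (1 / real (Suc n))"
      unfolding S_def
    proof (intro CollectI conjI allI impI)
      fix d :: real assume d: "d > 0"
      obtain a b where ab: "a \<le> x" "x \<le> b" "a < b" "b - a < min (d/2) (1/2)"
        "(LINT u:{a..b}|lborel. g u) > (g x + e) * (b - a)"
        using ex[of "min (d/2) (1/2)"] d by auto
      \<comment> \<open>The interval contains \<open>x\<close> but need not be centred there. The
        ball with radius twice its length contains it, so the density drops by a factor 2, which is
        why \<open>n\<close> was chosen with \<open>e / 4\<close>. The bound 1/2 on the length keeps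
        the interval inside the window.\<close>
      define r where "r = 2 * (b - a)"
      have r: "0 < r" "r < d" using ab by (auto simp: r_def)
      have sub: "{a..b} \<subseteq> ball x r" using ab by (auto simp: r_def dist_real_def)
      have si: "set_integrable lborel X (w m p)" if "X \<in> sets borel" for X
        unfolding set_integrable_def using that by (intro integrable_mult_indicator wint) auto
      have sig: "set_integrable lborel {a..b} g"
        unfolding set_integrable_def using g by (intro integrable_mult_indicator) auto
      have sip: "set_integrable lborel {a..b} (\<lambda>u. p)"
        using ab unfolding set_integrable_def by (intro integrable_scaleR_left integrable_real_indicator) auto
      have "(LINT u:{a..b}|lborel. g u) \<le> (LINT u:{a..b}|lborel. p + w m p u)"
      proof (rule set_integral_mono)
        fix u assume "u \<in> {a..b}"
        then have "u \<in> {- real m..real m}" using ab m by auto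
        then show "g u \<le> p + w m p u" by (auto simp: w_def)
      qed (use sig sip si[of "{a..b}"] in auto)
      also have "\<dots> = (LINT u:{a..b}|lborel. p) + (LINT u:{a..b}|lborel. w m p u)"
        using sip si[of "{a..b}"] by (intro set_integral_add) auto
      also have "(LINT u:{a..b}|lborel. p) = p * (b - a)"
        using ab by (simp add: set_lebesgue_integral_def)
      also have "(LINT u:{a..b}|lborel. w m p u) = measure (nu m p) {a..b}" by (simp add: nu_meas)
      also have "\<dots> \<le> measure (nu m p) (ball x r)"
        using sub by (intro finite_measure.finite_measure_mono nu) (auto simp: nu)
      finally have "(g x + e) * (b - a) < p * (b - a) + measure (nu m p) (ball x r)" using ab by simp
      moreover have "p * (b - a) \<le> (g x + e/2) * (b - a)" using p ab by (intro mult_right_mono) auto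
      moreover have "(g x + e) * (b - a) = (g x + e/2) * (b - a) + e/2 * (b - a)" by (simp add: field_simps)
      ultimately have "measure (nu m p) (ball x r) > e/2 * (b - a)" by linarith
      moreover have "e/2 * (b - a) \<ge> 1 / real (Suc n) * r"
      proof -
        have "1 / real (Suc n) * r \<le> e/4 * r" using n r by (intro mult_right_mono) auto
        also have "e/4 * r = e/2 * (b - a)" by (simp add: r_def)
        finally show ?thesis .
      qed
      ultimately show "\<exists>r. 0 < r \<and> r < d \<and> measure (nu m p) (ball x r) > 1 / real (Suc n) * r"
        using r by (intro exI[of _ r] conjI) linarith+
    qed (use m p in auto)
    then show "x \<in> (\<Union>(m,p,n)\<in>UNIV \<times> \<rat> \<times> UNIV. S m p (1 / real (Suc n)))" using p(1) by blast
  qed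
  ultimately show ?thesis by (rule negligible_subset)
qed

text \<open>Both \<open>m\<close> and the admissible end points \<open>X\<close> are parameters, so
  that one notion covers integrals over arbitrary intervals of the line and increments of a function
  that is controlled on [0,1] only.\<close>

definition straddling_derivative :: "real set \<Rightarrow> (real \<Rightarrow> real \<Rightarrow> real) \<Rightarrow> real \<Rightarrow> real \<Rightarrow> bool" where
  "straddling_derivative X m x D \<longleftrightarrow> (\<forall>e>0. \<exists>d>0. \<forall>a\<in>X. \<forall>b\<in>X. a \<le> x \<longrightarrow> x \<le> b \<longrightarrow> a < b \<longrightarrow> b - a < d \<longrightarrow>
     \<bar>m a b - D * (b - a)\<bar> \<le> e * (b - a))"

lemma straddling_derivativeD:
  assumes "straddling_derivative X m x D" "e > 0"
  shows "\<exists>d>0. \<forall>a\<in>X. \<forall>b\<in>X. a \<le> x \<longrightarrow> x \<le> b \<longrightarrow> a < b \<longrightarrow> b - a < d \<longrightarrow>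
    \<bar>m a b - D * (b - a)\<bar> \<le> e * (b - a)"
  using assms(1)[unfolded straddling_derivative_def, rule_format, OF assms(2)] .

lemma straddling_derivative_subset:
  assumes "straddling_derivative S m x D" "X \<subseteq> S" "\<And>a b. a \<in> X \<Longrightarrow> b \<in> X \<Longrightarrow> a < b \<Longrightarrow> m' a b = m a b"
  shows "straddling_derivative X m' x D"
  unfolding straddling_derivative_def
proof (intro allI impI)
  fix e :: real assume e: "e > 0"
  obtain d where "d > 0" "\<forall>a\<in>S. \<forall>b\<in>S. a \<le> x \<longrightarrow> x \<le> b \<longrightarrow> a < b \<longrightarrow> b - a < d \<longrightarrow>
      \<bar>m a b - D * (b - a)\<bar> \<le> e * (b - a)"
    using straddling_derivativeD[OF assms(1) e] by blast
  then show "\<exists>d>0. \<forall>a\<in>X. \<forall>b\<in>X. a \<le> x \<longrightarrow> x \<le> b \<longrightarrow> a < b \<longrightarrow> b - a < d \<longrightarrow> \<bar>m' a b - D * (b - a)\<bar> \<le> e * (b - a)"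
    using assms(2,3) by (intro exI[of _ d]) auto
qed

text \<open>The one-sided estimate is applied to \<open>g\<close> and to \<open>- g\<close>.\<close>

theorem Lebesgue_differentiation:
  fixes g :: "real \<Rightarrow> real"
  assumes g: "integrable lborel g"
  shows "negligible {x. \<not> straddling_derivative UNIV (\<lambda>a b. LINT u:{a..b}|lborel. g u) x (g x)}" (is "negligible ?N")
proof -
  let ?P = "\<lambda>(g::real\<Rightarrow>real) x. \<forall>e>0. \<exists>d>0. \<forall>a b. a \<le> x \<longrightarrow> x \<le> b \<longrightarrow> a < b \<longrightarrow> b - a < d \<longrightarrow>
            (LINT u:{a..b}|lborel. g u) \<le> (g x + e) * (b - a)"
  have "straddling_derivative UNIV (\<lambda>a b. LINT u:{a..b}|lborel. g u) x (g x)"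
    if P: "?P g x" "?P (\<lambda>x. - g x) x" for x
    unfolding straddling_derivative_def
  proof (intro allI impI)
    fix e :: real assume e: "e > 0"
    obtain d1 where d1: "d1 > 0" "\<forall>a b. a \<le> x \<longrightarrow> x \<le> b \<longrightarrow> a < b \<longrightarrow> b - a < d1 \<longrightarrow>
            (LINT u:{a..b}|lborel. g u) \<le> (g x + e) * (b - a)" using P(1) e by blast
    obtain d2 where d2: "d2 > 0" "\<forall>a b. a \<le> x \<longrightarrow> x \<le> b \<longrightarrow> a < b \<longrightarrow> b - a < d2 \<longrightarrow>
            (LINT u:{a..b}|lborel. - g u) \<le> (- g x + e) * (b - a)" using P(2) e by blast
    show "\<exists>d>0. \<forall>a\<in>UNIV. \<forall>b\<in>UNIV. a \<le> x \<longrightarrow> x \<le> b \<longrightarrow> a < b \<longrightarrow> b - a < d \<longrightarrow>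
            \<bar>(LINT u:{a..b}|lborel. g u) - g x * (b - a)\<bar> \<le> e * (b - a)"
    proof (intro exI[of _ "min d1 d2"] conjI ballI impI)
      fix a b assume ab: "a \<le> x" "x \<le> b" "a < b" "b - a < min d1 d2"
      have "(LINT u:{a..b}|lborel. g u) \<le> (g x + e) * (b - a)" using d1(2) ab by auto
      moreover have "(LINT u:{a..b}|lborel. - g u) \<le> (- g x + e) * (b - a)" using d2(2) ab by auto
      moreover have "(LINT u:{a..b}|lborel. - g u) = - (LINT u:{a..b}|lborel. g u)"
        by (simp add: set_lebesgue_integral_def)
      ultimately show "\<bar>(LINT u:{a..b}|lborel. g u) - g x * (b - a)\<bar> \<le> e * (b - a)"
        by (simp add: abs_le_iff algebra_simps)
    qed (use d1(1) d2(1) in auto)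
  qed
  then have "?N \<subseteq> {x. \<not> ?P g x} \<union> {x. \<not> ?P (\<lambda>x. - g x) x}" by blast
  moreover have "negligible ({x. \<not> ?P g x} \<union> {x. \<not> ?P (\<lambda>x. - g x) x})"
    using g by (intro negligible_Un Lebesgue_upper_differentiation) auto
  ultimately show ?thesis by (rule negligible_subset[rotated])
qed

section \<open>Absolutely continuous functions\<close>

text \<open>The definition speaks of families indexed by initial segments of the naturals. Below,
  the families are selections of grid cells, indexed by a subset of the naturals or by pairs, so any
  finite index set of any type is allowed.\<close>

lemma absolutely_continuous_fun_finite:
  assumes "absolutely_continuous_fun u v f" "e > 0"
  shows "\<exists>d>0. \<forall>(I::'i set) a b. finite I \<longrightarrow> (\<forall>i\<in>I. u \<le> a i \<and> a i \<le> b i \<and> b i \<le> v) \<longrightarrow>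
       disjoint_family_on (\<lambda>i. {a i<..<b i}) I \<longrightarrow> (\<Sum>i\<in>I. b i - a i) < d \<longrightarrow>
       (\<Sum>i\<in>I. \<bar>f (b i) - f (a i)\<bar>) < e"
proof -
  obtain d where d: "d > 0" "\<And>(n::nat) a b. (\<forall>i<n. u \<le> a i \<and> a i \<le> b i \<and> b i \<le> v) \<Longrightarrow>
        disjoint_family_on (\<lambda>i. {a i<..<b i}) {..<n} \<Longrightarrow>
        (\<Sum>i<n. b i - a i) < d \<Longrightarrow> (\<Sum>i<n. \<bar>f (b i) - f (a i)\<bar>) < e"
    using assms unfolding absolutely_continuous_fun_def by meson
  show ?thesis
  proof (intro exI[of _ d] conjI allI impI d(1))
    fix I :: "'i set" and a b
    assume I: "finite I" "\<forall>i\<in>I. u \<le> a i \<and> a i \<le> b i \<and> b i \<le> v"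
       "disjoint_family_on (\<lambda>i. {a i<..<b i}) I" "(\<Sum>i\<in>I. b i - a i) < d"
    obtain h where h: "bij_betw h {..<card I} I"
      using ex_bij_betw_nat_finite[OF I(1)] by (auto simp: atLeast0LessThan)
    have hI: "h i \<in> I" if "i < card I" for i using bij_betwE[OF h] that by auto
    have inj: "inj_on h {..<card I}" using h by (auto simp: bij_betw_def)
    have "(\<Sum>i<card I. \<bar>f (b (h i)) - f (a (h i))\<bar>) < e"
    proof (rule d(2))
      show "disjoint_family_on (\<lambda>i. {a (h i)<..<b (h i)}) {..<card I}"
        using I(3) hI inj unfolding disjoint_family_on_def inj_on_def by (metis lessThan_iff)
      show "(\<Sum>i<card I. b (h i) - a (h i)) < d"
        using sum.reindex_bij_betw[OF h, of "\<lambda>i. b i - a i"] I(4) by simp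
    qed (use I(2) hI in auto)
    then show "(\<Sum>i\<in>I. \<bar>f (b i) - f (a i)\<bar>) < e"
      using sum.reindex_bij_betw[OF h, of "\<lambda>i. \<bar>f (b i) - f (a i)\<bar>"] by simp
  qed
qed

lemma absolutely_continuous_fun_continuous:
  assumes "absolutely_continuous_fun u v f"
  shows "continuous_on {u..v} f"
  unfolding continuous_on_iff
proof (intro ballI allI impI)
  fix x e :: real assume x: "x \<in> {u..v}" and e: "e > 0"
  obtain d where d0: "d > 0" and d1: "\<forall>(I::unit set) a b. finite I \<longrightarrow> (\<forall>i\<in>I. u \<le> a i \<and> a i \<le> b i \<and> b i \<le> v) \<longrightarrow>
       disjoint_family_on (\<lambda>i. {a i<..<b i}) I \<longrightarrow> (\<Sum>i\<in>I. b i - a i) < d \<longrightarrow>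
       (\<Sum>i\<in>I. \<bar>f (b i) - f (a i)\<bar>) < e"
      using absolutely_continuous_fun_finite[OF assms e] by blast
    note d = d0 d1[rule_format]
  have "dist (f y) (f x) < e" if y: "y \<in> {u..v}" "dist y x < d" for y
    using d(2)[of "{()}" "\<lambda>_. min x y" "\<lambda>_. max x y"] x y
    by (cases "x \<le> y") (auto simp: disjoint_family_on_def dist_real_def min_def max_def abs_minus_commute)
  then show "\<exists>d>0. \<forall>x'\<in>{u..v}. dist x' x < d \<longrightarrow> dist (f x') (f x) < e" using d(1) by blast
qed

lemma absolutely_continuous_fun_diff:
  assumes "absolutely_continuous_fun u v f" "absolutely_continuous_fun u v g"
  shows "absolutely_continuous_fun u v (\<lambda>x. f x - g x)"
  unfolding absolutely_continuous_fun_def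
proof (intro allI impI)
  fix e :: real assume "e > 0" then have e: "e/2 > 0" by simp
  obtain d1 where d1: "d1 > 0" "\<And>(n::nat) a b. (\<forall>i<n. u \<le> a i \<and> a i \<le> b i \<and> b i \<le> v) \<Longrightarrow>
        disjoint_family_on (\<lambda>i. {a i<..<b i}) {..<n} \<Longrightarrow>
        (\<Sum>i<n. b i - a i) < d1 \<Longrightarrow> (\<Sum>i<n. \<bar>f (b i) - f (a i)\<bar>) < e/2"
    using assms(1) e unfolding absolutely_continuous_fun_def by meson
  obtain d2 where d2: "d2 > 0" "\<And>(n::nat) a b. (\<forall>i<n. u \<le> a i \<and> a i \<le> b i \<and> b i \<le> v) \<Longrightarrow>
        disjoint_family_on (\<lambda>i. {a i<..<b i}) {..<n} \<Longrightarrow>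
        (\<Sum>i<n. b i - a i) < d2 \<Longrightarrow> (\<Sum>i<n. \<bar>g (b i) - g (a i)\<bar>) < e/2"
    using assms(2) e unfolding absolutely_continuous_fun_def by meson
  show "\<exists>d>0. \<forall>(n::nat) a b. (\<forall>i<n. u \<le> a i \<and> a i \<le> b i \<and> b i \<le> v) \<longrightarrow>
        disjoint_family_on (\<lambda>i. {a i<..<b i}) {..<n} \<longrightarrow>
        (\<Sum>i<n. b i - a i) < d \<longrightarrow> (\<Sum>i<n. \<bar>f (b i) - g (b i) - (f (a i) - g (a i))\<bar>) < e"
  proof (intro exI[of _ "min d1 d2"] conjI allI impI)
    fix n :: nat and a b :: "nat \<Rightarrow> real"
    assume h: "\<forall>i<n. u \<le> a i \<and> a i \<le> b i \<and> b i \<le> v"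
      "disjoint_family_on (\<lambda>i. {a i<..<b i}) {..<n}" "(\<Sum>i<n. b i - a i) < min d1 d2"
    have "(\<Sum>i<n. \<bar>f (b i) - g (b i) - (f (a i) - g (a i))\<bar>)
        \<le> (\<Sum>i<n. \<bar>f (b i) - f (a i)\<bar> + \<bar>g (b i) - g (a i)\<bar>)" by (intro sum_mono) linarith
    also have "\<dots> < e/2 + e/2" unfolding sum.distrib
      using d1(2)[OF h(1,2)] d2(2)[OF h(1,2)] h(3) by (intro add_strict_mono) auto
    finally show "(\<Sum>i<n. \<bar>f (b i) - g (b i) - (f (a i) - g (a i))\<bar>) < e" by simp
  qed (use d1 d2 in auto)
qed

lemma grid_cells_inter:
  fixes h x :: real and i j :: nat
  assumes "h > 0" "x \<in> {real i * h<..real (Suc i) * h}" "x \<in> {real j * h<..real (Suc j) * h}"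
  shows "i = j"
proof -
  have "real i * h < real (Suc j) * h" "real j * h < real (Suc i) * h" using assms(2,3) unfolding greaterThanAtMost_iff by linarith+
  then have "real i < real (Suc j)" "real j < real (Suc i)" using assms(1) by (auto simp: mult_less_cancel_right)
  then show ?thesis by linarith
qed

lemma grid_cells_disjoint:
  fixes h :: real and i j :: nat
  assumes "h > 0" "i \<noteq> j"
  shows "{real i * h<..<real (Suc i) * h} \<inter> {real j * h<..<real (Suc j) * h} = {}"
proof (rule ccontr)
  assume "\<not> ?thesis"
  then obtain x where "x \<in> {real i * h<..<real (Suc i) * h}" "x \<in> {real j * h<..<real (Suc j) * h}" by blast
  then show False using grid_cells_inter[OF assms(1), of x i j] assms(2) by auto
qed

text \<open>The density is the Radon-Nikodym derivative of the Stieltjes measure of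
  \<open>f\<close>. That this measure vanishes on Lebesgue null sets need only be checked on compact
  ones, by inner regularity, and a compact null set is covered by finitely many grid cells of small
  total length, to which absolute continuity of \<open>f\<close> applies.\<close>

lemma monotone_AC_density:
  assumes ac: "absolutely_continuous_fun 0 1 f" and mono: "mono_on {0..1} f"
  obtains g :: "real \<Rightarrow> real" where "integrable lborel g"
    "\<And>s t. 0 \<le> s \<Longrightarrow> s \<le> t \<Longrightarrow> t \<le> 1 \<Longrightarrow> (LINT u:{s..t}|lborel. g u) = f t - f s"
proof -
  \<comment> \<open>Extending \<open>f\<close> by constants outside [0,1] gives a function on the
    line whose Stieltjes measure is finite and concentrated on \<open>{0<..1}\<close>.\<close>
  define F where "F x = f (max 0 (min 1 x)) - f 0" for x :: real
  have Fmono: "F x \<le> F y" if "x \<le> y" for x y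
    unfolding F_def using that by (intro diff_right_mono mono_onD[OF mono]) auto
  have Fcont: "continuous_on UNIV F"
    unfolding F_def
    by (intro continuous_intros continuous_on_compose2[OF absolutely_continuous_fun_continuous[OF ac]]) auto
  have Frc: "continuous (at_right a) F" for a
    using Fcont by (simp add: continuous_on_eq_continuous_within continuous_within_subset[of _ UNIV])
  have bot: "(F \<longlongrightarrow> 0) at_bot"
    by (intro tendsto_eventually eventually_at_bot_linorderI[of 0]) (auto simp: F_def)
  have top: "(F \<longlongrightarrow> F 1) at_top"
    by (intro tendsto_eventually eventually_at_top_linorderI[of 1]) (auto simp: F_def)
  have F0: "F x = 0" if "x \<le> 0" for x using that by (simp add: F_def)
  have F1: "0 \<le> F 1" using Fmono[of 0 1] F0[of 0] by simp
  define M where "M = interval_measure F"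
  have MU: "emeasure M UNIV = ennreal (F 1)"
    unfolding M_def by (rule interval_measure_UNIV[OF Fmono Frc bot top F1])
  have sM: "sets M = sets borel" "space M = UNIV" by (simp_all add: M_def)
  have Ioc: "emeasure M {a<..b} = ennreal (F b - F a)" if "a \<le> b" for a b
    unfolding M_def using that by (intro emeasure_interval_measure_Ioc Fmono Frc)
  have Icc: "emeasure M {a..b} = ennreal (F b - F a)" if "a \<le> b" for a b
    unfolding M_def using that by (intro emeasure_interval_measure_Icc Fmono Fcont)
  have out: "emeasure M (- {0<..1}) = 0"
  proof -
    have "emeasure M (space M - {0<..1}) = emeasure M (space M) - emeasure M {0<..1}"
      using Ioc[of 0 1] by (intro emeasure_compl) (simp_all add: sM)
    also have "\<dots> = 0" using MU Ioc[of 0 1] F0[of 0] by (simp add: sM)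
    finally show ?thesis by (simp add: sM flip: Compl_eq_Diff_UNIV)
  qed
  \<comment> \<open>The null set \<open>K\<close> lies in an open \<open>U\<close> of measure below
    \<open>d\<close>. With a mesh finer than the distance \<open>e0\<close> from \<open>K\<close> to
    the complement of \<open>U\<close>, every cell that meets \<open>K\<close> stays in
    \<open>U\<close>. These cells are disjoint, so their total length is below \<open>d\<close> and
    their mass below \<open>e\<close>.\<close>
  have small: "emeasure M K \<le> ennreal e" if K: "compact K" "emeasure lborel K = 0" and e: "e > 0" for K e
  proof -
    obtain d where d0: "d > 0" and d1: "\<forall>(I::nat set) a b. finite I \<longrightarrow> (\<forall>i\<in>I. 0 \<le> a i \<and> a i \<le> b i \<and> b i \<le> 1) \<longrightarrow>
       disjoint_family_on (\<lambda>i. {a i<..<b i}) I \<longrightarrow> (\<Sum>i\<in>I. b i - a i) < d \<longrightarrow>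
       (\<Sum>i\<in>I. \<bar>f (b i) - f (a i)\<bar>) < e"
      using absolutely_continuous_fun_finite[OF ac e] by blast
    note d = d0 d1[rule_format]
    have Kb: "K \<in> sets borel" using K(1) by (simp add: compact_imp_closed borel_closed)
    obtain U where U: "open U" "K \<subseteq> U" "emeasure lborel (U - K) < ennreal d"
      using outer_regular_lborel[OF Kb d(1)] by blast
    have Ud: "emeasure lborel U < ennreal d"
    proof -
      have "emeasure lborel U = emeasure lborel ((U - K) \<union> K)" using U(2) by (simp add: Un_absorb2)
      also have "\<dots> \<le> emeasure lborel (U - K) + emeasure lborel K"
        using U(1) Kb by (intro emeasure_subadditive) auto
      finally show ?thesis using U(3) K(2) by simp
    qed
    obtain e0 where e0: "e0 > 0" "(\<Union>x\<in>K. ball x e0) \<subseteq> U"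
      using compact_subset_open_imp_ball_epsilon_subset[OF K(1) U(1,2)] by blast
    obtain n where n: "1 / real (Suc n) < e0"
      using e0(1) by (metis reals_Archimedean inverse_eq_divide)
    define h where "h = 1 / real (Suc n)"
    have h: "h > 0" "h < e0" "real (Suc n) * h = 1" using n by (auto simp: h_def)
    define J where "J i = {real i * h<..real (Suc i) * h}" for i :: nat
    define I where "I = {i. i < Suc n \<and> J i \<inter> K \<noteq> {}}"
    have finI: "finite I" by (auto simp: I_def)
    have I1: "real (Suc i) * h \<le> 1" if "i \<in> I" for i
    proof -
      have "real (Suc i) * h \<le> real (Suc n) * h" using that h by (intro mult_right_mono) (auto simp: I_def)
      then show ?thesis using h(3) by linarith
    qed
    have Jm: "J i \<in> sets borel" for i by (simp add: J_def)
    have JU: "J i \<subseteq> U" if i: "i \<in> I" for i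
    proof
      fix y assume y: "y \<in> J i"
      obtain x where x: "x \<in> J i" "x \<in> K" using i by (auto simp: I_def)
      have "dist x y < e0" using x(1) y h by (auto simp: J_def dist_real_def algebra_simps)
      then show "y \<in> U" using e0(2) x(2) by (metis UN_I mem_ball subsetD)
    qed
    have dis: "disjoint_family_on J I"
      unfolding disjoint_family_on_def J_def using grid_cells_inter[OF h(1)] by blast
    have len: "(\<Sum>i\<in>I. real (Suc i) * h - real i * h) < d"
    proof -
      have "ennreal (\<Sum>i\<in>I. real (Suc i) * h - real i * h) = (\<Sum>i\<in>I. ennreal (real (Suc i) * h - real i * h))"
        using h by (intro sum_ennreal[symmetric]) (auto simp: algebra_simps)
      also have "\<dots> = (\<Sum>i\<in>I. emeasure lborel (J i))"
        using h by (intro sum.cong refl) (auto simp: J_def)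
      also have "\<dots> = emeasure lborel (\<Union>i\<in>I. J i)"
        using dis finI by (intro sum_emeasure) (auto simp: Jm)
      also have "\<dots> \<le> emeasure lborel U" using JU U(1) by (intro emeasure_mono) auto
      finally have "ennreal (\<Sum>i\<in>I. real (Suc i) * h - real i * h) < ennreal d" using Ud by order
      moreover have "0 \<le> (\<Sum>i\<in>I. real (Suc i) * h - real i * h)"
        using h by (intro sum_nonneg) (auto simp: algebra_simps)
      ultimately show ?thesis using ennreal_less_iff by blast
    qed
    have sm: "(\<Sum>i\<in>I. \<bar>f (real (Suc i) * h) - f (real i * h)\<bar>) < e"
    proof (rule d(2)[OF finI _ _ len])
      show "disjoint_family_on (\<lambda>i. {real i * h<..<real (Suc i) * h}) I"
        by (rule disjoint_family_on_bisimulation[OF dis]) (auto simp: J_def disjoint_iff)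
    qed (use h I1 in auto)
    have cov: "K \<subseteq> (\<Union>i\<in>I. J i) \<union> - {0<..1}"
    proof
      fix x assume x: "x \<in> K"
      show "x \<in> (\<Union>i\<in>I. J i) \<union> - {0<..1}"
      proof (cases "x \<in> {0<..1}")
        case True
        define i where "i = nat (\<lceil>x / h\<rceil> - 1)"
        have "x / h > 0" using True h by simp
        then have i: "real i < x / h" "x / h \<le> real (Suc i)" unfolding i_def by linarith+
        have xJ: "x \<in> J i" using i h by (auto simp: J_def field_simps)
        have "real i * h < real (Suc n) * h" using xJ True h by (auto simp: J_def)
        then have "i < Suc n" using h by (simp add: mult_less_cancel_right)
        then show ?thesis using xJ x by (auto simp: I_def)
      qed auto
    qed
    have "emeasure M K \<le> emeasure M ((\<Union>i\<in>I. J i) \<union> - {0<..1})"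
      using cov by (intro emeasure_mono) (auto simp: sM Jm intro!: sets.finite_UN finI)
    also have "\<dots> \<le> emeasure M (\<Union>i\<in>I. J i) + emeasure M (- {0<..1})"
      by (intro emeasure_subadditive) (auto simp: sM Jm intro!: sets.finite_UN finI)
    also have "\<dots> = emeasure M (\<Union>i\<in>I. J i)" by (simp add: out)
    also have "\<dots> = (\<Sum>i\<in>I. emeasure M (J i))"
      using dis finI by (intro sum_emeasure[symmetric]) (auto simp: Jm sM)
    also have "\<dots> = (\<Sum>i\<in>I. ennreal \<bar>f (real (Suc i) * h) - f (real i * h)\<bar>)"
    proof (intro sum.cong refl)
      fix i assume i: "i \<in> I"
      have 1: "real i * h \<le> real (Suc i) * h" using h by (intro mult_right_mono) auto
      have "F (real (Suc i) * h) - F (real i * h) = f (real (Suc i) * h) - f (real i * h)"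
        using I1[OF i] 1 order.trans[OF 1 I1[OF i]] h by (simp add: F_def)
      moreover have "F (real i * h) \<le> F (real (Suc i) * h)" using 1 by (rule Fmono)
      ultimately show "emeasure M (J i) = ennreal \<bar>f (real (Suc i) * h) - f (real i * h)\<bar>"
        unfolding J_def using Ioc[OF 1] by simp
    qed
    also have "\<dots> = ennreal (\<Sum>i\<in>I. \<bar>f (real (Suc i) * h) - f (real i * h)\<bar>)" by (intro sum_ennreal) auto
    also have "\<dots> \<le> ennreal e" using sm by (intro ennreal_leI) auto
    finally show ?thesis .
  qed
  have acM: "absolutely_continuous lborel M"
    unfolding Radon_Nikodym.absolutely_continuous_def
  proof
    fix A assume A: "A \<in> null_sets (lborel::real measure)"
    have Ab: "A \<in> sets borel" using A by (auto simp: null_sets_def)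
    have "emeasure M A = (SUP K\<in>{K. K \<subseteq> A \<and> compact K}. emeasure M K)"
      by (rule inner_regular[OF sM(1) _ Ab]) (simp add: sM MU)
    also have "\<dots> \<le> 0"
    proof (rule SUP_least)
      fix K assume K: "K \<in> {K. K \<subseteq> A \<and> compact K}"
      have "emeasure lborel K \<le> emeasure lborel A" using K Ab by (intro emeasure_mono) auto
      then have "emeasure lborel K = 0" using A by (auto simp: null_sets_def)
      then have "emeasure M K \<le> ennreal e" if "e > 0" for e using small[of K e] K that by blast
      then show "emeasure M K \<le> 0"
        using ennreal_le_epsilon[of 0 "emeasure M K"] by simp
    qed
    finally show "A \<in> null_sets M" using Ab by (auto simp: null_sets_def sM)
  qed
  obtain g0 where g0[measurable]: "g0 \<in> borel_measurable lborel" and dens: "density lborel g0 = M"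
    using sigma_finite_measure.Radon_Nikodym[OF sigma_finite_lborel acM] sM by auto
  have nn: "(\<integral>\<^sup>+u. g0 u \<partial>lborel) = ennreal (F 1)"
    using MU unfolding dens[symmetric] by (simp add: emeasure_density)
  have fin: "AE u in lborel. g0 u \<noteq> \<infinity>"
    using nn by (intro nn_integral_PInf_AE) auto
  define g where "g u = enn2real (g0 u)" for u
  have gm[measurable]: "g \<in> borel_measurable borel" unfolding g_def by measurable
  have gg: "AE u in lborel. ennreal (g u) = g0 u"
    using fin by eventually_elim (auto simp: g_def less_top)
  have gint: "integrable lborel g"
  proof (rule integrableI_nonneg)
    have "(\<integral>\<^sup>+u. ennreal (g u) \<partial>lborel) = (\<integral>\<^sup>+u. g0 u \<partial>lborel)" using gg by (rule nn_integral_cong_AE)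
    then show "(\<integral>\<^sup>+u. ennreal (g u) \<partial>lborel) < \<infinity>" using nn by simp
  qed (auto simp: g_def)
  have "(LINT u:{s..t}|lborel. g u) = f t - f s" if st: "0 \<le> s" "s \<le> t" "t \<le> 1" for s t
  proof -
    have "ennreal (LINT u:{s..t}|lborel. g u) = (\<integral>\<^sup>+u. ennreal (indicator {s..t} u *\<^sub>R g u) \<partial>lborel)"
      unfolding set_lebesgue_integral_def
      by (intro nn_integral_eq_integral[symmetric] integrable_mult_indicator gint) (auto simp: g_def)
    also have "\<dots> = (\<integral>\<^sup>+u. g0 u * indicator {s..t} u \<partial>lborel)"
      using gg by (intro nn_integral_cong_AE) (auto split: split_indicator)
    also have "\<dots> = emeasure M {s..t}" by (simp add: dens[symmetric] emeasure_density)
    also have "\<dots> = ennreal (F t - F s)" using st by (intro Icc)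
    finally have "(LINT u:{s..t}|lborel. g u) = F t - F s"
      using Fmono[OF st(2)] by (subst (asm) ennreal_inj) (auto simp: set_lebesgue_integral_def g_def intro!: integral_nonneg_AE)
    then show ?thesis using st by (simp add: F_def)
  qed
  then show thesis using gint that by blast
qed

lemma dyadic_floor_tendsto:
  fixes t :: real assumes "0 \<le> t"
  shows "(\<lambda>r. real (nat \<lfloor>t * 2 ^ r\<rfloor>) / 2 ^ r) \<longlonglongrightarrow> t"
proof (rule real_tendsto_sandwich)
  show "\<forall>\<^sub>F r in sequentially. t - (1/2) ^ r \<le> real (nat \<lfloor>t * 2 ^ r\<rfloor>) / 2 ^ r"
  proof (intro always_eventually allI)
    fix r :: nat
    have "t * 2 ^ r - 1 \<le> real (nat \<lfloor>t * 2 ^ r\<rfloor>)" by linarith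
    then have "(t * 2 ^ r - 1) / 2 ^ r \<le> real (nat \<lfloor>t * 2 ^ r\<rfloor>) / 2 ^ r" by (intro divide_right_mono) auto
    then show "t - (1/2) ^ r \<le> real (nat \<lfloor>t * 2 ^ r\<rfloor>) / 2 ^ r" by (simp add: diff_divide_distrib power_divide)
  qed
  show "\<forall>\<^sub>F r in sequentially. real (nat \<lfloor>t * 2 ^ r\<rfloor>) / 2 ^ r \<le> t"
    using assms by (intro always_eventually allI) (simp add: divide_le_eq)
  show "(\<lambda>r. t - (1/2) ^ r) \<longlonglongrightarrow> t"
    using tendsto_diff[OF tendsto_const[of t] LIMSEQ_power_zero[of "1/2::real"]] by simp
qed simp

text \<open>Jordan decomposition, with the variation computed along dyadic grids only. Refining the
  grid increases the sums, so the limit \<open>V\<close> exists once they are bounded. Absolute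
  continuity of \<open>f\<close> yields this bound and, applied to the cells inside the given
  intervals, also the absolute continuity of \<open>V\<close>.\<close>

lemma absolutely_continuous_fun_decomposition:
  assumes ac: "absolutely_continuous_fun 0 1 f"
  obtains V where "absolutely_continuous_fun 0 1 V" "mono_on {0..1} V" "mono_on {0..1} (\<lambda>x. V x - f x)"
proof -
  define D where "D r i = \<bar>f (real (Suc i) / 2 ^ r) - f (real i / 2 ^ r)\<bar>" for r i :: nat
  define n where "n r t = nat \<lfloor>t * 2 ^ r\<rfloor>" for r :: nat and t :: real
  define W where "W r t = (\<Sum>i<n r t. D r i)" for r t
  have D0: "0 \<le> D r i" for r i by (simp add: D_def)
  have nmono: "n r s \<le> n r t" if "s \<le> t" for r s t
    unfolding n_def using that by (intro nat_mono floor_mono mult_right_mono) auto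
  have n_le: "n r t \<le> 2 ^ r" if "t \<le> 1" for r t
    using nmono[OF that, of r] by (simp add: n_def nat_power_eq)
  have Wdiff: "W r t - W r s = (\<Sum>i\<in>{n r s..<n r t}. D r i)" if "s \<le> t" for r s t
    unfolding W_def using sum_diff_nat_ivl[of 0 "n r s" "n r t" "D r"] nmono[OF that]
    by (simp add: lessThan_atLeast0)
  have Wmono: "W r s \<le> W r t" if "s \<le> t" for r s t
    using Wdiff[OF that, of r] sum_nonneg[of "{n r s..<n r t}" "D r"] D0 by simp
  \<comment> \<open>Every cell is split into two cells of the next generation, and the triangle
    inequality applies to each.\<close>
  have D2: "(\<Sum>i<k. D r i) \<le> (\<Sum>i<2*k. D (Suc r) i)" for r k
  proof (induction k)
    case (Suc k)
    have "D r k \<le> D (Suc r) (2*k) + D (Suc r) (Suc (2*k))"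
    proof -
      have e: "real (Suc k) / 2 ^ r = real (Suc (Suc (2*k))) / 2 ^ Suc r" "real k / 2 ^ r = real (2*k) / 2 ^ Suc r"
        by (auto simp: field_simps)
      show ?thesis unfolding D_def e by linarith
    qed
    then show ?case using Suc by simp
  qed simp
  have Winc: "incseq (\<lambda>r. W r t)" if t: "0 \<le> t" for t
  proof (rule incseq_SucI)
    fix r
    have "real (n r t) \<le> t * 2 ^ r" using t by (simp add: n_def)
    then have "real (2 * n r t) \<le> t * 2 ^ Suc r" by simp
    then have "2 * n r t \<le> n (Suc r) t" unfolding n_def by linarith
    then have "(\<Sum>i<2 * n r t. D (Suc r) i) \<le> W (Suc r) t"
      unfolding W_def by (intro sum_mono2) (auto simp: D0)
    then show "W r t \<le> W (Suc r) t" using D2[of r "n r t"] unfolding W_def by linarith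
  qed
  \<comment> \<open>Absolute continuity with \<open>\<epsilon> = 1\<close> gives \<open>d\<close>.
    All cells of generation \<open>p + q\<close> inside one interval of length
    \<open>(1/2)^p\<close>, which is below \<open>d\<close>, contribute at most 1, and there are
    \<open>2^p\<close> such intervals, whatever \<open>q\<close> is.\<close>
  obtain B where B: "\<And>r. W r 1 \<le> B"
  proof -
    obtain d where d0: "d > 0" and d1: "\<forall>(I::nat set) a b. finite I \<longrightarrow> (\<forall>i\<in>I. 0 \<le> a i \<and> a i \<le> b i \<and> b i \<le> 1) \<longrightarrow>
       disjoint_family_on (\<lambda>i. {a i<..<b i}) I \<longrightarrow> (\<Sum>i\<in>I. b i - a i) < d \<longrightarrow>
       (\<Sum>i\<in>I. \<bar>f (b i) - f (a i)\<bar>) < 1"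
      using absolutely_continuous_fun_finite[OF ac zero_less_one] by blast
    note d = d0 d1[rule_format]
    obtain p where p: "(1/2::real) ^ p < d" using real_arch_pow_inv[OF d0, of "1/2"] by auto
    have "W (p + q) 1 \<le> 2 ^ p" for q
    proof -
      have "W (p + q) 1 = (\<Sum>i<2 ^ p * 2 ^ q. D (p + q) i)"
        by (simp add: W_def n_def nat_power_eq power_add[symmetric])
      also have "\<dots> = (\<Sum>m<2 ^ p. \<Sum>i\<in>{m * 2 ^ q..<m * 2 ^ q + 2 ^ q}. D (p + q) i)"
        by (rule sum.nat_group[symmetric])
      also have "\<dots> \<le> (\<Sum>m<(2::nat) ^ p. 1)"
      proof (rule sum_mono)
        fix m :: nat assume m: "m \<in> {..<2 ^ p}"
        let ?I = "{m * 2 ^ q..<m * 2 ^ q + 2 ^ q}" and ?h = "1 / 2 ^ (p + q) :: real"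
        have le: "Suc i \<le> 2 ^ (p + q)" if "i \<in> ?I" for i
        proof -
          have "Suc i \<le> Suc m * 2 ^ q" using that by auto
          also have "\<dots> \<le> 2 ^ p * 2 ^ q" using m by (intro mult_right_mono) auto
          finally show ?thesis by (simp add: power_add)
        qed
        have le': "real (Suc i) \<le> 2 ^ (p + q)" if "i \<in> ?I" for i
          using le[OF that] by (metis of_nat_le_iff of_nat_numeral of_nat_power)
        have "(\<Sum>i\<in>?I. \<bar>f (real (Suc i) * ?h) - f (real i * ?h)\<bar>) < 1"
        proof (rule d(2))
          show "0 \<le> real i * ?h \<and> real i * ?h \<le> real (Suc i) * ?h \<and> real (Suc i) * ?h \<le> 1" if "i \<in> ?I" for i
            using le'[OF that] by (simp add: field_simps)
          show "disjoint_family_on (\<lambda>i. {real i * ?h<..<real (Suc i) * ?h}) ?I"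
            unfolding disjoint_family_on_def
          proof (intro ballI impI)
            fix i j :: nat assume "i \<noteq> j"
            then show "{real i * ?h<..<real (Suc i) * ?h} \<inter> {real j * ?h<..<real (Suc j) * ?h} = {}"
              by (intro grid_cells_disjoint) auto
          qed
          have "(\<Sum>i\<in>?I. real (Suc i) * ?h - real i * ?h) = (\<Sum>i\<in>?I. ?h)"
            by (intro sum.cong) (auto simp: field_simps)
          also have "\<dots> = (1/2) ^ p" by (simp add: power_add power_divide)
          finally show "(\<Sum>i\<in>?I. real (Suc i) * ?h - real i * ?h) < d" using p by simp
        qed simp
        then show "(\<Sum>i\<in>?I. D (p + q) i) \<le> 1" by (simp add: D_def)
      qed
      finally show ?thesis by simp
    qed
    then have "W r 1 \<le> 2 ^ p" for r
      using incseqD[OF Winc[of 1], of r "p + r"] by (meson le_add2 order_trans zero_le_one)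
    then show thesis using that by blast
  qed
  \<comment> \<open>the variation of \<open>f\<close> on \<open>[0,t]\<close>\<close>
  define V where "V t = lim (\<lambda>r. W r t)" for t
  have V: "(\<lambda>r. W r t) \<longlonglongrightarrow> V t" if t: "0 \<le> t" "t \<le> 1" for t
  proof -
    have "W r t \<le> B" for r using Wmono[OF t(2), of r] B[of r] by linarith
    then have "convergent (\<lambda>r. W r t)"
      using Winc[OF t(1)] by (meson incseq_convergent convergentI)
    then show ?thesis unfolding V_def by (simp add: convergent_LIMSEQ_iff)
  qed
  \<comment> \<open>At dyadic points this is the triangle inequality along the cells in between;
    continuity of \<open>f\<close> carries it to \<open>s\<close> and \<open>t\<close>.\<close>
  have Vinc: "\<bar>f t - f s\<bar> \<le> V t - V s" if st: "0 \<le> s" "s \<le> t" "t \<le> 1" for s t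
  proof (rule LIMSEQ_le)
    have lim: "(\<lambda>r. f (real (n r u) / 2 ^ r)) \<longlonglongrightarrow> f u" if u: "0 \<le> u" "u \<le> 1" for u
    proof (rule continuous_on_tendsto_compose[OF absolutely_continuous_fun_continuous[OF ac]])
      show "(\<lambda>r. real (n r u) / 2 ^ r) \<longlonglongrightarrow> u" unfolding n_def by (rule dyadic_floor_tendsto[OF u(1)])
      show "\<forall>\<^sub>F r in sequentially. real (n r u) / 2 ^ r \<in> {0..1}"
      proof (intro always_eventually allI)
        fix r
        have "real (n r u) \<le> 2 ^ r" using n_le[OF u(2), of r] by (metis of_nat_le_iff of_nat_numeral of_nat_power)
        then show "real (n r u) / 2 ^ r \<in> {0..1}" by simp
      qed
    qed (use u in auto)
    show "(\<lambda>r. \<bar>f (real (n r t) / 2 ^ r) - f (real (n r s) / 2 ^ r)\<bar>) \<longlonglongrightarrow> \<bar>f t - f s\<bar>"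
      using lim[of t] lim[of s] st by (intro tendsto_intros) auto
    show "(\<lambda>r. W r t - W r s) \<longlonglongrightarrow> V t - V s" using V[of t] V[of s] st by (intro tendsto_intros) auto
    have "\<bar>f (real (n r t) / 2 ^ r) - f (real (n r s) / 2 ^ r)\<bar> \<le> W r t - W r s" for r
    proof -
      have "f (real (n r t) / 2 ^ r) - f (real (n r s) / 2 ^ r)
          = (\<Sum>i\<in>{n r s..<n r t}. f (real (Suc i) / 2 ^ r) - f (real i / 2 ^ r))"
        using sum_Suc_diff'[OF nmono[OF st(2)], of "\<lambda>i. f (real i / 2 ^ r)" r] by simp
      then have "\<bar>f (real (n r t) / 2 ^ r) - f (real (n r s) / 2 ^ r)\<bar> \<le> (\<Sum>i\<in>{n r s..<n r t}. D r i)"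
        unfolding D_def by (simp only: sum_abs)
      then show ?thesis using Wdiff[OF st(2)] by simp
    qed
    then show "\<exists>N. \<forall>r\<ge>N. \<bar>f (real (n r t) / 2 ^ r) - f (real (n r s) / 2 ^ r)\<bar> \<le> W r t - W r s" by blast
  qed
  have "absolutely_continuous_fun 0 1 V"
    unfolding absolutely_continuous_fun_def
  proof (intro allI impI)
    fix e :: real assume "e > 0" then have e: "e/2 > 0" by simp
    obtain d where d0: "d > 0" and d1: "\<forall>(I::(nat\<times>nat) set) a b. finite I \<longrightarrow> (\<forall>i\<in>I. 0 \<le> a i \<and> a i \<le> b i \<and> b i \<le> 1) \<longrightarrow>
       disjoint_family_on (\<lambda>i. {a i<..<b i}) I \<longrightarrow> (\<Sum>i\<in>I. b i - a i) < d \<longrightarrow>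
       (\<Sum>i\<in>I. \<bar>f (b i) - f (a i)\<bar>) < e/2"
      using absolutely_continuous_fun_finite[OF ac e] by blast
    note d = d0 d1[rule_format]
    show "\<exists>d>0. \<forall>(m::nat) a b. (\<forall>i<m. 0 \<le> a i \<and> a i \<le> b i \<and> b i \<le> 1) \<longrightarrow>
        disjoint_family_on (\<lambda>i. {a i<..<b i}) {..<m} \<longrightarrow>
        (\<Sum>i<m. b i - a i) < d \<longrightarrow> (\<Sum>i<m. \<bar>V (b i) - V (a i)\<bar>) < e"
    proof (intro exI[of _ d] conjI allI impI d0)
      fix m :: nat and a b :: "nat \<Rightarrow> real"
      assume h: "\<forall>i<m. 0 \<le> a i \<and> a i \<le> b i \<and> b i \<le> 1"
        "disjoint_family_on (\<lambda>i. {a i<..<b i}) {..<m}" "(\<Sum>i<m. b i - a i) < d"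
      have nr: "real (n r t) \<le> t * 2 ^ r" "t * 2 ^ r < real (n r t) + 1" if "0 \<le> t" for r t
        using that unfolding n_def by (simp, linarith)
      \<comment> \<open>The cells attributed to one interval can exceed its length by at most one
        mesh width, which gives \<open>real m * (1/2) ^ r\<close> in total.\<close>
      have "(\<lambda>r. (\<Sum>i<m. b i - a i) + real m * (1/2) ^ r) \<longlonglongrightarrow> (\<Sum>i<m. b i - a i) + real m * 0"
        by (intro tendsto_intros LIMSEQ_power_zero) auto
      then have "\<forall>\<^sub>F r in sequentially. (\<Sum>i<m. b i - a i) + real m * (1/2) ^ r < d"
        using h(3) by (intro order_tendstoD(2)) auto
      then have ev: "\<forall>\<^sub>F r in sequentially. (\<Sum>j<m. \<bar>W r (b j) - W r (a j)\<bar>) \<le> e/2"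
      proof eventually_elim
        case (elim r)
        let ?h = "1 / 2 ^ r :: real"
        let ?I = "Sigma {..<m} (\<lambda>j. {n r (a j)..<n r (b j)})"
        \<comment> \<open>A cell belongs to interval \<open>j\<close> through its right end, which
          lies in \<open>(a j, b j]\<close>; its left end may stick out. Hence no cell is claimed
          twice: two intervals sharing this right end would both contain the points just left of
          it.\<close>
        have inI: "a j < real (Suc i) * ?h \<and> real (Suc i) * ?h \<le> b j" if "(j, i) \<in> ?I" for i j
        proof -
          have j: "j < m" "n r (a j) \<le> i" "Suc i \<le> n r (b j)" using that by auto
          then have "0 \<le> a j" "0 \<le> b j" using h(1) by force+
          have "a j * 2 ^ r < real (Suc i)" using nr(2)[OF \<open>0 \<le> a j\<close>, of r] j by linarith
          moreover have "real (Suc i) \<le> b j * 2 ^ r" using nr(1)[OF \<open>0 \<le> b j\<close>, of r] j by linarith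
          ultimately show ?thesis by (simp add: field_simps)
        qed
        have "(\<Sum>j<m. \<bar>W r (b j) - W r (a j)\<bar>) = (\<Sum>j<m. \<Sum>i\<in>{n r (a j)..<n r (b j)}. D r i)"
        proof (intro sum.cong refl)
          fix j assume "j \<in> {..<m}"
          then have "a j \<le> b j" using h(1) by auto
          then show "\<bar>W r (b j) - W r (a j)\<bar> = (\<Sum>i\<in>{n r (a j)..<n r (b j)}. D r i)"
            using Wdiff[of "a j" "b j" r] Wmono[of "a j" "b j" r] by simp
        qed
        also have "\<dots> = (\<Sum>p\<in>?I. D r (snd p))" by (subst sum.Sigma) (auto simp: split_beta)
        also have "\<dots> = (\<Sum>p\<in>?I. \<bar>f (real (Suc (snd p)) * ?h) - f (real (snd p) * ?h)\<bar>)" by (simp add: D_def)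
        also have "\<dots> < e/2"
        proof (rule d(2))
          fix p assume p: "p \<in> ?I"
          have "b (fst p) \<le> 1" using p h(1) by auto
          moreover have "real (Suc (snd p)) * ?h \<le> b (fst p)" using inI[of "fst p" "snd p"] p by simp
          ultimately have "real (Suc (snd p)) * ?h \<le> 1" by linarith
          then show "0 \<le> real (snd p) * ?h \<and> real (snd p) * ?h \<le> real (Suc (snd p)) * ?h \<and> real (Suc (snd p)) * ?h \<le> 1"
            by (simp add: divide_right_mono)
        next
          show "disjoint_family_on (\<lambda>p. {real (snd p) * ?h<..<real (Suc (snd p)) * ?h}) ?I"
            unfolding disjoint_family_on_def
          proof (intro ballI impI)
            fix p q assume pq: "p \<in> ?I" "q \<in> ?I" "p \<noteq> q"
            show "{real (snd p) * ?h<..<real (Suc (snd p)) * ?h} \<inter> {real (snd q) * ?h<..<real (Suc (snd q)) * ?h} = {}"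
            proof (cases "snd p = snd q")
              case False
              then show ?thesis
                by (intro grid_cells_disjoint) auto
            next
              case True
              then have "fst p \<noteq> fst q" using pq(3) by (metis prod.collapse)
              moreover have "fst p < m" "fst q < m" using pq by auto
              ultimately have dj: "{a (fst p)<..<b (fst p)} \<inter> {a (fst q)<..<b (fst q)} = {}"
                using h(2) by (auto simp: disjoint_family_on_def)
              have 1: "a (fst p) < real (Suc (snd p)) * ?h \<and> real (Suc (snd p)) * ?h \<le> b (fst p)"
                using inI[of "fst p" "snd p"] pq by simp
              have 2: "a (fst q) < real (Suc (snd p)) * ?h \<and> real (Suc (snd p)) * ?h \<le> b (fst q)"
                using inI[of "fst q" "snd q"] pq True by simp
              obtain z where "max (a (fst p)) (a (fst q)) < z" "z < real (Suc (snd p)) * ?h"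
                using dense[of "max (a (fst p)) (a (fst q))" "real (Suc (snd p)) * ?h"] 1 2 by auto
              then have "z \<in> {a (fst p)<..<b (fst p)} \<inter> {a (fst q)<..<b (fst q)}" using 1 2 by auto
              then show ?thesis using dj by blast
            qed
          qed
        next
          have "(\<Sum>p\<in>?I. real (Suc (snd p)) * ?h - real (snd p) * ?h) = (\<Sum>p\<in>?I. ?h)"
            by (intro sum.cong) (auto simp: field_simps)
          also have "\<dots> = (\<Sum>j<m. \<Sum>i\<in>{n r (a j)..<n r (b j)}. ?h)" by (subst sum.Sigma) (auto simp: split_beta)
          also have "\<dots> \<le> (\<Sum>j<m. (b j - a j) + (1/2) ^ r)"
          proof (intro sum_mono)
            fix j assume "j \<in> {..<m}"
            then have j: "0 \<le> a j" "a j \<le> b j" using h(1) by auto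
            have "real (n r (b j) - n r (a j)) \<le> b j * 2 ^ r - a j * 2 ^ r + 1"
              using nr[of "b j" r] nr[of "a j" r] j nmono[OF j(2), of r] by (simp add: of_nat_diff)
            then show "(\<Sum>i\<in>{n r (a j)..<n r (b j)}. ?h) \<le> (b j - a j) + (1/2) ^ r"
              by (simp add: field_simps power_divide)
          qed
          also have "\<dots> < d" using elim by (simp add: sum.distrib)
          finally show "(\<Sum>p\<in>?I. real (Suc (snd p)) * ?h - real (snd p) * ?h) < d" .
        qed simp
        finally show ?case by simp
      qed
      have "(\<lambda>r. \<Sum>j<m. \<bar>W r (b j) - W r (a j)\<bar>) \<longlonglongrightarrow> (\<Sum>j<m. \<bar>V (b j) - V (a j)\<bar>)"
      proof (intro tendsto_sum tendsto_rabs tendsto_diff V)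
      qed (use h(1) in force)+
      then have "(\<Sum>j<m. \<bar>V (b j) - V (a j)\<bar>) \<le> e/2" using ev by (intro tendsto_upperbound) auto
      then show "(\<Sum>i<m. \<bar>V (b i) - V (a i)\<bar>) < e" using e by linarith
    qed
  qed
  moreover have "mono_on {0..1} V" using Vinc by (intro mono_onI) force
  moreover have "mono_on {0..1} (\<lambda>x. V x - f x)"
  proof (rule mono_onI)
    fix r s :: real assume "r \<in> {0..1}" "s \<in> {0..1}" "r \<le> s"
    then show "V r - f r \<le> V s - f s" using Vinc[of r s] by auto
  qed
  ultimately show thesis using that by blast
qed

text \<open>The density is the difference of the densities of the two monotone parts
  \<open>V\<close> and \<open>V - f\<close>; increments of \<open>f\<close> are then integrals, and
  the differentiation theorem applies to them.\<close>

theorem absolutely_continuous_fun_FTC: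
  assumes ac: "absolutely_continuous_fun 0 1 f"
  obtains g :: "real \<Rightarrow> real" where "integrable lborel g"
    "\<And>s t. 0 \<le> s \<Longrightarrow> s \<le> t \<Longrightarrow> t \<le> 1 \<Longrightarrow> (LINT u:{s..t}|lborel. g u) = f t - f s"
    "negligible {t \<in> {0<..<1}. \<not> straddling_derivative {0..1} (\<lambda>a b. f b - f a) t (g t)}"
proof -
  obtain V where V: "absolutely_continuous_fun 0 1 V" "mono_on {0..1} V" "mono_on {0..1} (\<lambda>x. V x - f x)"
    using absolutely_continuous_fun_decomposition[OF ac] by blast
  obtain g1 where g1: "integrable lborel g1"
    "\<And>s t. 0 \<le> s \<Longrightarrow> s \<le> t \<Longrightarrow> t \<le> 1 \<Longrightarrow> (LINT u:{s..t}|lborel. g1 u) = V t - V s"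
    using monotone_AC_density[OF V(1,2)] by blast
  obtain g2 where g2: "integrable lborel g2"
    "\<And>s t. 0 \<le> s \<Longrightarrow> s \<le> t \<Longrightarrow> t \<le> 1 \<Longrightarrow> (LINT u:{s..t}|lborel. g2 u) = (V t - f t) - (V s - f s)"
    using monotone_AC_density[OF absolutely_continuous_fun_diff[OF V(1) ac] V(3)] by blast
  define g where "g u = g1 u - g2 u" for u
  have g: "integrable lborel g" unfolding g_def using g1(1) g2(1) by auto
  have gi: "(LINT u:{s..t}|lborel. g u) = f t - f s" if "0 \<le> s" "s \<le> t" "t \<le> 1" for s t
  proof -
    have "(LINT u:{s..t}|lborel. g u) = (LINT u:{s..t}|lborel. g1 u) - (LINT u:{s..t}|lborel. g2 u)"
      unfolding g_def using g1(1) g2(1)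
      by (intro set_integral_diff) (auto simp: set_integrable_def simp del: real_scaleR_def intro!: integrable_mult_indicator)
    then show ?thesis using g1(2)[OF that] g2(2)[OF that] by simp
  qed
  show thesis
  proof (rule that[OF g gi negligible_subset[OF Lebesgue_differentiation[OF g]]])
    have "straddling_derivative {0..1} (\<lambda>a b. f b - f a) t (g t)"
      if "straddling_derivative UNIV (\<lambda>a b. LINT u:{a..b}|lborel. g u) t (g t)" for t
      using that by (rule straddling_derivative_subset) (auto simp: gi)
    then show "{t \<in> {0<..<1}. \<not> straddling_derivative {0..1} (\<lambda>a b. f b - f a) t (g t)}
        \<subseteq> {t. \<not> straddling_derivative UNIV (\<lambda>a b. LINT u:{a..b}|lborel. g u) t (g t)}" by blast
  qed
qed

section \<open>The Markov chain of explored vertices\<close>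

primrec run_snoc :: "('a \<Rightarrow> 'a pmf) \<Rightarrow> nat \<Rightarrow> 'a \<Rightarrow> 'a list pmf" where
  "run_snoc K 0 x = return_pmf [x]"
| "run_snoc K (Suc k) x = bind_pmf (run_snoc K k x) (\<lambda>xs. map_pmf (\<lambda>y. xs @ [y]) (K (last xs)))"

text \<open>The same law as \<open>run_snoc\<close>, which appends states at the end as
  \<open>greedy_run\<close> does. Splitting off the first step instead is the form that permits
  induction over the starting state.\<close>

primrec run_cons :: "('a \<Rightarrow> 'a pmf) \<Rightarrow> nat \<Rightarrow> 'a \<Rightarrow> 'a list pmf" where
  "run_cons K 0 x = return_pmf [x]"
| "run_cons K (Suc k) x = bind_pmf (K x) (\<lambda>y. map_pmf (Cons x) (run_cons K k y))"

primrec kernel_power :: "('a \<Rightarrow> 'a pmf) \<Rightarrow> nat \<Rightarrow> 'a \<Rightarrow> 'a pmf" where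
  "kernel_power K 0 x = return_pmf x"
| "kernel_power K (Suc n) x = bind_pmf (K x) (kernel_power K n)"

lemma run_snoc_nonempty: "xs \<in> set_pmf (run_snoc K k x) \<Longrightarrow> xs \<noteq> []"
  by (induction k arbitrary: xs) auto

lemma run_snoc_Suc_cons:
  "run_snoc K (Suc k) x = bind_pmf (K x) (\<lambda>y. map_pmf (Cons x) (run_snoc K k y))"
proof (induction k)
  case 0
  show ?case by (simp add: bind_return_pmf map_pmf_def bind_assoc_pmf)
next
  case (Suc k)
  have "run_snoc K (Suc (Suc k)) x
      = bind_pmf (K x) (\<lambda>y. bind_pmf (run_snoc K k y) (\<lambda>xs. map_pmf (\<lambda>z. (x # xs) @ [z]) (K (last (x # xs)))))"
    unfolding run_snoc.simps(2)[of K "Suc k"] Suc.IH by (simp add: bind_assoc_pmf bind_map_pmf)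
  also have "\<dots> = bind_pmf (K x) (\<lambda>y. map_pmf (Cons x) (run_snoc K (Suc k) y))"
    by (intro bind_pmf_cong refl) (auto simp: map_bind_pmf pmf.map_comp o_def
      intro!: bind_pmf_cong dest: run_snoc_nonempty)
  finally show ?case .
qed

lemma run_snoc_eq_run_cons: "run_snoc K k x = run_cons K k x"
proof (induction k arbitrary: x)
  case (Suc k)
  show ?case unfolding run_snoc_Suc_cons run_cons.simps Suc.IH ..
qed simp

lemma run_cons_nth_0: "xs \<in> set_pmf (run_cons K k x) \<Longrightarrow> xs ! 0 = x"
  by (cases k) auto

lemma run_cons_length: "xs \<in> set_pmf (run_cons K k x) \<Longrightarrow> length xs = Suc k"
  by (induction k arbitrary: x xs) auto

lemma run_cons_drop: "map_pmf (drop a) (run_cons K (a + b) x) = bind_pmf (kernel_power K a x) (run_cons K b)"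
proof (induction a arbitrary: x)
  case 0
  show ?case by (simp add: bind_return_pmf)
next
  case (Suc a)
  show ?case by (simp add: map_bind_pmf pmf.map_comp o_def Suc.IH bind_assoc_pmf)
qed

text \<open>The Markov property at the first grid time \<open>k 1\<close> splits off one transition
  factor, and the rest is the same claim for the grid shifted by \<open>k 1\<close>. Coinciding grid
  times are consistent because \<open>kernel_power K 0\<close> is a point mass.\<close>

lemma run_cons_grid:
  assumes "k 0 = 0" "\<And>i. i < m \<Longrightarrow> k i \<le> k (Suc i)" "k m \<le> n" "z 0 = x"
  shows "measure (measure_pmf (run_cons K n x)) {zs. \<forall>i\<le>m. zs ! k i = z i}
    = (\<Prod>i<m. pmf (kernel_power K (k (Suc i) - k i) (z i)) (z (Suc i)))"
  using assms
proof (induction m arbitrary: k z n x)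
  case 0
  have "measure (measure_pmf (run_cons K n x)) {zs. \<forall>i\<le>0. zs ! k i = z i}
      = measure (measure_pmf (run_cons K n x)) UNIV"
    using 0 by (intro measure_pmf.finite_measure_eq_AE) (auto simp: AE_measure_pmf_iff run_cons_nth_0)
  then show ?case by simp
next
  case (Suc m)
  define a where "a = k 1"
  define b where "b = n - a"
  define k' where "k' i = k (Suc i) - a" for i
  define z' where "z' i = z (Suc i)" for i
  have kmono: "a \<le> k (Suc i)" if "i \<le> m" for i
    using that
  proof (induction i)
    case (Suc i)
    then show ?case using Suc.prems \<open>\<And>i. i < Suc m \<Longrightarrow> k i \<le> k (Suc i)\<close>[of "Suc i"] by simp
  qed (simp add: a_def)
  have n: "n = a + b" using kmono[of m] Suc.prems(3) by (simp add: b_def)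
  let ?X = "{ys. \<forall>i\<le>m. ys ! k' i = z' i}"
  have "measure (measure_pmf (run_cons K n x)) {zs. \<forall>i\<le>Suc m. zs ! k i = z i}
      = measure (measure_pmf (run_cons K n x)) {zs. drop a zs \<in> ?X}"
  proof (intro measure_pmf.finite_measure_eq_AE)
    show "AE zs in measure_pmf (run_cons K n x). (zs \<in> {zs. \<forall>i\<le>Suc m. zs ! k i = z i}) = (zs \<in> {zs. drop a zs \<in> ?X})"
      unfolding AE_measure_pmf_iff
    proof
      fix zs assume zs: "zs \<in> set_pmf (run_cons K n x)"
      have "zs ! k 0 = z 0" using run_cons_nth_0[OF zs] Suc.prems by simp
      moreover have "drop a zs ! k' i = zs ! k (Suc i)" if "i \<le> m" for i
        using kmono[OF that] run_cons_length[OF zs] n by (simp add: k'_def)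
      ultimately show "(zs \<in> {zs. \<forall>i\<le>Suc m. zs ! k i = z i}) = (zs \<in> {zs. drop a zs \<in> ?X})"
        unfolding mem_Collect_eq z'_def by (metis Suc_le_mono not0_implies_Suc zero_le)
    qed
  qed auto
  also have "\<dots> = measure (measure_pmf (map_pmf (drop a) (run_cons K n x))) ?X"
    by (simp add: vimage_def)
  also have "\<dots> = measure (measure_pmf (bind_pmf (kernel_power K a x) (run_cons K b))) ?X"
    unfolding n run_cons_drop ..
  also have "\<dots> = pmf (kernel_power K a x) (z' 0) * measure (measure_pmf (run_cons K b (z' 0))) ?X"
  proof -
    have "emeasure (measure_pmf (bind_pmf (kernel_power K a x) (run_cons K b))) ?X
        = (\<integral>\<^sup>+y. emeasure (measure_pmf (run_cons K b y)) ?X \<partial>measure_pmf (kernel_power K a x))"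
      by (rule emeasure_bind_pmf)
    \<comment> \<open>A run that restarts at \<open>y\<close> has \<open>y\<close> at index
      \<open>k' 0 = 0\<close>, so only \<open>y = z' 0\<close> contributes.\<close>
    also have "\<dots> = (\<integral>\<^sup>+y. emeasure (measure_pmf (run_cons K b (z' 0))) ?X * indicator {z' 0} y \<partial>measure_pmf (kernel_power K a x))"
    proof (intro nn_integral_cong)
      fix y
      show "emeasure (measure_pmf (run_cons K b y)) ?X = emeasure (measure_pmf (run_cons K b (z' 0))) ?X * indicator {z' 0} y"
      proof (cases "y = z' 0")
        case False
        have "k' 0 = 0" by (simp add: k'_def a_def)
        then have "AE ys in measure_pmf (run_cons K b y). ys \<notin> ?X"
          using False run_cons_nth_0 by (fastforce simp: AE_measure_pmf_iff)
        then have "emeasure (measure_pmf (run_cons K b y)) ?X = 0"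
          using emeasure_eq_AE[of ?X "{}" "measure_pmf (run_cons K b y)"] by auto
        then show ?thesis using False by simp
      qed simp
    qed
    also have "\<dots> = emeasure (measure_pmf (run_cons K b (z' 0))) ?X * emeasure (measure_pmf (kernel_power K a x)) {z' 0}"
      by (subst nn_integral_cmult_indicator) auto
    finally have "ennreal (measure (measure_pmf (bind_pmf (kernel_power K a x) (run_cons K b))) ?X)
      = ennreal (measure (measure_pmf (run_cons K b (z' 0))) ?X * pmf (kernel_power K a x) (z' 0))"
      by (simp add: measure_pmf.emeasure_eq_measure measure_pmf_single ennreal_mult)
    then show ?thesis by (subst (asm) ennreal_inj) (auto simp: mult.commute)
  qed
  also have "measure (measure_pmf (run_cons K b (z' 0))) ?X = (\<Prod>i<m. pmf (kernel_power K (k' (Suc i) - k' i) (z' i)) (z' (Suc i)))"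
  proof (rule Suc.IH)
    show "k' i \<le> k' (Suc i)" if "i < m" for i
      using Suc.prems(2)[of "Suc i"] that by (simp add: k'_def)
  qed (use Suc.prems in \<open>auto simp: k'_def a_def b_def\<close>)
  also have "(\<Prod>i<m. pmf (kernel_power K (k' (Suc i) - k' i) (z' i)) (z' (Suc i)))
     = (\<Prod>i<m. pmf (kernel_power K (k (Suc (Suc i)) - k (Suc i)) (z (Suc i))) (z (Suc (Suc i))))"
  proof (intro prod.cong refl)
    fix i assume "i \<in> {..<m}"
    then have "a \<le> k (Suc i)" "a \<le> k (Suc (Suc i))" using kmono[of i] kmono[of "Suc i"] by auto
    then have "k' (Suc i) - k' i = k (Suc (Suc i)) - k (Suc i)" by (simp add: k'_def)
    then show "pmf (kernel_power K (k' (Suc i) - k' i) (z' i)) (z' (Suc i))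
       = pmf (kernel_power K (k (Suc (Suc i)) - k (Suc i)) (z (Suc i))) (z (Suc (Suc i)))" by (simp add: z'_def)
  qed
  finally show ?case
    using Suc.prems by (subst prod.lessThan_Suc_shift) (simp add: a_def z'_def)
qed

section \<open>From the greedy exploration to the chain of explored counts\<close>

definition explore_step :: "nat \<Rightarrow> real \<Rightarrow> nat \<Rightarrow> nat pmf" where
  "explore_step N p z =
     (if z < N then map_pmf (\<lambda>j. z + 1 + j) (binomial_pmf (N - z - 1) p) else return_pmf z)"

definition edges_in :: "nat set \<Rightarrow> edges" where
  "edges_in V = {e. e \<subseteq> V \<and> card e = 2}"

text \<open>Allowing any vertex set makes it possible to speak of the random graph on the vertices
  that are still unexplored, which is all that remains undisclosed during the exploration.\<close>

definition graph_on :: "nat set \<Rightarrow> real \<Rightarrow> edges pmf" where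
  "graph_on V p = map_pmf (\<lambda>X. {e. X e}) (Pi_pmf (edges_in V) False (\<lambda>_. bernoulli_pmf p))"

lemma finite_edges_in: "finite V \<Longrightarrow> finite (edges_in V)"
  unfolding edges_in_def by (rule finite_subset[of _ "Pow V"]) auto

lemma graph_on_edges: "finite V \<Longrightarrow> E \<in> set_pmf (graph_on V p) \<Longrightarrow> E \<subseteq> edges_in V"
  using set_Pi_pmf_subset[OF finite_edges_in, of V False "\<lambda>_. bernoulli_pmf p"]
  by (fastforce simp: graph_on_def)

lemma graph_on_restrict:
  assumes "finite V" "V' \<subseteq> V"
  shows "map_pmf (\<lambda>E. E \<inter> edges_in V') (graph_on V p) = graph_on V' p"
proof -
  have sub: "edges_in V' \<subseteq> edges_in V" using assms(2) by (auto simp: edges_in_def)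
  show ?thesis
    unfolding graph_on_def Pi_pmf_subset[OF finite_edges_in[OF assms(1)] sub] pmf.map_comp
    by (intro map_pmf_cong refl) (auto simp: split: if_splits)
qed

text \<open>The selected vertex is unexplored and explored neighbours are discarded, so a step
  inspects edges between unexplored vertices only.\<close>

lemma greedy_step_cong:
  assumes "E \<subseteq> edges_in {..<N}" "E' \<subseteq> edges_in {..<N}"
    "E \<inter> edges_in ({..<N} - explored s) = E' \<inter> edges_in ({..<N} - explored s)"
    "explored s \<subseteq> {..<N}"
  shows "greedy_step N E s = greedy_step N E' s"
proof (cases "explored s = {..<N}")
  case False
  have "neighbours E v - explored s = neighbours E' v - explored s" if v: "v \<in> {..<N} - explored s" for v
  proof -
    have "{v, w} \<in> E \<longleftrightarrow> {v, w} \<in> E'" if "w \<notin> explored s" for w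
    proof -
      have "{v, w} \<in> edges_in {..<N} \<Longrightarrow> {v, w} \<in> edges_in ({..<N} - explored s)"
        using v that by (auto simp: edges_in_def)
      then show ?thesis using assms by blast
    qed
    then show ?thesis by (auto simp: neighbours_def)
  qed
  moreover have "{..<N} - explored s \<noteq> {}" using False assms(4) by auto
  ultimately have "map_pmf (\<lambda>v. (insert v (fst s), snd s \<union> (neighbours E v - explored s))) (pmf_of_set ({..<N} - explored s))
      = map_pmf (\<lambda>v. (insert v (fst s), snd s \<union> (neighbours E' v - explored s))) (pmf_of_set ({..<N} - explored s))"
    by (intro map_pmf_cong refl) (auto simp: set_pmf_of_set)
  then show ?thesis by (simp add: greedy_step_def)
qed (simp add: greedy_step_def)

lemma greedy_step_explored_mono:
  assumes "s' \<in> set_pmf (greedy_step N E s)" "explored s \<subseteq> {..<N}"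
  shows "explored s \<subseteq> explored s'"
proof (cases "explored s = {..<N}")
  case False
  then have "{..<N} - explored s \<noteq> {}" using assms(2) by auto
  then show ?thesis using assms False by (auto simp: greedy_step_def explored_def)
qed (use assms in \<open>auto simp: greedy_step_def\<close>)

lemma run_cons_greedy_cong:
  assumes "E \<subseteq> edges_in {..<N}" "E' \<subseteq> edges_in {..<N}" "explored s \<subseteq> {..<N}"
    "E \<inter> edges_in ({..<N} - explored s) = E' \<inter> edges_in ({..<N} - explored s)"
  shows "run_cons (greedy_step N E) k s = run_cons (greedy_step N E') k s"
  using assms(3,4)
proof (induction k arbitrary: s)
  case (Suc k)
  have eq: "greedy_step N E s = greedy_step N E' s"
    using greedy_step_cong[OF assms(1,2) Suc.prems(2,1)] .
  have "run_cons (greedy_step N E) k s' = run_cons (greedy_step N E') k s'" if s': "s' \<in> set_pmf (greedy_step N E s)" for s'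
  proof (rule Suc.IH)
    show "explored s' \<subseteq> {..<N}"
      using greedy_step_explored[OF _ Suc.prems(1) s'] assms(1) by (auto simp: edges_in_def)
    have "explored s \<subseteq> explored s'" using greedy_step_explored_mono[OF s' Suc.prems(1)] .
    then have "edges_in ({..<N} - explored s') \<subseteq> edges_in ({..<N} - explored s)" by (auto simp: edges_in_def)
    then show "E \<inter> edges_in ({..<N} - explored s') = E' \<inter> edges_in ({..<N} - explored s')"
      using Suc.prems(2) by blast
  qed
  then show ?case unfolding run_cons.simps eq[symmetric] by (intro bind_pmf_cong refl) simp
qed simp

text \<open>Principle of deferred decisions. Once \<open>v\<close> is chosen, the possible edges
  among unexplored vertices split into the star \<open>A\<close> at \<open>v\<close> and the edges
  \<open>B\<close> avoiding \<open>v\<close>, which are independent. The star alone decides which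
  vertices are blocked, and their number is binomial; the future inspects only edges of
  \<open>B\<close> between vertices not blocked. The last hypothesis is the induction hypothesis of
  \<open>greedy_chain\<close>.\<close>

lemma greedy_first_step:
  assumes p: "p \<in> {0..1}" and s: "explored s \<subseteq> {..<N}" and v: "v \<in> {..<N} - explored s"
    and IH: "\<And>s'. explored s' \<subseteq> {..<N} \<Longrightarrow>
      bind_pmf (graph_on ({..<N} - explored s') p) (\<lambda>E. map_pmf (map (card \<circ> explored)) (run_cons (greedy_step N E) k s'))
      = run_cons (explore_step N p) k (card (explored s'))"
  shows "bind_pmf (graph_on ({..<N} - explored s) p) (\<lambda>E. map_pmf (map (card \<circ> explored))
        (run_cons (greedy_step N E) k (insert v (fst s), snd s \<union> (neighbours E v - explored s))))
      = bind_pmf (binomial_pmf (N - card (explored s) - 1) p) (\<lambda>j. run_cons (explore_step N p) k (card (explored s) + 1 + j))"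
proof -
  define V where "V = {..<N} - explored s"
  define V1 where "V1 = V - {v}"
  define A where "A = (\<lambda>w. {v, w}) ` V1"
  define B where "B = edges_in V1"
  have fin: "finite V" "finite V1" "finite A" "finite B" by (auto simp: V_def V1_def A_def B_def finite_edges_in)
  have vV: "v \<in> V" "v \<notin> V1" using v by (auto simp: V_def V1_def)
  have AB: "edges_in V = A \<union> B" "A \<inter> B = {}"
  proof -
    show "edges_in V = A \<union> B"
    proof (intro equalityI subsetI)
      fix e assume e: "e \<in> edges_in V"
      show "e \<in> A \<union> B"
      proof (cases "v \<in> e")
        case True
        then obtain w where "e = {v, w}" "w \<noteq> v" using e by (auto simp: edges_in_def card_2_iff)
        then show ?thesis using e by (auto simp: A_def V1_def edges_in_def)
      next
        case False
        then show ?thesis using e by (auto simp: B_def V1_def edges_in_def)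
      qed
    next
      fix e assume "e \<in> A \<union> B"
      then show "e \<in> edges_in V" using vV by (auto simp: A_def B_def V1_def edges_in_def card_2_iff)
    qed
    show "A \<inter> B = {}" using vV by (auto simp: A_def B_def edges_in_def)
  qed
  define W where "W f = {w \<in> V1. f {v, w}}" for f :: "nat set \<Rightarrow> bool"
  define st where "st f = (insert v (fst s), snd s \<union> W f)" for f
  have exp_st: "explored (st f) = insert v (explored s) \<union> W f" for f by (auto simp: st_def explored_def)
  have W_V1: "W f \<subseteq> V1" for f by (auto simp: W_def)
  have exp_sub: "explored (st f) \<subseteq> {..<N}" for f
    using s v W_V1[of f] by (auto simp: exp_st V1_def V_def)
  have rest: "{..<N} - explored (st f) = V1 - W f" for f by (auto simp: exp_st V1_def V_def)
  have card_exp: "card (explored (st f)) = card (explored s) + 1 + card (W f)" for f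
  proof -
    have fe: "finite (explored s)" using s finite_subset by blast
    have "v \<notin> explored s" "W f \<inter> insert v (explored s) = {}" using v by (auto simp: W_def V1_def V_def)
    then show ?thesis unfolding exp_st using fe fin W_V1[of f]
      by (subst card_Un_disjoint) (auto intro: finite_subset)
  qed
  have graph: "graph_on V p = bind_pmf (Pi_pmf A False (\<lambda>_. bernoulli_pmf p)) (\<lambda>f. map_pmf (\<lambda>E. {e \<in> A. f e} \<union> E) (graph_on V1 p))"
  proof -
    have "graph_on V p = map_pmf (\<lambda>(f, g). {e. if e \<in> A then f e else g e})
        (pair_pmf (Pi_pmf A False (\<lambda>_. bernoulli_pmf p)) (Pi_pmf B False (\<lambda>_. bernoulli_pmf p)))"
      unfolding graph_on_def AB(1) Pi_pmf_union[OF fin(3,4) AB(2)] pmf.map_comp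
      by (auto simp: o_def split_beta intro!: map_pmf_cong)
    also have "\<dots> = map_pmf (\<lambda>(f, g). {e \<in> A. f e} \<union> {e. g e})
        (pair_pmf (Pi_pmf A False (\<lambda>_. bernoulli_pmf p)) (Pi_pmf B False (\<lambda>_. bernoulli_pmf p)))"
    proof (intro map_pmf_cong refl)
      fix x assume "x \<in> set_pmf (pair_pmf (Pi_pmf A False (\<lambda>_. bernoulli_pmf p)) (Pi_pmf B False (\<lambda>_. bernoulli_pmf p)))"
      then have "\<And>e. e \<notin> B \<Longrightarrow> \<not> snd x e"
        using set_Pi_pmf_subset[OF fin(4), of False "\<lambda>_. bernoulli_pmf p"] by auto
      then show "(case x of (f, g) \<Rightarrow> {e. if e \<in> A then f e else g e}) = (case x of (f, g) \<Rightarrow> {e \<in> A. f e} \<union> {e. g e})"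
        using AB(2) by (auto simp: split_beta split: if_splits)
    qed
    also have "\<dots> = bind_pmf (Pi_pmf A False (\<lambda>_. bernoulli_pmf p)) (\<lambda>f. map_pmf (\<lambda>E. {e \<in> A. f e} \<union> E) (graph_on V1 p))"
      by (simp add: pair_pmf_def map_bind_pmf graph_on_def B_def pmf.map_comp o_def map_pmf_def[symmetric] bind_return_pmf bind_assoc_pmf)
    finally show ?thesis .
  qed
  \<comment> \<open>With the star \<open>f\<close> fixed, the edges that still matter are those
    inside \<open>V1 - W f\<close>, the new set of unexplored vertices. Restricting the graph on
    \<open>V1\<close> to them gives again a random graph, so the induction hypothesis applies to the
    new state.\<close>
  have inner: "bind_pmf (graph_on V1 p) (\<lambda>E. map_pmf (map (card \<circ> explored))
        (run_cons (greedy_step N ({e \<in> A. f e} \<union> E)) k (insert v (fst s), snd s \<union> (neighbours ({e \<in> A. f e} \<union> E) v - explored s))))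
     = run_cons (explore_step N p) k (card (explored s) + 1 + card (W f))" for f
  proof -
    have "bind_pmf (graph_on V1 p) (\<lambda>E. map_pmf (map (card \<circ> explored))
        (run_cons (greedy_step N ({e \<in> A. f e} \<union> E)) k (insert v (fst s), snd s \<union> (neighbours ({e \<in> A. f e} \<union> E) v - explored s))))
      = bind_pmf (graph_on V1 p) (\<lambda>E. map_pmf (map (card \<circ> explored))
        (run_cons (greedy_step N (E \<inter> edges_in (V1 - W f))) k (st f)))"
    proof (intro bind_pmf_cong refl)
      fix E assume "E \<in> set_pmf (graph_on V1 p)"
      then have E: "E \<subseteq> edges_in V1" using graph_on_edges[OF fin(2)] by blast
      have "neighbours ({e \<in> A. f e} \<union> E) v - explored s = W f"
      proof -
        have "{v, w} \<notin> E" for w using E vV by (auto simp: edges_in_def)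
        moreover have "{v, w} \<in> A \<longleftrightarrow> w \<in> V1" for w
          using vV by (auto simp: A_def doubleton_eq_iff)
        ultimately show ?thesis by (auto simp: neighbours_def W_def V1_def V_def)
      qed
      moreover have "run_cons (greedy_step N ({e \<in> A. f e} \<union> E)) k (st f) = run_cons (greedy_step N (E \<inter> edges_in (V1 - W f))) k (st f)"
      proof (rule run_cons_greedy_cong[OF _ _ exp_sub])
        have "A \<subseteq> edges_in V" "edges_in V1 \<subseteq> edges_in V" "edges_in V \<subseteq> edges_in {..<N}"
          using AB by (auto simp: B_def) (auto simp: edges_in_def V_def)
        then show "{e \<in> A. f e} \<union> E \<subseteq> edges_in {..<N}" "E \<inter> edges_in (V1 - W f) \<subseteq> edges_in {..<N}" using E by auto
        have "A \<inter> edges_in (V1 - W f) = {}" using vV by (auto simp: A_def edges_in_def)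
        then show "({e \<in> A. f e} \<union> E) \<inter> edges_in ({..<N} - explored (st f))
            = E \<inter> edges_in (V1 - W f) \<inter> edges_in ({..<N} - explored (st f))" unfolding rest by auto
      qed
      ultimately show "map_pmf (map (card \<circ> explored))
          (run_cons (greedy_step N ({e \<in> A. f e} \<union> E)) k (insert v (fst s), snd s \<union> (neighbours ({e \<in> A. f e} \<union> E) v - explored s)))
        = map_pmf (map (card \<circ> explored)) (run_cons (greedy_step N (E \<inter> edges_in (V1 - W f))) k (st f))"
        by (simp add: st_def)
    qed
    also have "\<dots> = bind_pmf (map_pmf (\<lambda>E. E \<inter> edges_in (V1 - W f)) (graph_on V1 p))
        (\<lambda>E. map_pmf (map (card \<circ> explored)) (run_cons (greedy_step N E) k (st f)))"
      by (simp add: bind_map_pmf)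
    also have "\<dots> = bind_pmf (graph_on ({..<N} - explored (st f)) p)
        (\<lambda>E. map_pmf (map (card \<circ> explored)) (run_cons (greedy_step N E) k (st f)))"
      unfolding rest by (subst graph_on_restrict[OF fin(2)]) auto
    also have "\<dots> = run_cons (explore_step N p) k (card (explored s) + 1 + card (W f))"
      unfolding IH[OF exp_sub] card_exp ..
    finally show ?thesis .
  qed
  have cardA: "card A = N - card (explored s) - 1"
  proof -
    have "inj_on (\<lambda>w. {v, w}) V1" by (auto simp: inj_on_def doubleton_eq_iff)
    then have "card A = card V1" unfolding A_def by (rule card_image)
    also have "\<dots> = card V - 1" using vV fin by (simp add: V1_def)
    also have "card V = N - card (explored s)" unfolding V_def using s
      by (subst card_Diff_subset) (auto intro: finite_subset)
    finally show ?thesis .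
  qed
  have cardW: "card (W f) = card {e \<in> A. f e}" for f
  proof -
    have "{e \<in> A. f e} = (\<lambda>w. {v, w}) ` W f" by (auto simp: A_def W_def)
    moreover have "inj_on (\<lambda>w. {v, w}) (W f)" by (auto simp: inj_on_def doubleton_eq_iff)
    ultimately show ?thesis by (simp add: card_image)
  qed
  have "bind_pmf (graph_on V p) (\<lambda>E. map_pmf (map (card \<circ> explored))
        (run_cons (greedy_step N E) k (insert v (fst s), snd s \<union> (neighbours E v - explored s))))
     = bind_pmf (Pi_pmf A False (\<lambda>_. bernoulli_pmf p)) (\<lambda>f. run_cons (explore_step N p) k (card (explored s) + 1 + card (W f)))"
    unfolding graph bind_assoc_pmf bind_map_pmf inner ..
  also have "\<dots> = bind_pmf (map_pmf (\<lambda>f. card {e \<in> A. f e}) (Pi_pmf A False (\<lambda>_. bernoulli_pmf p)))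
      (\<lambda>j. run_cons (explore_step N p) k (card (explored s) + 1 + j))"
    by (simp add: bind_map_pmf cardW)
  also have "map_pmf (\<lambda>f. card {e \<in> A. f e}) (Pi_pmf A False (\<lambda>_. bernoulli_pmf p)) = binomial_pmf (N - card (explored s) - 1) p"
    using binomial_pmf_altdef'[OF fin(3) cardA p, of False] by simp
  finally show ?thesis unfolding V_def .
qed

text \<open>Induction needs an arbitrary state together with a graph that is random only between its
  unexplored vertices. After exchanging the choice of \<open>v\<close> with that of the graph, the
  law of the counts no longer depends on \<open>v\<close>, so the uniform choice averages
  out.\<close>

lemma greedy_chain:
  assumes p: "p \<in> {0..1}" and s: "explored s \<subseteq> {..<N}"
  shows "bind_pmf (graph_on ({..<N} - explored s) p) (\<lambda>E. map_pmf (map (card \<circ> explored)) (run_cons (greedy_step N E) k s))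
      = run_cons (explore_step N p) k (card (explored s))"
  using s
proof (induction k arbitrary: s)
  case (Suc k)
  let ?F = "\<lambda>E s. map_pmf (map (card \<circ> explored)) (run_cons (greedy_step N E) k s)"
  let ?G = "graph_on ({..<N} - explored s) p"
  let ?z = "card (explored s)"
  have step: "map_pmf (map (card \<circ> explored)) (run_cons (greedy_step N E) (Suc k) s)
      = bind_pmf (greedy_step N E s) (\<lambda>s'. map_pmf (Cons ?z) (?F E s'))" for E
    by (simp add: map_bind_pmf pmf.map_comp o_def)
  show ?case
  proof (cases "explored s = {..<N}")
    case True
    have "bind_pmf ?G (\<lambda>E. map_pmf (map (card \<circ> explored)) (run_cons (greedy_step N E) (Suc k) s))
       = map_pmf (Cons ?z) (bind_pmf ?G (\<lambda>E. ?F E s))"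
      unfolding step using True by (simp add: greedy_step_def bind_return_pmf map_bind_pmf)
    also have "\<dots> = run_cons (explore_step N p) (Suc k) ?z"
      unfolding Suc.IH[OF Suc.prems] using True by (simp add: explore_step_def bind_return_pmf)
    finally show ?thesis .
  next
    case False
    have z: "?z < N" using psubset_card_mono[of "{..<N}" "explored s"] False Suc.prems by auto
    let ?U = "pmf_of_set ({..<N} - explored s)"
    have ne: "{..<N} - explored s \<noteq> {}" using False Suc.prems by auto
    have "bind_pmf ?G (\<lambda>E. map_pmf (map (card \<circ> explored)) (run_cons (greedy_step N E) (Suc k) s))
       = bind_pmf ?G (\<lambda>E. bind_pmf ?U (\<lambda>v. map_pmf (Cons ?z) (?F E (insert v (fst s), snd s \<union> (neighbours E v - explored s)))))"
      unfolding step using False by (simp add: greedy_step_def bind_map_pmf)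
    also have "\<dots> = bind_pmf ?U (\<lambda>v. bind_pmf ?G (\<lambda>E. map_pmf (Cons ?z) (?F E (insert v (fst s), snd s \<union> (neighbours E v - explored s)))))"
      by (rule bind_commute_pmf)
    also have "\<dots> = bind_pmf ?U (\<lambda>v. map_pmf (Cons ?z) (bind_pmf (binomial_pmf (N - ?z - 1) p) (\<lambda>j. run_cons (explore_step N p) k (?z + 1 + j))))"
    proof (intro bind_pmf_cong refl)
      fix v assume "v \<in> set_pmf ?U"
      then have v: "v \<in> {..<N} - explored s" using ne by (subst (asm) set_pmf_of_set) auto
      show "bind_pmf ?G (\<lambda>E. map_pmf (Cons ?z) (?F E (insert v (fst s), snd s \<union> (neighbours E v - explored s))))
         = map_pmf (Cons ?z) (bind_pmf (binomial_pmf (N - ?z - 1) p) (\<lambda>j. run_cons (explore_step N p) k (?z + 1 + j)))"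
        using arg_cong[OF greedy_first_step[OF p Suc.prems v Suc.IH], of "map_pmf (Cons ?z)"] by (simp only: map_bind_pmf)
    qed
    also have "\<dots> = run_cons (explore_step N p) (Suc k) ?z"
      using z by (simp add: explore_step_def bind_map_pmf map_bind_pmf bind_pmf_const)
    finally show ?thesis .
  qed
qed simp

lemma greedy_run_eq: "greedy_run N E k = run_cons (greedy_step N E) k ({}, {})"
proof -
  have "greedy_run N E k = run_snoc (greedy_step N E) k ({}, {})" by (induction k) auto
  then show ?thesis by (simp add: run_snoc_eq_run_cons)
qed

theorem greedy_exploration_Markov:
  assumes "c / real N \<in> {0..1}"
  shows "map_pmf (map (card \<circ> explored)) (greedy_exploration N c) = run_cons (explore_step N (c / real N)) N 0"
  using greedy_chain[OF assms, of "({}, {})" N N]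
  by (simp add: greedy_exploration_def map_bind_pmf greedy_run_eq explored_def graph_on_def random_graph_def edges_in_def)

lemma Z_grid_probability:
  assumes "c / real N \<in> {0..1}"
    "k 0 = 0" "\<And>i. i < m \<Longrightarrow> k i \<le> k (Suc i)" "k m \<le> N" "z 0 = 0"
  shows "measure (measure_pmf (greedy_exploration N c)) {ss. \<forall>i\<le>m. Z ss (k i) = z i}
    = (\<Prod>i<m. pmf (kernel_power (explore_step N (c / real N)) (k (Suc i) - k i) (z i)) (z (Suc i)))"
proof -
  have le: "k i \<le> N" if "i \<le> m" for i
  proof -
    have "k i \<le> k m" using that
    proof (induction rule: inc_induct)
      case (step n) then show ?case using assms(3)[of n] by simp
    qed simp
    then show ?thesis using assms(4) by simp
  qed
  have "measure (measure_pmf (greedy_exploration N c)) {ss. \<forall>i\<le>m. Z ss (k i) = z i}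
     = measure (measure_pmf (greedy_exploration N c)) {ss. \<forall>i\<le>m. map (card \<circ> explored) ss ! k i = z i}"
  proof (intro measure_pmf.finite_measure_eq_AE)
    show "AE ss in measure_pmf (greedy_exploration N c). (ss \<in> {ss. \<forall>i\<le>m. Z ss (k i) = z i})
         = (ss \<in> {ss. \<forall>i\<le>m. map (card \<circ> explored) ss ! k i = z i})"
      unfolding AE_measure_pmf_iff
    proof
      fix ss assume "ss \<in> set_pmf (greedy_exploration N c)"
      then have "length ss = Suc N"
        using run_cons_length by (auto simp: greedy_exploration_def greedy_run_eq)
      then show "(ss \<in> {ss. \<forall>i\<le>m. Z ss (k i) = z i}) = (ss \<in> {ss. \<forall>i\<le>m. map (card \<circ> explored) ss ! k i = z i})"
        using le by (auto simp: Z_def nth_map less_Suc_eq_le)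
    qed
  qed auto
  also have "\<dots> = measure (measure_pmf (map_pmf (map (card \<circ> explored)) (greedy_exploration N c))) {zs. \<forall>i\<le>m. zs ! k i = z i}"
    by (simp add: vimage_def)
  also have "\<dots> = measure (measure_pmf (run_cons (explore_step N (c / real N)) N 0)) {zs. \<forall>i\<le>m. zs ! k i = z i}"
    unfolding greedy_exploration_Markov[OF assms(1)] ..
  also have "\<dots> = (\<Prod>i<m. pmf (kernel_power (explore_step N (c / real N)) (k (Suc i) - k i) (z i)) (z (Suc i)))"
    by (rule run_cons_grid) (use assms in auto)
  finally show ?thesis .
qed

section \<open>Bounds on the transition probabilities\<close>

lemma kernel_power_absorbed: "kernel_power (explore_step N p) n N = return_pmf N"
  by (induction n) (simp_all add: explore_step_def bind_return_pmf)

lemma kernel_power_ge: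
  "w \<in> set_pmf (kernel_power (explore_step N p) n z) \<Longrightarrow> z \<le> w"
proof (induction n arbitrary: z)
  case (Suc n)
  then obtain y where "y \<in> set_pmf (explore_step N p z)" "w \<in> set_pmf (kernel_power (explore_step N p) n y)" by auto
  moreover from this(1) have "z \<le> y" by (auto simp: explore_step_def split: if_splits)
  ultimately show ?case using Suc.IH[of y] by simp
qed simp

lemma pmf_kernel_power_below: "w < z \<Longrightarrow> pmf (kernel_power (explore_step N p) n z) w = 0"
  using kernel_power_ge by (meson leD set_pmf_iff)

lemma pmf_kernel_power_Suc:
  assumes "p \<in> {0..1}" "z < N"
  shows "pmf (kernel_power (explore_step N p) (Suc n) z) w =
    (\<Sum>j\<le>N - z - 1. real (N - z - 1 choose j) * p ^ j * (1 - p) ^ (N - z - 1 - j) *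
        pmf (kernel_power (explore_step N p) n (z + 1 + j)) w)"
proof -
  have "pmf (kernel_power (explore_step N p) (Suc n) z) w
    = pmf (bind_pmf (binomial_pmf (N - z - 1) p) (\<lambda>j. kernel_power (explore_step N p) n (z + 1 + j))) w"
    using assms by (simp add: explore_step_def bind_map_pmf)
  also have "\<dots> = measure_pmf.expectation (binomial_pmf (N - z - 1) p) (\<lambda>j. pmf (kernel_power (explore_step N p) n (z + 1 + j)) w)"
    by (rule pmf_bind)
  also have "\<dots> = (\<Sum>j\<le>N - z - 1. (real (N - z - 1 choose j) * p ^ j * (1 - p) ^ (N - z - 1 - j)) *\<^sub>R
        pmf (kernel_power (explore_step N p) n (z + 1 + j)) w)"
    by (rule expectation_binomial_pmf'[OF assms(1)])
  finally show ?thesis by simp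
qed

text \<open>For \<open>w = N\<close> the chain may be absorbed before step \<open>n\<close>, hence the sign condition on \<open>\<theta>\<close>.\<close>

lemma kernel_power_upper:
  assumes p: "p \<in> {0..1}" and "z \<le> N" and w: "w \<le> N" "w < N \<or> \<theta> \<ge> 0"
  shows "pmf (kernel_power (explore_step N p) n z) w \<le>
     exp (- \<theta> * (real w - real z - real n) + real n * p * ((real N - real z) * exp \<theta> - (real N - real w)))"
  using assms(2)
proof (induction n arbitrary: z)
  case 0
  then show ?case by (cases "z = w") auto
next
  case (Suc n)
  show ?case
  proof (cases "z < N")
    case False
    then have z: "z = N" using Suc.prems by simp
    show ?thesis
    proof (cases "w = N")
      case True
      then have "\<theta> \<ge> 0" using w by simp
      then have "pmf (return_pmf N) w \<le> exp (\<theta> * (1 + real n))" using True by simp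
      then show ?thesis unfolding z kernel_power_absorbed using True by (simp add: algebra_simps)
    next
      case False
      then show ?thesis unfolding z kernel_power_absorbed by simp
    qed
  next
    case True
    let ?M = "N - z - 1"
    let ?P = "\<lambda>n z. pmf (kernel_power (explore_step N p) n z) w"
    \<comment> \<open>The factor independent of \<open>j\<close> in the bound for each summand. The
      induction hypothesis at \<open>z + 1 + j\<close> is weakened by replacing
      \<open>N - (z + 1 + j)\<close> with \<open>N - z\<close>. Of the trials in this step at least
      \<open>N - w\<close> fail when the chain ends at \<open>w\<close>, which gives the last
      factor. What depends on \<open>j\<close> is \<open>(p * exp \<theta>) ^ j\<close>, and its
      binomial sum is at most \<open>exp ((N - z) * p * exp \<theta>)\<close>.\<close>
    let ?E = "exp (- \<theta> * (real w - real z - real (Suc n)) + real n * p * ((real N - real z) * exp \<theta> - (real N - real w)))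
           * exp (- p * (real N - real w))"
    have p01: "0 \<le> p" "p \<le> 1" using p by auto
    have summand: "real (?M choose j) * p ^ j * (1 - p) ^ (?M - j) * ?P n (z + 1 + j)
        \<le> real (?M choose j) * (p * exp \<theta>) ^ j * ?E" if j: "j \<le> ?M" for j
    proof (cases "z + 1 + j \<le> w")
      case False
      then have "?P n (z + 1 + j) = 0" by (intro pmf_kernel_power_below) simp
      then show ?thesis using p01 by simp
    next
      case zw: True
      let ?y = "z + 1 + j"
      have y: "?y \<le> N" using j True by simp
      have "?P n ?y \<le> exp (- \<theta> * (real w - real ?y - real n) + real n * p * ((real N - real ?y) * exp \<theta> - (real N - real w)))"
        by (rule Suc.IH[OF y])
      also have "\<dots> \<le> exp (- \<theta> * (real w - real ?y - real n) + real n * p * ((real N - real z) * exp \<theta> - (real N - real w)))"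
      proof -
        have "(real N - real ?y) * exp \<theta> \<le> (real N - real z) * exp \<theta>" by (intro mult_right_mono) auto
        then have "real n * p * ((real N - real ?y) * exp \<theta> - (real N - real w)) \<le> real n * p * ((real N - real z) * exp \<theta> - (real N - real w))"
          using p01 by (intro mult_left_mono) auto
        then show ?thesis by simp
      qed
      finally have 1: "?P n ?y \<le> exp (- \<theta> * (real w - real ?y - real n) + real n * p * ((real N - real z) * exp \<theta> - (real N - real w)))" .
      have "(1 - p) ^ (?M - j) \<le> exp (- p) ^ (?M - j)"
        using p01 exp_ge_add_one_self[of "-p"] by (intro power_mono) auto
      also have "\<dots> = exp (- p * real (?M - j))" by (simp add: exp_of_nat_mult[symmetric] mult.commute)
      also have "\<dots> \<le> exp (- p * (real N - real w))"
      proof -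
        have "real N - real w \<le> real (?M - j)" using j True zw by (simp add: of_nat_diff)
        then have "p * (real N - real w) \<le> p * real (?M - j)" using p01 by (intro mult_left_mono)
        then show ?thesis by simp
      qed
      finally have 2: "(1 - p) ^ (?M - j) \<le> exp (- p * (real N - real w))" .
      have "real (?M choose j) * p ^ j * (1 - p) ^ (?M - j) * ?P n ?y
        \<le> real (?M choose j) * p ^ j * exp (- p * (real N - real w)) *
          exp (- \<theta> * (real w - real ?y - real n) + real n * p * ((real N - real z) * exp \<theta> - (real N - real w)))"
        using 1 2 p01 by (intro mult_mono mult_left_mono mult_nonneg_nonneg) auto
      also have "exp (- \<theta> * (real w - real ?y - real n) + real n * p * ((real N - real z) * exp \<theta> - (real N - real w)))
          = exp \<theta> ^ j * exp (- \<theta> * (real w - real z - real (Suc n)) + real n * p * ((real N - real z) * exp \<theta> - (real N - real w)))"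
        by (simp add: exp_of_nat_mult[symmetric] exp_add[symmetric] algebra_simps)
      finally show ?thesis by (simp add: power_mult_distrib mult_ac)
    qed
    have "?P (Suc n) z \<le> (\<Sum>j\<le>?M. real (?M choose j) * (p * exp \<theta>) ^ j * ?E)"
      unfolding pmf_kernel_power_Suc[OF p True] using summand by (intro sum_mono) auto
    also have "\<dots> = (p * exp \<theta> + 1) ^ ?M * ?E"
      by (subst binomial_ring) (simp add: sum_distrib_right)
    also have "\<dots> \<le> exp (real N * (p * exp \<theta>) - real z * (p * exp \<theta>)) * ?E"
    proof (rule mult_right_mono)
      have "(p * exp \<theta> + 1) ^ ?M \<le> exp (p * exp \<theta>) ^ ?M"
        using p01 exp_ge_add_one_self[of "p * exp \<theta>"] by (intro power_mono) (auto simp: add.commute)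
      also have "\<dots> = exp (real ?M * (p * exp \<theta>))" by (simp add: exp_of_nat_mult)
      also have "\<dots> \<le> exp ((real N - real z) * (p * exp \<theta>))"
        using p01 True by (subst exp_le_cancel_iff, intro mult_right_mono) auto
      finally show "(p * exp \<theta> + 1) ^ ?M \<le> exp (real N * (p * exp \<theta>) - real z * (p * exp \<theta>))"
        by (simp add: algebra_simps)
    qed simp
    also have "\<dots> = exp (- \<theta> * (real w - real z - real (Suc n)) + real (Suc n) * p * ((real N - real z) * exp \<theta> - (real N - real w)))"
      by (simp add: exp_add[symmetric] algebra_simps)
    finally show ?thesis .
  qed
qed

text \<open>On the way to \<open>w\<close> at least \<open>N - w\<close> vertices are available for
  blocking at each of the \<open>n\<close> steps, and \<open>w - z - n\<close> of them have to be
  blocked altogether. Distributing this number over the steps and summing the products of binomial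
  coefficients gives, by Vandermonde, the choices from \<open>n * (N - w)\<close> trials. All
  failures together cost at most \<open>n * (N - z)\<close> factors \<open>1 - p\<close>.\<close>

lemma kernel_power_lower:
  assumes p: "p \<in> {0..1}" and w: "w < N" and "z + n \<le> w"
  shows "real (n * (N - w) choose (w - z - n)) * p ^ (w - z - n) * (1 - p) ^ (n * (N - z))
     \<le> pmf (kernel_power (explore_step N p) n z) w"
  using assms(3)
proof (induction n arbitrary: z)
  case 0
  then show ?case by (cases "w = z") (auto simp: binomial_eq_0)
next
  case (Suc n)
  let ?M = "N - z - 1" and ?K = "N - w" and ?d = "w - z - Suc n"
  let ?P = "\<lambda>n z. pmf (kernel_power (explore_step N p) n z) w"
  have p01: "0 \<le> p" "p \<le> 1" using p by auto
  have z: "z < N" using Suc.prems w by simp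
  have dM: "?d \<le> ?M" using Suc.prems w by simp
  have summand: "real (?K choose j) * real (n * ?K choose (?d - j)) * (p ^ ?d * (1 - p) ^ (Suc n * (N - z)))
      \<le> real (?M choose j) * p ^ j * (1 - p) ^ (?M - j) * ?P n (z + 1 + j)" if j: "j \<le> ?d" for j
  proof -
    let ?y = "z + 1 + j"
    have y: "?y + n \<le> w" using j Suc.prems by simp
    have d': "w - ?y - n = ?d - j" by simp
    have "real (n * ?K choose (?d - j)) * p ^ (?d - j) * (1 - p) ^ (n * (N - z))
       \<le> real (n * ?K choose (?d - j)) * p ^ (?d - j) * (1 - p) ^ (n * (N - ?y))"
      using p01 by (intro mult_left_mono power_decreasing) auto
    also have "\<dots> \<le> ?P n ?y" using Suc.IH[OF y] unfolding d' .
    finally have 1: "real (n * ?K choose (?d - j)) * p ^ (?d - j) * (1 - p) ^ (n * (N - z)) \<le> ?P n ?y" .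
    have 2: "real (?K choose j) \<le> real (?M choose j)"
      using Suc.prems by (intro of_nat_mono binomial_right_mono) auto
    have 3: "(1 - p) ^ (N - z) \<le> (1 - p) ^ (?M - j)" using p01 by (intro power_decreasing) auto
    have "real (?K choose j) * real (n * ?K choose (?d - j)) * (p ^ ?d * (1 - p) ^ (Suc n * (N - z)))
       = (real (?K choose j) * p ^ j * (1 - p) ^ (N - z)) * (real (n * ?K choose (?d - j)) * p ^ (?d - j) * (1 - p) ^ (n * (N - z)))"
    proof -
      have "p ^ ?d = p ^ j * p ^ (?d - j)" using j by (metis le_add_diff_inverse power_add)
      then show ?thesis by (simp add: power_add)
    qed
    also have "\<dots> \<le> (real (?M choose j) * p ^ j * (1 - p) ^ (?M - j)) * ?P n ?y"
      using 1 2 3 p01 by (intro mult_mono) auto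
    finally show ?thesis .
  qed
  have "(\<Sum>j\<le>?d. real (?K choose j) * real (n * ?K choose (?d - j))) = real (Suc n * ?K choose ?d)"
    using vandermonde[of ?K "n * ?K" ?d] by (simp flip: of_nat_mult of_nat_sum)
  then have "real (Suc n * ?K choose ?d) * p ^ ?d * (1 - p) ^ (Suc n * (N - z))
     = (\<Sum>j\<le>?d. real (?K choose j) * real (n * ?K choose (?d - j)) * (p ^ ?d * (1 - p) ^ (Suc n * (N - z))))"
    by (simp only: sum_distrib_right[symmetric] mult.assoc[symmetric])
  also have "\<dots> \<le> (\<Sum>j\<le>?d. real (?M choose j) * p ^ j * (1 - p) ^ (?M - j) * ?P n (z + 1 + j))"
    using summand by (intro sum_mono) auto
  also have "\<dots> \<le> (\<Sum>j\<le>?M. real (?M choose j) * p ^ j * (1 - p) ^ (?M - j) * ?P n (z + 1 + j))"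
    using dM p01 by (intro sum_mono2) auto
  also have "\<dots> = ?P (Suc n) z" by (rule pmf_kernel_power_Suc[OF p z, symmetric])
  finally show ?case .
qed

text \<open>An elementary Stirling bound from \<open>ln y \<le> y - 1\<close>. The shifted argument
  \<open>d + 1\<close> keeps it valid, with equality, at \<open>d = 0\<close>.\<close>

lemma ln_fact_le: "ln (fact d :: real) \<le> (real d + 1) * ln (real d + 1) - real d"
proof (induction d)
  case (Suc d)
  have "ln (real d + 1) - ln (real d + 2) = ln ((real d + 1) / (real d + 2))" by (subst ln_div) auto
  also have "\<dots> \<le> (real d + 1) / (real d + 2) - 1" by (intro ln_le_minus_one) auto
  also have "\<dots> = - (1 / (real d + 2))" by (simp add: field_simps)
  finally have "(real d + 2) * (ln (real d + 1) - ln (real d + 2)) \<le> (real d + 2) * - (1 / (real d + 2))"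
    by (intro mult_left_mono) auto
  then have "(real d + 2) * ln (real d + 1) + 1 \<le> (real d + 2) * ln (real d + 2)"
    by (simp add: algebra_simps)
  moreover have "ln (fact (Suc d) :: real) = ln (real d + 1) + ln (fact d)"
    by (simp add: ln_mult add.commute)
  ultimately show ?case using Suc by (simp add: algebra_simps)
qed simp

text \<open>Each of the \<open>d\<close> factors of the falling factorial of \<open>K\<close> is at
  least \<open>K - d\<close>; the second hypothesis makes the power of \<open>K - d\<close>
  positive, so that its logarithm is meaningful.\<close>

lemma ln_binomial_ge:
  assumes "d \<le> K" "d < K \<or> d = 0"
  shows "real d * ln (real K - real d) - ((real d + 1) * ln (real d + 1) - real d) \<le> ln (real (K choose d))"
proof -
  have "(real K - real d) ^ d \<le> fact d * real (K choose d)"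
  proof -
    have "(real K - real d) ^ d = (\<Prod>i<d. real K - real d)" by simp
    also have "\<dots> \<le> (\<Prod>i<d. real (K - i))" using assms by (intro prod_mono) (auto simp: of_nat_diff)
    also have "\<dots> = fact d * real (K choose d)"
      using assms(1) by (simp add: binomial_altdef_of_nat prod_dividef fact_prod_rev atLeast0LessThan)
    finally show ?thesis .
  qed
  moreover have "0 < (real K - real d) ^ d" using assms by auto
  ultimately have "ln ((real K - real d) ^ d) \<le> ln (fact d * real (K choose d))" by (subst ln_le_cancel_iff) auto
  moreover have "ln ((real K - real d) ^ d) = real d * ln (real K - real d)"
    using assms by (auto simp: ln_realpow)
  moreover have "0 < real (K choose d)" using assms(1) by simp
  then have "ln (fact d * real (K choose d)) = ln (fact d) + ln (real (K choose d))" by (subst ln_mult) auto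
  ultimately show ?thesis using ln_fact_le[of d] by linarith
qed

section \<open>The rate function and dyadic increments\<close>

lemma straddling_derivative_DERIV:
  assumes t: "0 < t" "t < 1" and s: "straddling_derivative {0..1} (\<lambda>a b. f b - f a) t D"
  shows "(f has_real_derivative D) (at t)"
  unfolding has_field_derivative_iff tendsto_iff
proof (intro allI impI)
  fix e :: real assume e: "e > 0"
  have e2: "e/2 > 0" using e by simp
  obtain d where d0: "d > 0" "\<forall>a\<in>{0..1}. \<forall>b\<in>{0..1}. a \<le> t \<longrightarrow> t \<le> b \<longrightarrow> a < b \<longrightarrow> b - a < d \<longrightarrow>
      \<bar>f b - f a - D * (b - a)\<bar> \<le> e/2 * (b - a)"
    using straddling_derivativeD[OF s e2] by blast
  note d = d0(1) d0(2)[rule_format]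
  have "\<forall>\<^sub>F y in at t. dist y t < min d (min t (1 - t)) \<and> y \<noteq> t"
    unfolding eventually_at using d(1) t by (intro exI[of _ "min d (min t (1 - t))"]) auto
  then show "\<forall>\<^sub>F y in at t. dist ((f y - f t) / (y - t)) D < e"
  proof eventually_elim
    case (elim y)
    have "\<bar>f y - f t - D * (y - t)\<bar> \<le> e/2 * \<bar>y - t\<bar>"
    proof (cases "y > t")
      case True
      then show ?thesis using d(2)[of t y] elim t by (auto simp: dist_real_def)
    next
      case False
      then have "\<bar>f t - f y - D * (t - y)\<bar> \<le> e/2 * (t - y)"
        using d(2)[of y t] elim t by (auto simp: dist_real_def)
      moreover have "f y - f t - D * (y - t) = - (f t - f y - D * (t - y))" by (simp add: algebra_simps)
      ultimately show ?thesis using False by (simp only: abs_minus_cancel) simp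
    qed
    moreover have "dist ((f y - f t) / (y - t)) D = \<bar>f y - f t - D * (y - t)\<bar> / \<bar>y - t\<bar>"
      using elim by (simp add: dist_real_def abs_divide[symmetric] diff_divide_distrib)
    ultimately have "dist ((f y - f t) / (y - t)) D \<le> e/2" using elim by (simp add: divide_le_eq)
    then show ?case using e by linarith
  qed
qed

lemma absolutely_continuous_fun_deriv:
  assumes ac: "absolutely_continuous_fun 0 1 f"
  shows "\<exists>g :: real \<Rightarrow> real. integrable lborel g \<and>
    (\<forall>s t. 0 \<le> s \<longrightarrow> s \<le> t \<longrightarrow> t \<le> 1 \<longrightarrow> (LINT u:{s..t}|lborel. g u) = f t - f s) \<and>
    (AE t in lborel. t \<in> {0<..<1} \<longrightarrow> straddling_derivative {0..1} (\<lambda>a b. f b - f a) t (g t)) \<and>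
    (AE t in lborel. t \<in> {0<..<1} \<longrightarrow> deriv f t = g t)"
proof -
  obtain g :: "real \<Rightarrow> real" where g: "integrable lborel g"
    "\<And>s t. 0 \<le> s \<Longrightarrow> s \<le> t \<Longrightarrow> t \<le> 1 \<Longrightarrow> (LINT u:{s..t}|lborel. g u) = f t - f s"
    and neg: "negligible {t \<in> {0<..<1}. \<not> straddling_derivative {0..1} (\<lambda>a b. f b - f a) t (g t)}"
    using absolutely_continuous_fun_FTC[OF ac] by blast
  have ae: "AE t in lborel. t \<in> {0<..<1} \<longrightarrow> straddling_derivative {0..1} (\<lambda>a b. f b - f a) t (g t)"
  proof -
    have "AE t in lebesgue. t \<notin> {t \<in> {0<..<1}. \<not> straddling_derivative {0..1} (\<lambda>a b. f b - f a) t (g t)}"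
      using neg by (intro AE_not_in) (simp add: negligible_iff_null_sets)
    then show ?thesis by (auto simp: AE_completion_iff)
  qed
  moreover have "AE t in lborel. t \<in> {0<..<1} \<longrightarrow> deriv f t = g t"
    using ae by eventually_elim (auto intro!: DERIV_imp_deriv straddling_derivative_DERIV)
  ultimately show ?thesis using g by (intro exI[of _ g] conjI allI impI)
qed

text \<open>Fenchel's inequality for the pair formed by \<open>L\<close> and the cumulants of a unit
  step plus a Poisson variable of mean \<open>c * (1 - x)\<close>; it is
  \<open>ln y \<le> y - 1\<close> at \<open>y = v * exp \<theta> / u\<close>. At
  \<open>x = 1\<close>, \<open>\<beta> = 0\<close> the left side is \<open>- \<theta>\<close>,
  whence the sign condition.\<close>

lemma L_ge_dual:
  assumes c: "c > 0" and x: "x \<le> 1" and th: "x < 1 \<or> \<theta> \<ge> 0"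
  shows "ennreal (\<theta> * (\<beta> - 1) - c * (1 - x) * (exp \<theta> - 1)) \<le> L c x \<beta>"
proof -
  consider "x < 1" "\<beta> > 1" | "x < 1" "\<beta> = 1" | "x = 1" "\<beta> = 0" | "L c x \<beta> = \<infinity>"
    unfolding L_def by (cases "x < 1 \<and> \<beta> > 1"; cases "x < 1 \<and> \<beta> = 1"; cases "x = 1 \<and> \<beta> = 0") auto
  then show ?thesis
  proof cases
    case 1
    define u v where "u = \<beta> - 1" and "v = c * (1 - x)"
    have uv: "u > 0" "v > 0" using 1 c by (auto simp: u_def v_def)
    have "ln (v * exp \<theta> / u) \<le> v * exp \<theta> / u - 1" using uv by (intro ln_le_minus_one) auto
    then have "u * ln (v * exp \<theta> / u) \<le> u * (v * exp \<theta> / u - 1)" using uv by (intro mult_left_mono) auto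
    moreover have "u * (v * exp \<theta> / u - 1) = v * exp \<theta> - u" using uv by (simp add: field_simps)
    moreover have "ln (v * exp \<theta> / u) = \<theta> - ln (u / v)" using uv by (simp add: ln_div ln_mult)
    ultimately have "\<theta> * u - v * (exp \<theta> - 1) \<le> u * (ln (u / v) - 1) + v" by (simp add: algebra_simps)
    then show ?thesis using 1 unfolding L_def u_def v_def by (simp add: ennreal_leI)
  next
    case 2
    have "- (c * (1 - x) * (exp \<theta> - 1)) \<le> c * (1 - x)"
      using c 2 by (simp add: algebra_simps)
    then show ?thesis using 2 by (simp add: L_def ennreal_leI)
  next
    case 3
    then show ?thesis using th by (simp add: L_def ennreal_neg)
  qed simp
qed

lemma L_finite_imp_nonneg: "L c x \<beta> \<noteq> \<infinity> \<Longrightarrow> 0 \<le> \<beta>"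
  by (auto simp: L_def split: if_splits)

text \<open>The summand is the dual form of the cost of block \<open>i\<close>. A negative \<open>\<theta> i\<close> is not allowed
  once the path has reached 1: an absorbed path need not increase with slope at least 1. The error
  \<open>c / 2^r\<close> accounts for replacing \<open>1 - f\<close> on a block by its value at the left end.\<close>

definition dyadic_bound :: "real \<Rightarrow> (real \<Rightarrow> real) \<Rightarrow> real \<Rightarrow> bool" where
  "dyadic_bound c f \<alpha> \<longleftrightarrow> (\<forall>r \<theta>.
     (\<forall>i<2^r. f (real (Suc i) / 2^r) < 1 \<or> 0 \<le> \<theta> i) \<longrightarrow>
     (\<Sum>i<2^r. \<theta> i * (f (real (Suc i) / 2^r) - f (real i / 2^r) - 1 / 2^r)
         - c / 2^r * (1 - f (real i / 2^r)) * (exp (\<theta> i) - 1)) \<le> \<alpha> + c / 2^r)"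

section \<open>Paths of finite rate satisfy the dyadic inequality\<close>

lemma ennreal_integral_le_nn_integral:
  fixes f :: "'a \<Rightarrow> real"
  assumes "integrable M f"
  shows "ennreal (integral\<^sup>L M f) \<le> (\<integral>\<^sup>+x. ennreal (f x) \<partial>M)"
proof -
  have "ennreal (integral\<^sup>L M f) \<le> ennreal (integral\<^sup>L M (\<lambda>x. max 0 (f x)))"
    using assms by (intro ennreal_leI integral_mono) auto
  also have "\<dots> = (\<integral>\<^sup>+x. ennreal (max 0 (f x)) \<partial>M)"
    using assms by (intro nn_integral_eq_integral[symmetric]) auto
  also have "\<dots> = (\<integral>\<^sup>+x. ennreal (f x) \<partial>M)" by (intro nn_integral_cong) (simp add: max_def ennreal_neg)
  finally show ?thesis .
qed

lemma path_of_props: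
  "t \<in> {0..1} \<Longrightarrow> 0 \<le> path_of \<phi> t" "t \<in> {0..1} \<Longrightarrow> path_of \<phi> t \<le> 1"
  using path_of[of \<phi>] by (auto simp: cadlag_functions_def PiE_iff)

lemma nn_integral_lebesgue_on_lborel:
  assumes [measurable]: "f \<in> borel_measurable borel"
  shows "(\<integral>\<^sup>+t. f t \<partial>lebesgue_on {0..1::real}) = (\<integral>\<^sup>+t. f t * indicator {0..1} t \<partial>lborel)"
  by (subst nn_integral_restrict_space) (auto intro!: nn_integral_completion)

lemma AE_lebesgue_on_unit:
  assumes "AE t in lborel. t \<in> {0<..<1::real} \<longrightarrow> P t"
  shows "AE t in lebesgue_on {0..1}. P t"
proof -
  have "AE t in lebesgue. t \<in> {0<..<1} \<longrightarrow> P t" using assms by (simp add: AE_completion_iff)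
  moreover have "AE t in lebesgue. t \<noteq> (0::real)" "AE t in lebesgue. t \<noteq> (1::real)"
    by (intro AE_completion AE_lborel_singleton)+
  ultimately have "AE t in lebesgue. t \<in> {0..1} \<longrightarrow> P t"
    by eventually_elim auto
  then show ?thesis by (simp add: AE_restrict_space_iff)
qed

text \<open>Fenchel's inequality is integrated with a tilt that is constant on each dyadic cell. The
  term linear in the derivative then integrates exactly to the increment over the cell, so no
  convexity argument is needed.\<close>

lemma rate_I_imp_dyadic_bound:
  assumes c: "c > 0" and \<alpha>: "0 \<le> \<alpha>" and I: "rate_I c \<phi> \<le> ennreal \<alpha>"
  shows "mono_on {0..1} (path_of \<phi>)" "path_of \<phi> 0 = 0" "dyadic_bound c (path_of \<phi>) \<alpha>"
    "absolutely_continuous_fun 0 1 (path_of \<phi>)"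
proof -
  define f where "f = path_of \<phi>"
  have H: "\<phi> \<in> H_L c" using I by (auto simp: rate_I_def top_unique split: if_splits)
  then have ac: "absolutely_continuous_fun 0 1 f" and f0: "f 0 = 0"
    and meas: "Lagrangian_along c \<phi> \<in> borel_measurable (lebesgue_on {0..1})"
    by (auto simp: H_L_def f_def)
  have int: "(\<integral>\<^sup>+t. Lagrangian_along c \<phi> t \<partial>lebesgue_on {0..1}) \<le> ennreal \<alpha>"
    using I H by (simp add: rate_I_def)
  obtain g where g0: "integrable lborel g"
    "\<forall>s t. 0 \<le> s \<longrightarrow> s \<le> t \<longrightarrow> t \<le> 1 \<longrightarrow> (LINT u:{s..t}|lborel. g u) = f t - f s"
    "AE t in lborel. t \<in> {0<..<1} \<longrightarrow> deriv f t = g t"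
    using absolutely_continuous_fun_deriv[OF ac] by (elim exE conjE) (rule that)
  note g = g0(1) g0(2)[rule_format] g0(3)
  have gm[measurable]: "g \<in> borel_measurable borel" using g(1) by auto
  have fin: "AE t in lebesgue_on {0..1}. Lagrangian_along c \<phi> t \<noteq> \<infinity>"
  proof (rule nn_integral_PInf_AE[OF meas])
    have "(\<integral>\<^sup>+t. Lagrangian_along c \<phi> t \<partial>lebesgue_on {0..1}) < \<infinity>"
      using int by (rule order_le_less_trans) simp
    then show "(\<integral>\<^sup>+t. Lagrangian_along c \<phi> t \<partial>lebesgue_on {0..1}) \<noteq> \<infinity>" by simp
  qed
  have dg: "AE t in lebesgue_on {0..1}. deriv f t = g t" by (rule AE_lebesgue_on_unit[OF g(3)])
  \<comment> \<open>Finite cost forces slope at least 1 below level 1 and slope 0 at level 1, so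
    monotonicity follows from finiteness of the rate.\<close>
  have "AE t in lebesgue_on {0..1}. 0 \<le> g t"
    using fin dg by eventually_elim
      (metis Lagrangian_along_def f_def L_finite_imp_nonneg)
  then have "AE t in lebesgue. t \<in> {0..1} \<longrightarrow> 0 \<le> g t" by (simp add: AE_restrict_space_iff)
  then have gpos: "AE t in lborel. t \<in> {0..1} \<longrightarrow> 0 \<le> g t" by (simp add: AE_completion_iff)
  have mono: "f s \<le> f t" if "0 \<le> s" "s \<le> t" "t \<le> 1" for s t
  proof -
    have "0 \<le> (LINT u:{s..t}|lborel. g u)"
      unfolding set_lebesgue_integral_def
      by (rule integral_nonneg_AE, use gpos in eventually_elim) (use that in \<open>auto split: split_indicator\<close>)
    then show ?thesis using g(2)[OF that] by simp
  qed
  then show "mono_on {0..1} (path_of \<phi>)" by (auto simp: f_def intro!: mono_onI)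
  show "path_of \<phi> 0 = 0" "absolutely_continuous_fun 0 1 (path_of \<phi>)" using f0 ac by (auto simp: f_def)
  have frange: "0 \<le> f t" "f t \<le> 1" if "t \<in> {0..1}" for t
    using path_of_props[OF that] by (auto simp: f_def)
  show "dyadic_bound c (path_of \<phi>) \<alpha>"
    unfolding dyadic_bound_def f_def[symmetric]
  proof (intro allI impI)
    fix r :: nat and \<theta> :: "nat \<Rightarrow> real"
    assume th: "\<forall>i<2^r. f (real (Suc i) / 2^r) < 1 \<or> 0 \<le> \<theta> i"
    define h where "h = 1 / (2::real)^r"
    have h: "h > 0" by (simp add: h_def)
    define a where "a i = real i * h" for i
    have a: "real i / 2^r = a i" for i by (simp add: a_def h_def)
    have a_step: "a (Suc i) = a i + h" for i by (simp add: a_def algebra_simps)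
    have a01: "0 \<le> a i" "a (Suc i) \<le> 1" if "i < 2^r" for i
    proof -
      have "real (Suc i) \<le> 2^r" using that by (metis Suc_leI of_nat_le_iff of_nat_numeral of_nat_power)
      then show "0 \<le> a i" "a (Suc i) \<le> 1" using h by (auto simp: a_def h_def)
    qed
    \<comment> \<open>On cell \<open>i\<close> the number \<open>K i\<close> dominates
      \<open>\<theta> i + c * (1 - f t) * (exp (\<theta> i) - 1)\<close> for every \<open>t\<close>.
      For a negative tilt, moving from \<open>f t\<close> to the left end can err in the wrong
      direction, by at most the increment of \<open>f\<close> over the cell; this is the last
      summand.\<close>
    define K where "K i = \<theta> i + c * ((1 - f (a i)) * (exp (\<theta> i) - 1) + (f (a (Suc i)) - f (a i)))" for i
    define J where "J t = (\<Sum>i<2^r. indicator {a i<..a (Suc i)} t * (\<theta> i * g t - K i))" for t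
    have Jint1: "integrable lborel (\<lambda>t. indicator {a i<..a (Suc i)} t * (\<theta> i * g t - K i))"
      and Jval1: "integral\<^sup>L lborel (\<lambda>t. indicator {a i<..a (Suc i)} t * (\<theta> i * g t - K i))
         = \<theta> i * (f (a (Suc i)) - f (a i)) - K i * h" if i: "i < 2^r" for i
    proof -
      have 1: "integrable lborel (\<lambda>t. indicator {a i..a (Suc i)} t * g t)"
        using integrable_mult_indicator[OF _ g(1), of "{a i..a (Suc i)}"] by simp
      have 2: "integrable lborel (\<lambda>t. indicat_real {a i..a (Suc i)} t)"
        by (intro integrable_real_indicator) (auto simp: emeasure_lborel_Icc_eq)
      have ae: "AE t in lborel. \<theta> i * (indicator {a i..a (Suc i)} t * g t) - K i * indicator {a i..a (Suc i)} t
          = indicator {a i<..a (Suc i)} t * (\<theta> i * g t - K i)"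
        using AE_lborel_singleton[of "a i"] by eventually_elim (auto split: split_indicator)
      have 3: "integrable lborel (\<lambda>t. \<theta> i * (indicator {a i..a (Suc i)} t * g t) - K i * indicator {a i..a (Suc i)} t)"
        using 1 2 by auto
      show "integrable lborel (\<lambda>t. indicator {a i<..a (Suc i)} t * (\<theta> i * g t - K i))"
        by (rule integrable_cong_AE_imp[OF 3 _ ae]) measurable
      have "integral\<^sup>L lborel (\<lambda>t. indicator {a i<..a (Suc i)} t * (\<theta> i * g t - K i))
        = integral\<^sup>L lborel (\<lambda>t. \<theta> i * (indicator {a i..a (Suc i)} t * g t) - K i * indicator {a i..a (Suc i)} t)"
        by (rule integral_cong_AE[symmetric, OF _ _ ae]) measurable
      also have "\<dots> = \<theta> i * (LINT u:{a i..a (Suc i)}|lborel. g u) - K i * measure lborel {a i..a (Suc i)}"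
        using 1 2 by (simp add: set_lebesgue_integral_def)
      also have "measure lborel {a i..a (Suc i)} = h" using h by (simp add: a_step)
      also have "(LINT u:{a i..a (Suc i)}|lborel. g u) = f (a (Suc i)) - f (a i)"
        using a01[OF i] h by (intro g(2)) (auto simp: a_step)
      finally show "integral\<^sup>L lborel (\<lambda>t. indicator {a i<..a (Suc i)} t * (\<theta> i * g t - K i))
         = \<theta> i * (f (a (Suc i)) - f (a i)) - K i * h" .
    qed
    have Jint: "integrable lborel J" unfolding J_def using Jint1 by (intro Bochner_Integration.integrable_sum) auto
    have Jm[measurable]: "J \<in> borel_measurable borel" using Jint by auto
    have J0: "J t = 0" if "t \<notin> {0<..1}" for t
      unfolding J_def
    proof (intro sum.neutral ballI)
      fix i assume "i \<in> {..<(2::nat)^r}"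
      then have "t \<notin> {a i<..a (Suc i)}" using that a01[of i] by auto
      then show "indicator {a i<..a (Suc i)} t * (\<theta> i * g t - K i) = 0" by simp
    qed
    have JL: "ennreal (J t) \<le> Lagrangian_along c \<phi> t" if t: "t \<in> {0<..1}" and d: "deriv f t = g t" for t
    proof -
      obtain k where k: "k < 2^r" "t \<in> {a k<..a (Suc k)}"
      proof -
        define k where "k = nat (\<lceil>t / h\<rceil> - 1)"
        have "t / h > 0" using t h by simp
        then have k: "real k < t / h" "t / h \<le> real (Suc k)" unfolding k_def by linarith+
        have "t / h \<le> 2^r" using t by (simp add: h_def)
        then have "real k < 2^r" using k by linarith
        then have "k < 2^r" by (metis of_nat_less_iff of_nat_numeral of_nat_power)
        moreover have "t \<in> {a k<..a (Suc k)}" using k h by (auto simp: a_def field_simps)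
        ultimately show thesis using that by blast
      qed
      have "J t = (\<Sum>i<2^r. if i = k then \<theta> k * g t - K k else 0)"
        unfolding J_def
      proof (intro sum.cong refl)
        fix i
        show "indicator {a i<..a (Suc i)} t * (\<theta> i * g t - K i) = (if i = k then \<theta> k * g t - K k else 0)"
        proof (cases "i = k")
          case False
          then have "t \<notin> {a i<..a (Suc i)}"
            using grid_cells_inter[OF h, of t i k] k(2) unfolding a_def by blast
          then show ?thesis using False by simp
        qed (use k(2) in simp)
      qed
      then have Jt: "J t = \<theta> k * g t - K k" using k(1) by simp
      have tin: "t \<in> {0..1}" using t by auto
      have ak: "0 \<le> a k" "a k \<le> t" "t \<le> a (Suc k)" "a (Suc k) \<le> 1" using k a01[of k] by auto
      have f1: "f (a k) \<le> f t" "f t \<le> f (a (Suc k))" using ak by (auto intro!: mono)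
      have thk: "f (a (Suc k)) < 1 \<or> 0 \<le> \<theta> k" using th[rule_format, OF k(1)] unfolding a .
      have e1: "(1 - f t) * (exp (\<theta> k) - 1) \<le> (1 - f (a k)) * (exp (\<theta> k) - 1) + (f (a (Suc k)) - f (a k))"
      proof (cases "0 \<le> \<theta> k")
        case True
        then have "(1 - f t) * (exp (\<theta> k) - 1) \<le> (1 - f (a k)) * (exp (\<theta> k) - 1)"
          using f1 by (intro mult_right_mono) auto
        then show ?thesis using f1 by linarith
      next
        case False
        have "(f t - f (a k)) * (1 - exp (\<theta> k)) \<le> (f (a (Suc k)) - f (a k)) * 1"
          using f1 False by (intro mult_mono) auto
        then show ?thesis by (simp add: algebra_simps)
      qed
      have "\<theta> k * g t - K k \<le> \<theta> k * (g t - 1) - c * (1 - f t) * (exp (\<theta> k) - 1)"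
        using mult_left_mono[OF e1, of c] c by (simp add: K_def algebra_simps)
      then have "ennreal (J t) \<le> ennreal (\<theta> k * (g t - 1) - c * (1 - f t) * (exp (\<theta> k) - 1))"
        unfolding Jt by (rule ennreal_leI)
      also have "\<dots> \<le> L c (f t) (g t)"
        using thk f1 frange[OF tin] by (intro L_ge_dual c) auto
      finally show ?thesis using d by (simp add: Lagrangian_along_def f_def)
    qed
    have "ennreal (integral\<^sup>L lborel J) \<le> (\<integral>\<^sup>+t. ennreal (J t) \<partial>lborel)"
      by (rule ennreal_integral_le_nn_integral[OF Jint])
    also have "\<dots> = (\<integral>\<^sup>+t. ennreal (J t) * indicator {0..1} t \<partial>lborel)"
      by (intro nn_integral_cong) (auto simp: J0 split: split_indicator)
    also have "\<dots> = (\<integral>\<^sup>+t. ennreal (J t) \<partial>lebesgue_on {0..1})"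
      by (rule nn_integral_lebesgue_on_lborel[symmetric]) measurable
    also have "\<dots> \<le> (\<integral>\<^sup>+t. Lagrangian_along c \<phi> t \<partial>lebesgue_on {0..1})"
    proof (rule nn_integral_mono_AE)
      have "AE t in lborel. t \<in> {0<..<1} \<longrightarrow> ennreal (J t) \<le> Lagrangian_along c \<phi> t"
        using g(3) by eventually_elim (auto intro: JL)
      then show "AE t in lebesgue_on {0..1}. ennreal (J t) \<le> Lagrangian_along c \<phi> t" by (rule AE_lebesgue_on_unit)
    qed
    finally have "ennreal (integral\<^sup>L lborel J) \<le> ennreal \<alpha>" using int by (rule order_trans)
    then have "integral\<^sup>L lborel J \<le> \<alpha>" using \<alpha> by (simp add: ennreal_le_iff)
    moreover have "integral\<^sup>L lborel J = (\<Sum>i<2^r. \<theta> i * (f (a (Suc i)) - f (a i)) - K i * h)"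
      unfolding J_def using Jint1 Jval1 by (subst Bochner_Integration.integral_sum) auto
    \<comment> \<open>The corrections added in \<open>K\<close> telescope to
      \<open>c * h * (f 1 - f 0)\<close>, at most \<open>c * h\<close>.\<close>
    moreover have "(\<Sum>i<2^r. f (a (Suc i)) - f (a i)) = f 1 - f 0"
      using sum_lessThan_telescope[of "\<lambda>i. f (a i)" "2^r"] by (simp add: a_def h_def)
    moreover have "(\<Sum>i<2^r. \<theta> i * (f (a (Suc i)) - f (a i) - h) - c * h * (1 - f (a i)) * (exp (\<theta> i) - 1))
       = (\<Sum>i<2^r. \<theta> i * (f (a (Suc i)) - f (a i)) - K i * h) + c * h * (\<Sum>i<2^r. f (a (Suc i)) - f (a i))"
      unfolding sum_distrib_left sum.distrib[symmetric] by (intro sum.cong refl) (simp add: K_def algebra_simps)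
    ultimately have "(\<Sum>i<2^r. \<theta> i * (f (a (Suc i)) - f (a i) - h) - c * h * (1 - f (a i)) * (exp (\<theta> i) - 1))
        \<le> \<alpha> + c * h * (f 1 - f 0)" by simp
    also have "\<dots> \<le> \<alpha> + c * h * 1" using frange[of 1] f0 c h by (intro add_left_mono mult_left_mono) auto
    finally have bound: "(\<Sum>i<2^r. \<theta> i * (f (a (Suc i)) - f (a i) - h) - c * h * (1 - f (a i)) * (exp (\<theta> i) - 1)) \<le> \<alpha> + c * h" by simp
    have "(\<Sum>i<2^r. \<theta> i * (f (real (Suc i) / 2^r) - f (real i / 2^r) - 1 / 2^r)
         - c / 2^r * (1 - f (real i / 2^r)) * (exp (\<theta> i) - 1)) =
      (\<Sum>i<2^r. \<theta> i * (f (a (Suc i)) - f (a i) - h) - c * h * (1 - f (a i)) * (exp (\<theta> i) - 1))"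
      by (intro sum.cong refl) (simp only: a h_def times_divide_eq_right mult_1_right)
    then show "(\<Sum>i<2^r. \<theta> i * (f (real (Suc i) / 2^r) - f (real i / 2^r) - 1 / 2^r)
         - c / 2^r * (1 - f (real i / 2^r)) * (exp (\<theta> i) - 1)) \<le> \<alpha> + c / 2^r"
      using bound by (simp add: h_def)
  qed
qed

text \<open>The inequality is tested with the tilt \<open>\<theta>\<close> on the cells in
  \<open>A\<close> and 0 elsewhere. A large \<open>\<theta>\<close> makes the first term small
  whatever \<open>A\<close> is, and then few cells make the second term small: this is uniform
  integrability of the slopes, from the superlinear growth of the cost.\<close>

lemma dyadic_bound_increments:
  assumes b: "dyadic_bound c f \<alpha>" and c: "c > 0" and f: "\<And>t. t \<in> {0..1} \<Longrightarrow> 0 \<le> f t"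
    and A: "A \<subseteq> {..<2^r}" and th: "\<theta> > 0"
  shows "(\<Sum>i\<in>A. f (real (Suc i) / 2^r) - f (real i / 2^r))
     \<le> (\<alpha> + c) / \<theta> + real (card A) / 2^r * (1 + c * (exp \<theta> - 1) / \<theta>)"
proof -
  define D where "D i = f (real (Suc i) / 2^r) - f (real i / 2^r)" for i
  define \<theta>' where "\<theta>' i = (if i \<in> A then \<theta> else 0)" for i
  have fA: "finite A" using A finite_subset by blast
  have "(\<Sum>i<2^r. \<theta>' i * (D i - 1 / 2^r) - c / 2^r * (1 - f (real i / 2^r)) * (exp (\<theta>' i) - 1)) \<le> \<alpha> + c / 2^r"
    using b[unfolded dyadic_bound_def, rule_format, of r \<theta>'] th by (simp add: D_def \<theta>'_def)
  moreover have "(\<Sum>i<2^r. \<theta>' i * (D i - 1 / 2^r) - c / 2^r * (1 - f (real i / 2^r)) * (exp (\<theta>' i) - 1))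
     = (\<Sum>i\<in>A. \<theta> * (D i - 1 / 2^r) - c / 2^r * (1 - f (real i / 2^r)) * (exp \<theta> - 1))"
    using A by (intro sum.mono_neutral_cong_right) (auto simp: \<theta>'_def)
  moreover have "(\<Sum>i\<in>A. \<theta> * (D i - 1 / 2^r) - c / 2^r * (exp \<theta> - 1)) \<le> (\<Sum>i\<in>A. \<theta> * (D i - 1 / 2^r) - c / 2^r * (1 - f (real i / 2^r)) * (exp \<theta> - 1))"
  proof (intro sum_mono)
    fix i assume "i \<in> A"
    then have "i < 2^r" using A by auto
    then have "real i \<le> 2^r" by (metis less_imp_le of_nat_le_iff of_nat_numeral of_nat_power)
    then have "0 \<le> f (real i / 2^r)" by (intro f) auto
    then have "c / 2^r * (1 - f (real i / 2^r)) * (exp \<theta> - 1) \<le> c / 2^r * 1 * (exp \<theta> - 1)"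
      using c th by (intro mult_right_mono mult_left_mono) auto
    then show "\<theta> * (D i - 1 / 2^r) - c / 2^r * (exp \<theta> - 1) \<le> \<theta> * (D i - 1 / 2^r) - c / 2^r * (1 - f (real i / 2^r)) * (exp \<theta> - 1)"
      by simp
  qed
  moreover have "(\<Sum>i\<in>A. \<theta> * (D i - 1 / 2^r) - c / 2^r * (exp \<theta> - 1)) = \<theta> * (\<Sum>i\<in>A. D i) - real (card A) / 2^r * (\<theta> + c * (exp \<theta> - 1))"
    by (simp add: sum_subtractf sum_distrib_left[symmetric] right_diff_distrib) (simp add: field_simps)
  moreover have "c / 2^r \<le> c" using c by (simp add: divide_le_eq_1 le_divide_eq field_simps)
  ultimately have "\<theta> * (\<Sum>i\<in>A. D i) \<le> (\<alpha> + c) + real (card A) / 2^r * (\<theta> + c * (exp \<theta> - 1))" by linarith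
  then have "(\<Sum>i\<in>A. D i) \<le> ((\<alpha> + c) + real (card A) / 2^r * (\<theta> + c * (exp \<theta> - 1))) / \<theta>"
    using th by (simp add: le_divide_eq mult.commute)
  also have "\<dots> = (\<alpha> + c) / \<theta> + real (card A) / 2^r * (1 + c * (exp \<theta> - 1) / \<theta>)"
    using th by (simp add: add_divide_distrib distrib_left)
  finally show ?thesis by (simp add: D_def)
qed

text \<open>Covering \<open>[s, t]\<close> by dyadic cells from outside adds at most two cells,
  whose contribution vanishes as \<open>r\<close> grows. The bound depends on \<open>f\<close> only
  through \<open>\<alpha>\<close>.\<close>

lemma dyadic_bound_modulus:
  assumes b: "dyadic_bound c f \<alpha>" and c: "c > 0" and f: "\<And>t. t \<in> {0..1} \<Longrightarrow> 0 \<le> f t"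
    and mono: "mono_on {0..1} f" and th: "\<theta> > 0" and st: "0 \<le> s" "s \<le> t" "t \<le> 1"
  shows "f t - f s \<le> (\<alpha> + c) / \<theta> + (t - s) * (1 + c * (exp \<theta> - 1) / \<theta>)"
proof -
  let ?C = "1 + c * (exp \<theta> - 1) / \<theta>"
  have C: "?C \<ge> 0" using c th by simp
  have "f t - f s \<le> (\<alpha> + c) / \<theta> + (t - s + 2 * (1/2) ^ r) * ?C" for r
  proof -
    define i0 i1 where "i0 = nat \<lfloor>s * 2^r\<rfloor>" and "i1 = nat \<lceil>t * 2^r\<rceil>"
    have i: "real i0 \<le> s * 2^r" "s * 2^r - 1 \<le> real i0" "t * 2^r \<le> real i1" "real i1 \<le> t * 2^r + 1"
    proof -
      have "0 \<le> s * 2^r" "0 \<le> t * 2^r" using st by simp_all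
      then show "real i0 \<le> s * 2^r" "s * 2^r - 1 \<le> real i0" "t * 2^r \<le> real i1" "real i1 \<le> t * 2^r + 1"
        unfolding i0_def i1_def by linarith+
    qed
    have "t * 2^r \<le> 2^r" using st by simp
    then have i1: "i1 \<le> 2^r" unfolding i1_def by (simp add: ceiling_le_iff nat_le_iff)
    have "s * 2^r \<le> t * 2^r" using st by simp
    then have le: "i0 \<le> i1" using i by linarith
    have i1r: "real i1 \<le> 2^r" using i1 by (metis of_nat_le_iff of_nat_numeral of_nat_power)
    have "f t \<le> f (real i1 / 2^r)" using i i1r st by (intro mono_onD[OF mono]) (auto simp: field_simps)
    moreover have "f (real i0 / 2^r) \<le> f s" using i i1r st le by (intro mono_onD[OF mono]) (auto simp: field_simps)
    moreover have "(\<Sum>i\<in>{i0..<i1}. f (real (Suc i) / 2^r) - f (real i / 2^r)) = f (real i1 / 2^r) - f (real i0 / 2^r)"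
      using sum_Suc_diff'[OF le, of "\<lambda>i. f (real i / 2^r)"] by simp
    moreover have "(\<Sum>i\<in>{i0..<i1}. f (real (Suc i) / 2^r) - f (real i / 2^r))
       \<le> (\<alpha> + c) / \<theta> + real (card {i0..<i1}) / 2^r * ?C"
      using i1 by (intro dyadic_bound_increments[OF b c f _ th]) auto
    moreover have "real (card {i0..<i1}) / 2^r * ?C \<le> (t - s + 2 * (1/2) ^ r) * ?C"
    proof (rule mult_right_mono[OF _ C])
      have "real (card {i0..<i1}) \<le> (t - s) * 2^r + 2" using i le by (simp add: of_nat_diff left_diff_distrib)
      then have "real (card {i0..<i1}) / 2^r \<le> ((t - s) * 2^r + 2) / 2^r" by (intro divide_right_mono) auto
      also have "\<dots> = t - s + 2 * (1/2) ^ r" by (simp add: add_divide_distrib power_divide)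
      finally show "real (card {i0..<i1}) / 2^r \<le> t - s + 2 * (1/2) ^ r" .
    qed
    ultimately show ?thesis by linarith
  qed
  moreover have "(\<lambda>r. (\<alpha> + c) / \<theta> + (t - s + 2 * (1/2) ^ r) * ?C) \<longlonglongrightarrow> (\<alpha> + c) / \<theta> + (t - s + 2 * 0) * ?C"
    by (intro tendsto_intros LIMSEQ_power_zero) auto
  ultimately show ?thesis using LIMSEQ_le_const[of _ _ "f t - f s"] by fastforce
qed

lemma dyadic_bound_continuous:
  assumes b: "dyadic_bound c f \<alpha>" and c: "c > 0" and a: "\<alpha> \<ge> 0" and f: "\<And>t. t \<in> {0..1} \<Longrightarrow> 0 \<le> f t"
    and mono: "mono_on {0..1} f"
  shows "continuous_on {0..1} f"
  unfolding continuous_on_iff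
proof (intro ballI allI impI)
  fix x e :: real assume x: "x \<in> {0..1}" and e: "e > 0"
  \<comment> \<open>The tilt is fixed first and makes \<open>(\<alpha> + c) / \<theta>\<close> equal
    to \<open>e / 2\<close>; the constant \<open>C\<close> depends on it, and the admissible length
    is then chosen in terms of \<open>C\<close>.\<close>
  define \<theta> where "\<theta> = 2 * (\<alpha> + c) / e"
  have th: "\<theta> > 0" using a c e by (simp add: \<theta>_def)
  have th2: "(\<alpha> + c) / \<theta> = e / 2" using a c e by (simp add: \<theta>_def field_simps)
  define C where "C = 1 + c * (exp \<theta> - 1) / \<theta>"
  have C: "C > 0" using c th unfolding C_def by (smt (verit) divide_nonneg_nonneg mult_nonneg_nonneg one_le_exp_iff)
  have key: "\<bar>f t - f s\<bar> < e" if "0 \<le> s" "s \<le> t" "t \<le> 1" "t - s < e / (2 * C)" for s t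
  proof -
    have "(t - s) * C < e / (2 * C) * C" using that C by (intro mult_strict_right_mono)
    then have "(t - s) * C < e / 2" using C by simp
    moreover have "f s \<le> f t" using that by (intro mono_onD[OF mono]) auto
    ultimately show ?thesis using dyadic_bound_modulus[OF b c f mono th that(1-3)] th2 unfolding C_def by linarith
  qed
  show "\<exists>d>0. \<forall>x'\<in>{0..1}. dist x' x < d \<longrightarrow> dist (f x') (f x) < e"
  proof (intro exI[of _ "e / (2 * C)"] conjI ballI impI)
    show "0 < e / (2 * C)" using e C by simp
    fix y assume "y \<in> {0..1}" "dist y x < e / (2 * C)"
    then show "dist (f y) (f x) < e"
      using key[of x y] key[of y x] x by (cases "x \<le> y") (auto simp: dist_real_def abs_minus_commute)
  qed
qed

text \<open>A shared cell would have its right end in both half-open intervals \<open>(a, b]\<close>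
  and \<open>(a', b']\<close>, and points just left of it would lie in both open ones.\<close>

lemma dyadic_ranges_disjoint:
  fixes a b a' b' :: real
  assumes "0 \<le> a" "0 \<le> a'" "{a<..<b} \<inter> {a'<..<b'} = {}"
  shows "{nat \<lfloor>a * 2^r\<rfloor>..<nat \<lfloor>b * 2^r\<rfloor>} \<inter> {nat \<lfloor>a' * 2^r\<rfloor>..<nat \<lfloor>b' * 2^r\<rfloor>} = {}"
proof (rule ccontr)
  assume "\<not> ?thesis"
  then obtain i where "i \<in> {nat \<lfloor>a * 2^r\<rfloor>..<nat \<lfloor>b * 2^r\<rfloor>}" "i \<in> {nat \<lfloor>a' * 2^r\<rfloor>..<nat \<lfloor>b' * 2^r\<rfloor>}" by blast
  then have "nat \<lfloor>a * 2^r\<rfloor> \<le> i" "Suc i \<le> nat \<lfloor>b * 2^r\<rfloor>"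
    "nat \<lfloor>a' * 2^r\<rfloor> \<le> i" "Suc i \<le> nat \<lfloor>b' * 2^r\<rfloor>" by (simp_all only: atLeastLessThan_iff Suc_le_eq)
  then have "a * 2^r < real (Suc i)" "real (Suc i) \<le> b * 2^r" "a' * 2^r < real (Suc i)" "real (Suc i) \<le> b' * 2^r"
    by linarith+
  then have *: "a < real (Suc i) / 2^r" "real (Suc i) / 2^r \<le> b" "a' < real (Suc i) / 2^r" "real (Suc i) / 2^r \<le> b'"
    by (simp_all add: field_simps)
  then obtain z where "max a a' < z" "z < real (Suc i) / 2^r" using dense[of "max a a'" "real (Suc i) / 2^r"] by auto
  then have "z \<in> {a<..<b} \<inter> {a'<..<b'}" using * by auto
  then show False using assms(3) by blast
qed

text \<open>\<open>dyadic_bound_increments\<close> controls an arbitrary union of cells at once,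
  which is what absolute continuity demands. It is applied to all cells of the given intervals
  together; continuity of \<open>f\<close> allows end points to be replaced by their dyadic floors
  and the limit in \<open>r\<close> to be taken.\<close>

lemma dyadic_bound_absolutely_continuous:
  assumes b: "dyadic_bound c f \<alpha>" and c: "c > 0" and a: "\<alpha> \<ge> 0" and f: "\<And>t. t \<in> {0..1} \<Longrightarrow> 0 \<le> f t"
    and mono: "mono_on {0..1} f"
  shows "absolutely_continuous_fun 0 1 f"
  unfolding absolutely_continuous_fun_def
proof (intro allI impI)
  fix e :: real assume e: "e > 0"
  define \<theta> where "\<theta> = 4 * (\<alpha> + c) / e"
  have th: "\<theta> > 0" using a c e by (simp add: \<theta>_def)
  have th2: "(\<alpha> + c) / \<theta> = e / 4" using a c e by (simp add: \<theta>_def field_simps)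
  define C where "C = 1 + c * (exp \<theta> - 1) / \<theta>"
  have C: "C > 0" using c th unfolding C_def by (smt (verit) divide_nonneg_nonneg mult_nonneg_nonneg one_le_exp_iff)
  show "\<exists>d>0. \<forall>(m::nat) a b. (\<forall>i<m. 0 \<le> a i \<and> a i \<le> b i \<and> b i \<le> 1) \<longrightarrow>
        disjoint_family_on (\<lambda>i. {a i<..<b i}) {..<m} \<longrightarrow>
        (\<Sum>i<m. b i - a i) < d \<longrightarrow> (\<Sum>i<m. \<bar>f (b i) - f (a i)\<bar>) < e"
  proof (intro exI[of _ "e / (4 * C)"] conjI allI impI)
    show "0 < e / (4 * C)" using e C by simp
    fix m :: nat and a b :: "nat \<Rightarrow> real"
    assume h: "\<forall>i<m. 0 \<le> a i \<and> a i \<le> b i \<and> b i \<le> 1"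
      "disjoint_family_on (\<lambda>i. {a i<..<b i}) {..<m}" "(\<Sum>i<m. b i - a i) < e / (4 * C)"
    define n where "n r t = nat \<lfloor>t * 2 ^ r\<rfloor>" for r :: nat and t :: real
    have n_le: "real (n r t) \<le> 2 ^ r" if "t \<le> 1" for r t
    proof -
      have "t * 2 ^ r \<le> 2 ^ r" "(0::real) \<le> 2 ^ r" using that by simp_all
      then show ?thesis unfolding n_def by linarith
    qed
    have n_mono: "n r s \<le> n r t" if "s \<le> t" for r s t
      unfolding n_def using that by (intro nat_mono floor_mono mult_right_mono) auto
    have lim: "(\<lambda>r. f (real (n r u) / 2 ^ r)) \<longlonglongrightarrow> f u" if u: "0 \<le> u" "u \<le> 1" for u
    proof (rule continuous_on_tendsto_compose[OF dyadic_bound_continuous[OF b c \<open>\<alpha> \<ge> 0\<close> f mono]])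
      show "(\<lambda>r. real (n r u) / 2 ^ r) \<longlonglongrightarrow> u" unfolding n_def by (rule dyadic_floor_tendsto[OF u(1)])
      show "\<forall>\<^sub>F r in sequentially. real (n r u) / 2 ^ r \<in> {0..1}"
        using n_le[OF u(2)] by (intro always_eventually allI) simp
    qed (use u in auto)
    have bound: "(\<Sum>j<m. f (real (n r (b j)) / 2^r) - f (real (n r (a j)) / 2^r)) \<le> e/4 + (e / (4 * C) + real m * (1/2) ^ r) * C" for r
    proof -
      define A where "A = (\<Union>j<m. {n r (a j)..<n r (b j)})"
      have dis: "disjoint_family_on (\<lambda>j. {n r (a j)..<n r (b j)}) {..<m}"
        unfolding disjoint_family_on_def
      proof (intro ballI impI)
        fix j k assume jk: "j \<in> {..<m}" "k \<in> {..<m}" "j \<noteq> k"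
        then show "{n r (a j)..<n r (b j)} \<inter> {n r (a k)..<n r (b k)} = {}"
          unfolding n_def using h by (intro dyadic_ranges_disjoint) (auto simp: disjoint_family_on_def)
      qed
      have nab: "n r (a j) \<le> n r (b j)" if "j < m" for j using h(1) that by (intro n_mono) auto
      have A2: "A \<subseteq> {..<2^r}"
      proof
        fix i assume "i \<in> A"
        then obtain j where "j < m" "i < n r (b j)" by (auto simp: A_def)
        then have "real i < 2^r" using n_le[of "b j" r] h(1) by force
        then show "i \<in> {..<2^r}" by (metis lessThan_iff of_nat_less_iff of_nat_numeral of_nat_power)
      qed
      have "(\<Sum>j<m. f (real (n r (b j)) / 2^r) - f (real (n r (a j)) / 2^r))
         = (\<Sum>j<m. \<Sum>i\<in>{n r (a j)..<n r (b j)}. f (real (Suc i) / 2^r) - f (real i / 2^r))"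
        using sum_Suc_diff'[OF nab, of _ "\<lambda>i. f (real i / 2^r)"] by (intro sum.cong refl) simp
      also have "\<dots> = (\<Sum>i\<in>A. f (real (Suc i) / 2^r) - f (real i / 2^r))"
        unfolding A_def using dis by (intro sum.UNION_disjoint[symmetric]) (auto simp: disjoint_family_on_def)
      also have "\<dots> \<le> e/4 + real (card A) / 2^r * C"
        using dyadic_bound_increments[OF b c f A2 th] unfolding th2 C_def .
      also have "real (card A) / 2^r * C \<le> (e / (4 * C) + real m * (1/2) ^ r) * C"
      proof (rule mult_right_mono)
        have "real (card A) = (\<Sum>j<m. real (card {n r (a j)..<n r (b j)}))"
          unfolding A_def of_nat_sum[symmetric] of_nat_eq_iff
          using dis by (intro card_UN_disjoint) (auto simp: disjoint_family_on_def)
        also have "\<dots> \<le> (\<Sum>j<m. (b j - a j) * 2^r + 1)"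
        proof (intro sum_mono)
          fix j assume "j \<in> {..<m}"
          then have j: "0 \<le> a j" "a j \<le> b j" "j < m" using h(1) by auto
          have "real (n r (b j)) \<le> b j * 2^r" "a j * 2^r - 1 \<le> real (n r (a j))" using j unfolding n_def by (simp, linarith)
          then show "real (card {n r (a j)..<n r (b j)}) \<le> (b j - a j) * 2^r + 1"
            using nab[OF j(3)] by (simp add: of_nat_diff left_diff_distrib)
        qed
        also have "\<dots> = (\<Sum>j<m. b j - a j) * 2^r + real m" by (simp add: sum.distrib sum_distrib_right)
        finally have "real (card A) / 2^r \<le> ((\<Sum>j<m. b j - a j) * 2^r + real m) / 2^r" by (intro divide_right_mono) auto
        also have "\<dots> = (\<Sum>j<m. b j - a j) + real m * (1/2) ^ r" by (simp add: add_divide_distrib power_divide)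
        also have "\<dots> \<le> e / (4 * C) + real m * (1/2) ^ r" using h(3) by simp
        finally show "real (card A) / 2^r \<le> e / (4 * C) + real m * (1/2) ^ r" .
      qed (use C in auto)
      finally show ?thesis by simp
    qed
    have "(\<Sum>j<m. f (b j) - f (a j)) \<le> e/4 + (e / (4 * C) + real m * 0) * C"
    proof (rule LIMSEQ_le)
      show "(\<lambda>r. \<Sum>j<m. f (real (n r (b j)) / 2^r) - f (real (n r (a j)) / 2^r)) \<longlonglongrightarrow> (\<Sum>j<m. f (b j) - f (a j))"
        by (intro tendsto_sum tendsto_diff lim) (use h(1) in force)+
      show "(\<lambda>r. e/4 + (e / (4 * C) + real m * (1/2) ^ r) * C) \<longlonglongrightarrow> e/4 + (e / (4 * C) + real m * 0) * C"
        by (intro tendsto_intros LIMSEQ_power_zero) auto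
    qed (use bound in blast)
    also have "\<dots> < e" using e C by simp
    also have "(\<Sum>j<m. f (b j) - f (a j)) = (\<Sum>j<m. \<bar>f (b j) - f (a j)\<bar>)"
    proof (intro sum.cong refl)
      fix j assume "j \<in> {..<m}"
      then have "f (a j) \<le> f (b j)" using h(1) by (intro mono_onD[OF mono]) auto
      then show "f (b j) - f (a j) = \<bar>f (b j) - f (a j)\<bar>" by simp
    qed
    finally show "(\<Sum>i<m. \<bar>f (b i) - f (a i)\<bar>) < e" .
  qed
qed

text \<open>The dual problem is solved by \<open>ln (u / v)\<close> for \<open>\<beta> > 1\<close>
  and by tilts tending to minus infinity otherwise, with value infinity when
  \<open>\<beta> < 1\<close>. By continuity in the tilt the rationals suffice; a countable family is
  needed because each tilt is handled from some generation of the grid on.\<close>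

lemma L_le_SUP_dual:
  fixes q :: "nat \<Rightarrow> real"
  assumes c: "c > 0" and x: "x < 1" and q: "range q = \<rat>"
  shows "L c x \<beta> \<le> (SUP k. ennreal (q k * (\<beta> - 1) - c * (1 - x) * (exp (q k) - 1)))" (is "_ \<le> ?S")
proof -
  define F where "F \<theta> = \<theta> * (\<beta> - 1) - c * (1 - x) * (exp \<theta> - 1)" for \<theta>
  have rat: "ennreal (F w) \<le> ?S" if "w \<in> \<rat>" for w
  proof -
    have "w \<in> range q" using that by (simp add: q)
    then obtain k where "w = q k" by blast
    then show ?thesis using SUP_upper[of k UNIV "\<lambda>k. ennreal (F (q k))"] unfolding F_def by simp
  qed
  have real: "ennreal (F \<theta>) \<le> ?S" for \<theta>
  proof -
    have "\<theta> \<in> closure \<rat>" by (simp add: Rats_closure_real)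
    then obtain w where w: "\<And>n. w n \<in> \<rat>" "w \<longlonglongrightarrow> \<theta>" unfolding closure_sequential by blast
    have "(\<lambda>n. F (w n)) \<longlonglongrightarrow> F \<theta>" unfolding F_def by (intro tendsto_intros w(2))
    then have "(\<lambda>n. ennreal (F (w n))) \<longlonglongrightarrow> ennreal (F \<theta>)" by (rule tendsto_ennrealI)
    then show ?thesis by (rule LIMSEQ_le_const2) (use rat w(1) in auto)
  qed
  consider "\<beta> > 1" | "\<beta> = 1" | "\<beta> < 1" by linarith
  then show ?thesis
  proof cases
    case 1
    define u v where "u = \<beta> - 1" and "v = c * (1 - x)"
    have uv: "u > 0" "v > 0" using 1 c x by (auto simp: u_def v_def)
    have "F (ln (u / v)) = u * (ln (u / v) - 1) + v"
      using uv unfolding F_def u_def[symmetric] v_def[symmetric] by (simp add: field_simps)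
    then have "L c x \<beta> = ennreal (F (ln (u / v)))" using 1 x unfolding L_def u_def v_def by simp
    then show ?thesis using real by simp
  next
    case 2
    have "(\<lambda>n::nat. exp (- real n)) \<longlonglongrightarrow> 0" by real_asymp
    then have "(\<lambda>n::nat. - c * (1 - x) * (exp (- real n) - 1)) \<longlonglongrightarrow> - c * (1 - x) * (0 - 1)" by (intro tendsto_intros)
    then have "(\<lambda>n::nat. ennreal (F (- real n))) \<longlonglongrightarrow> ennreal (c * (1 - x))"
      using 2 by (intro tendsto_ennrealI) (simp add: F_def)
    then have "ennreal (c * (1 - x)) \<le> ?S" by (rule LIMSEQ_le_const2) (use real in auto)
    then show ?thesis using 2 x by (simp add: L_def)
  next
    case 3
    have "?S = \<infinity>"
    proof (rule ccontr)
      assume "?S \<noteq> \<infinity>"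
      then obtain s where s: "?S = ennreal s" "s \<ge> 0" by (cases ?S) auto
      obtain n :: nat where n: "s / (1 - \<beta>) < real n" using reals_Archimedean2 by blast
      have "s < real n * (1 - \<beta>)" using n 3 by (simp add: divide_less_eq)
      also have "\<dots> \<le> real n * (1 - \<beta>) + c * (1 - x) * (1 - exp (- real n))" using c x by simp
      also have "\<dots> = F (- real n)" by (simp add: F_def algebra_simps)
      finally have "ennreal s < ennreal (F (- real n))" using s by (simp add: ennreal_less_iff)
      moreover have "ennreal (F (- real n)) \<le> ennreal s" using real[of "- real n"] unfolding s(1) .
      ultimately show False using leD by blast
    qed
    then show ?thesis by (metis infinity_ennreal_def top_greatest)
  qed
qed

text \<open>Replacing \<open>deriv\<close> by the Borel density \<open>g\<close> changes the
  integrand on a null set only, and Lebesgue measure is complete.\<close>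

lemma Lagrangian_along_measurable:
  assumes ac: "absolutely_continuous_fun 0 1 (path_of \<phi>)"
    and gm[measurable]: "g \<in> borel_measurable borel"
    and dg: "AE t in lborel. t \<in> {0<..<1} \<longrightarrow> deriv (path_of \<phi>) t = g t"
  shows "Lagrangian_along c \<phi> \<in> borel_measurable (lebesgue_on {0..1})"
proof -
  define f where "f t = path_of \<phi> (max 0 (min 1 t))" for t
  have "continuous_on UNIV f" unfolding f_def
    by (intro continuous_on_compose2[OF absolutely_continuous_fun_continuous[OF ac]] continuous_intros) auto
  then have fm[measurable]: "f \<in> borel_measurable borel" by (rule borel_measurable_continuous_onI)
  define k where "k t = indicator {0..1} t * L c (f t) (g t)" for t
  have km[measurable]: "k \<in> borel_measurable borel" unfolding k_def L_def by measurable
  have kl: "k \<in> borel_measurable lebesgue" by (rule measurable_completion) simp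
  define h where "h t = indicator {0..1} t * Lagrangian_along c \<phi> t" for t
  have hk: "AE t in lebesgue. h t = k t"
  proof -
    have "AE t in lebesgue. t \<in> {0<..<1} \<longrightarrow> deriv (path_of \<phi>) t = g t" using dg by (simp add: AE_completion_iff)
    moreover have "AE t in lebesgue. t \<noteq> (0::real)" "AE t in lebesgue. t \<noteq> (1::real)"
      by (intro AE_completion AE_lborel_singleton)+
    ultimately show ?thesis
      by eventually_elim (auto simp: h_def k_def f_def Lagrangian_along_def split: split_indicator)
  qed
  have "h \<in> borel_measurable lebesgue"
  proof (rule measurableI)
    fix B :: "ennreal set" assume B: "B \<in> sets borel"
    show "h -` B \<inter> space lebesgue \<in> sets lebesgue"
    proof (rule completion.in_sets_AE)
      show "AE x in lebesgue. (x \<in> k -` B \<inter> space lebesgue) = (x \<in> h -` B \<inter> space lebesgue)"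
        using hk by eventually_elim auto
      show "k -` B \<inter> space lebesgue \<in> sets lebesgue" by (rule measurable_sets[OF kl B])
    qed auto
  qed simp
  then have "h \<in> borel_measurable (lebesgue_on {0..1})" by (rule measurable_restrict_space1)
  then show ?thesis
    by (rule measurable_cong[THEN iffD1, rotated]) (auto simp: h_def)
qed

lemma ceiling_cell:
  fixes t :: real assumes "0 < t" "t \<le> 1"
  obtains i where "i < 2 ^ r" "t \<in> {real i / 2 ^ r<..real (Suc i) / 2 ^ r}"
proof -
  define i where "i = nat (\<lceil>t * 2 ^ r\<rceil> - 1)"
  have "t * 2 ^ r > 0" using assms by simp
  then have k: "real i < t * 2 ^ r" "t * 2 ^ r \<le> real (Suc i)" unfolding i_def by linarith+
  have "t * 2 ^ r \<le> 2 ^ r" using assms by simp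
  then have "real i < 2 ^ r" using k by linarith
  then have "i < 2 ^ r" by (metis of_nat_less_iff of_nat_numeral of_nat_power)
  moreover have "t \<in> {real i / 2 ^ r<..real (Suc i) / 2 ^ r}" using k by (simp add: field_simps)
  ultimately show thesis by (rule that)
qed

text \<open>At generation \<open>r\<close> each cell receives the best of finitely many tilts. The
  dyadic inequality for these tilts bounds the integral of the step function \<open>G r\<close> of
  best values. At almost every \<open>t\<close> the slopes over the cells around \<open>t\<close>
  converge to the derivative and each fixed tilt is eventually among the candidates, so the lower
  limit of \<open>G r t\<close> dominates the Lagrangian.\<close>

theorem dyadic_bound_imp_rate_I:
  assumes b: "dyadic_bound c f \<alpha>" and c: "c > 0" and a: "\<alpha> \<ge> 0"
    and f: "\<And>t. t \<in> {0..1} \<Longrightarrow> 0 \<le> f t \<and> f t \<le> 1" and f0: "f 0 = 0" and mono: "mono_on {0..1} f"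
    and \<phi>: "\<And>t. t \<in> {0..1} \<Longrightarrow> path_of \<phi> t = f t"
  shows "rate_I c \<phi> \<le> ennreal \<alpha>"
proof -
  have ac: "absolutely_continuous_fun 0 1 f"
    using dyadic_bound_absolutely_continuous[OF b c a _ mono] f by blast
  \<comment> \<open>The rate speaks of \<open>path_of \<phi>\<close>, which agrees with
    \<open>f\<close> on [0,1] only, so what is known of \<open>f\<close> is first
    transferred.\<close>
  define F where "F = path_of \<phi>"
  have Ff: "F t = f t" if "t \<in> {0..1}" for t using \<phi>[OF that] by (simp add: F_def)
  have acF: "absolutely_continuous_fun 0 1 F"
    unfolding absolutely_continuous_fun_def
  proof (intro allI impI)
    fix e :: real assume "e > 0"
    then obtain d where d: "d > 0" "\<forall>(n::nat) a b. (\<forall>i<n. 0 \<le> a i \<and> a i \<le> b i \<and> b i \<le> 1) \<longrightarrow>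
        disjoint_family_on (\<lambda>i. {a i<..<b i}) {..<n} \<longrightarrow>
        (\<Sum>i<n. b i - a i) < d \<longrightarrow> (\<Sum>i<n. \<bar>f (b i) - f (a i)\<bar>) < e"
      using ac unfolding absolutely_continuous_fun_def by blast
    show "\<exists>d>0. \<forall>(n::nat) a b. (\<forall>i<n. 0 \<le> a i \<and> a i \<le> b i \<and> b i \<le> 1) \<longrightarrow>
        disjoint_family_on (\<lambda>i. {a i<..<b i}) {..<n} \<longrightarrow>
        (\<Sum>i<n. b i - a i) < d \<longrightarrow> (\<Sum>i<n. \<bar>F (b i) - F (a i)\<bar>) < e"
    proof (intro exI[of _ d] conjI allI impI d(1))
      fix n :: nat and a b :: "nat \<Rightarrow> real"
      assume h: "\<forall>i<n. 0 \<le> a i \<and> a i \<le> b i \<and> b i \<le> 1" "disjoint_family_on (\<lambda>i. {a i<..<b i}) {..<n}" "(\<Sum>i<n. b i - a i) < d"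
      have "(\<Sum>i<n. \<bar>F (b i) - F (a i)\<bar>) = (\<Sum>i<n. \<bar>f (b i) - f (a i)\<bar>)"
        using h(1) Ff by (intro sum.cong refl) force
      then show "(\<Sum>i<n. \<bar>F (b i) - F (a i)\<bar>) < e" using d(2)[rule_format, of n a b] h by simp
    qed
  qed
  have Frange: "0 \<le> F t" "F t \<le> 1" if "t \<in> {0..1}" for t using f[OF that] Ff[OF that] by auto
  have Fmono: "mono_on {0..1} F" using mono Ff unfolding mono_on_def by metis
  have dy: "real i / 2 ^ r \<in> {0..1}" if "i \<le> 2 ^ r" for i r :: nat
    using that by (auto simp: divide_le_eq_1)
  have bF: "dyadic_bound c F \<alpha>"
    unfolding dyadic_bound_def
  proof (intro allI impI)
    fix r :: nat and \<theta> :: "nat \<Rightarrow> real"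
    assume th: "\<forall>i<2^r. F (real (Suc i) / 2^r) < 1 \<or> 0 \<le> \<theta> i"
    have e: "F (real i / 2^r) = f (real i / 2^r)" if "i \<le> 2^r" for i using Ff[OF dy[OF that]] .
    have "(\<Sum>i<2^r. \<theta> i * (F (real (Suc i) / 2^r) - F (real i / 2^r) - 1 / 2^r) - c / 2^r * (1 - F (real i / 2^r)) * (exp (\<theta> i) - 1))
      = (\<Sum>i<2^r. \<theta> i * (f (real (Suc i) / 2^r) - f (real i / 2^r) - 1 / 2^r) - c / 2^r * (1 - f (real i / 2^r)) * (exp (\<theta> i) - 1))"
      by (intro sum.cong refl) (simp only: lessThan_iff Suc_leI less_imp_le e)
    also have "\<dots> \<le> \<alpha> + c / 2^r"
    proof (rule b[unfolded dyadic_bound_def, rule_format])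
      fix i :: nat assume "i < 2^r"
      then show "f (real (Suc i) / 2^r) < 1 \<or> 0 \<le> \<theta> i" using th e[of "Suc i"] by auto
    qed
    finally show "(\<Sum>i<2^r. \<theta> i * (F (real (Suc i) / 2^r) - F (real i / 2^r) - 1 / 2^r) - c / 2^r * (1 - F (real i / 2^r)) * (exp (\<theta> i) - 1)) \<le> \<alpha> + c / 2^r" .
  qed
  obtain g where g0: "integrable lborel g" "AE t in lborel. t \<in> {0<..<1} \<longrightarrow> straddling_derivative {0..1} (\<lambda>a b. F b - F a) t (g t)"
    "AE t in lborel. t \<in> {0<..<1} \<longrightarrow> deriv F t = g t"
    using absolutely_continuous_fun_deriv[OF acF] by (elim exE conjE) (rule that)
  have gm[measurable]: "g \<in> borel_measurable borel" using g0(1) by auto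
  have meas: "Lagrangian_along c \<phi> \<in> borel_measurable (lebesgue_on {0..1})"
    using Lagrangian_along_measurable[OF acF[unfolded F_def] gm g0(3)[unfolded F_def]] .
  \<comment> \<open>An enumeration of the rationals that starts with 0. The tilt 0 is always
    admissible and has value 0, so the sets \<open>Al\<close> are nonempty and the maxima
    \<open>m\<close> nonnegative.\<close>
  define q :: "nat \<Rightarrow> real" where "q k = (case k of 0 \<Rightarrow> 0 | Suc j \<Rightarrow> from_nat_into \<rat> j)" for k
  have q0: "q 0 = 0" by (simp add: q_def)
  have qrange: "range q = \<rat>"
  proof (intro equalityI subsetI)
    fix w :: real assume "w \<in> range q"
    then show "w \<in> \<rat>" using from_nat_into[of "\<rat>::real set"] Rats_0 by (fastforce simp: q_def split: nat.splits)
  next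
    fix w :: real assume "w \<in> \<rat>"
    then obtain j where "from_nat_into \<rat> j = w" using from_nat_into_surj[OF countable_rat] by blast
    then have "w = q (Suc j)" by (simp add: q_def)
    then show "w \<in> range q" by blast
  qed
  define x where "x r i = F (real i / 2 ^ r)" for r i :: nat
  define val where "val r i k = q k * (2 ^ r * (x r (Suc i) - x r i) - 1) - c * (1 - x r i) * (exp (q k) - 1)" for r i k
  \<comment> \<open>Only the tilts with index up to \<open>r\<close> compete, so the maximum is over
    a finite set, and on cells ending at level 1 negative tilts are left out, as
    \<open>dyadic_bound\<close> demands.\<close>
  define Al where "Al r i = {k. k \<le> r \<and> (x r (Suc i) < 1 \<or> 0 \<le> q k)}" for r i
  define m where "m r i = Max (val r i ` Al r i)" for r i
  have Al: "finite (Al r i)" "0 \<in> Al r i" for r i by (auto simp: Al_def q0)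
  have m_ge: "val r i k \<le> m r i" if "k \<in> Al r i" for r i k
    unfolding m_def using Al(1) that by (intro Max_ge) auto
  have m_nonneg: "0 \<le> m r i" for r i using m_ge[OF Al(2), of r i] by (simp add: val_def q0)
  have m_attained: "\<exists>k\<in>Al r i. m r i = val r i k" for r i
  proof -
    have "m r i \<in> val r i ` Al r i" unfolding m_def using Al[of r i] by (intro Max_in) auto
    then show ?thesis by auto
  qed
  then obtain kk where kk: "\<And>r i. kk r i \<in> Al r i" "\<And>r i. m r i = val r i (kk r i)" by metis
  have m_sum: "(\<Sum>i<2^r. m r i / 2^r) \<le> \<alpha> + c / 2^r" for r
  proof -
    have "(\<Sum>i<2^r. m r i / 2^r) = (\<Sum>i<2^r. q (kk r i) * (F (real (Suc i) / 2^r) - F (real i / 2^r) - 1 / 2^r) - c / 2^r * (1 - F (real i / 2^r)) * (exp (q (kk r i)) - 1))"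
      by (intro sum.cong refl) (simp add: kk(2) val_def x_def field_simps)
    also have "\<dots> \<le> \<alpha> + c / 2^r"
      using kk(1) by (intro bF[unfolded dyadic_bound_def, rule_format]) (auto simp: Al_def x_def)
    finally show ?thesis .
  qed
  define G where "G r t = (\<Sum>i<2^r. ennreal (m r i) * indicator {real i / 2^r<..real (Suc i) / 2^r} t)" for r and t :: real
  have Gm[measurable]: "G r \<in> borel_measurable borel" for r unfolding G_def by measurable
  have Gint: "(\<integral>\<^sup>+t. G r t \<partial>lborel) \<le> ennreal (\<alpha> + c / 2^r)" for r
  proof -
    have "(\<integral>\<^sup>+t. G r t \<partial>lborel) = (\<Sum>i<2^r. ennreal (m r i) * emeasure lborel {real i / 2^r<..real (Suc i) / 2^r})"
      unfolding G_def by (subst nn_integral_sum) (auto simp: nn_integral_cmult_indicator)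
    also have "\<dots> = (\<Sum>i<2^r. ennreal (m r i / 2^r))"
    proof (intro sum.cong refl)
      fix i :: nat
      have "real (Suc i) / 2^r - real i / 2^r = 1 / 2^r" by (simp add: add_divide_distrib)
      then have "emeasure lborel {real i / 2^r<..real (Suc i) / 2^r} = ennreal (1 / 2^r)"
        by (subst emeasure_lborel_Ioc) (auto simp: divide_right_mono)
      then show "ennreal (m r i) * emeasure lborel {real i / 2^r<..real (Suc i) / 2^r} = ennreal (m r i / 2^r)"
        using m_nonneg by (simp add: ennreal_mult[symmetric])
    qed
    also have "\<dots> = ennreal (\<Sum>i<2^r. m r i / 2^r)" using m_nonneg by (intro sum_ennreal) auto
    also have "\<dots> \<le> ennreal (\<alpha> + c / 2^r)" by (intro ennreal_leI m_sum)
    finally show ?thesis .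
  qed
  have Fcont: "continuous_on {0..1} F" by (rule absolutely_continuous_fun_continuous[OF acF])
  have key: "L c (F t) (deriv F t) \<le> liminf (\<lambda>r. G r t)"
    if t: "t \<in> {0<..<1}" and st: "straddling_derivative {0..1} (\<lambda>a b. F b - F a) t (g t)" and dF: "deriv F t = g t" for t
  proof -
    have t01: "t \<in> {0..1}" "0 < t" "t \<le> 1" using t by auto
    have "\<exists>i<2^r. t \<in> {real i / 2 ^ r<..real (Suc i) / 2 ^ r}" for r
      using ceiling_cell[OF t01(2,3)] by metis
    then obtain i where i: "\<And>r. i r < 2^r" "\<And>r. t \<in> {real (i r) / 2 ^ r<..real (Suc (i r)) / 2 ^ r}" by metis
    define lo hi where "lo r = real (i r) / 2 ^ r" and "hi r = real (Suc (i r)) / 2 ^ r" for r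
    have lohi: "0 \<le> lo r" "lo r < t" "t \<le> hi r" "hi r \<le> 1" "hi r - lo r = (1/2)^r" for r
      using i(2)[of r] dy[of "Suc (i r)" r] i(1)[of r] by (auto simp: lo_def hi_def Suc_le_eq add_divide_distrib power_divide)
    have lim0: "(\<lambda>r. (1/2::real)^r) \<longlonglongrightarrow> 0" by (rule LIMSEQ_power_zero) auto
    have lolim: "lo \<longlonglongrightarrow> t"
    proof (rule real_tendsto_sandwich)
      show "\<forall>\<^sub>F r in sequentially. t - (1/2)^r \<le> lo r" using lohi by (intro always_eventually allI) (smt (verit))
      show "\<forall>\<^sub>F r in sequentially. lo r \<le> t" using lohi by (intro always_eventually allI less_imp_le) auto
      show "(\<lambda>r. t - (1/2)^r) \<longlonglongrightarrow> t" using tendsto_diff[OF tendsto_const lim0, of t] by simp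
    qed simp
    have hilim: "hi \<longlonglongrightarrow> t"
    proof -
      have "hi = (\<lambda>r. lo r + (1/2)^r)" using lohi(5) by (auto simp: algebra_simps)
      then show ?thesis using tendsto_add[OF lolim lim0] by simp
    qed
    have Flo: "(\<lambda>r. F (lo r)) \<longlonglongrightarrow> F t"
      using lohi t01 by (intro continuous_on_tendsto_compose[OF Fcont lolim]) (auto intro!: always_eventually intro: order.trans[OF less_imp_le])
    have Fhi: "(\<lambda>r. F (hi r)) \<longlonglongrightarrow> F t"
      using lohi t01 by (intro continuous_on_tendsto_compose[OF Fcont hilim]) (auto intro!: always_eventually intro: order.trans[OF less_imp_le] order.trans)
    \<comment> \<open>The dyadic cell \<open>[lo r, hi r]\<close> contains \<open>t\<close>, at an
      uncontrolled position, so this convergence needs the straddling form of the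
      derivative.\<close>
    have slope: "(\<lambda>r. 2 ^ r * (F (hi r) - F (lo r))) \<longlonglongrightarrow> g t"
      unfolding lim_sequentially
    proof (intro allI impI)
      fix e :: real assume e: "e > 0"
      then have e2: "e/2 > 0" by simp
      obtain d where d0: "d > 0" "\<forall>a\<in>{0..1}. \<forall>b\<in>{0..1}. a \<le> t \<longrightarrow> t \<le> b \<longrightarrow> a < b \<longrightarrow> b - a < d \<longrightarrow>
          \<bar>F b - F a - g t * (b - a)\<bar> \<le> e/2 * (b - a)"
        using straddling_derivativeD[OF st e2] by blast
      note d = d0(1) d0(2)[rule_format]
      obtain R where R: "(1/2::real) ^ R < d" using real_arch_pow_inv[OF d(1), of "1/2"] by auto
      have "dist (2 ^ r * (F (hi r) - F (lo r))) (g t) < e" if "R \<le> r" for r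
      proof -
        have "(1/2::real) ^ r \<le> (1/2) ^ R" using that by (intro power_decreasing) auto
        then have "hi r - lo r < d" using R lohi(5)[of r] by linarith
        then have "\<bar>F (hi r) - F (lo r) - g t * (hi r - lo r)\<bar> \<le> e/2 * (hi r - lo r)"
          using lohi[of r] by (intro d(2)) auto
        then have "2 ^ r * \<bar>F (hi r) - F (lo r) - g t * (1/2)^r\<bar> \<le> 2 ^ r * (e/2 * (1/2)^r)"
          unfolding lohi(5) by (intro mult_left_mono) auto
        moreover have "2 ^ r * \<bar>F (hi r) - F (lo r) - g t * (1/2)^r\<bar> = \<bar>2 ^ r * (F (hi r) - F (lo r)) - g t\<bar>"
        proof -
          have "2 ^ r * (F (hi r) - F (lo r) - g t * (1/2)^r) = 2 ^ r * (F (hi r) - F (lo r)) - g t"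
            by (simp add: right_diff_distrib power_divide)
          then show ?thesis by (metis abs_mult abs_numeral power_abs)
        qed
        moreover have "2 ^ r * (e/2 * (1/2)^r) = e/2" by (simp add: power_divide)
        ultimately show ?thesis unfolding dist_real_def using e by linarith
      qed
      then show "\<exists>no. \<forall>n\<ge>no. dist (2 ^ n * (F (hi n) - F (lo n))) (g t) < e" by blast
    qed
    show ?thesis
    proof (cases "F t = 1")
      case True
      \<comment> \<open>Having reached level 1 a monotone path stays there, so increments to the
        right of \<open>t\<close> vanish and the derivative can only be 0, the slope at which
        \<open>L\<close> is 0.\<close>
      have "g t = 0"
      proof -
        have "F (hi r) = 1" for r
          using mono_onD[OF Fmono, of t "hi r"] lohi[of r] t01 Frange[of "hi r"] True by auto
        then have "(\<lambda>r. 2 ^ r * (1 - F (lo r))) \<longlonglongrightarrow> g t" using slope by simp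
        moreover have False if "g t \<noteq> 0"
        proof -
          have e2: "\<bar>g t\<bar> / 2 > 0" using that by simp
          obtain d where d0: "d > 0" "\<forall>a\<in>{0..1}. \<forall>b\<in>{0..1}. a \<le> t \<longrightarrow> t \<le> b \<longrightarrow> a < b \<longrightarrow> b - a < d \<longrightarrow>
              \<bar>F b - F a - g t * (b - a)\<bar> \<le> \<bar>g t\<bar> / 2 * (b - a)"
            using straddling_derivativeD[OF st e2] by blast
          note d = d0(1) d0(2)[rule_format]
          define b where "b = min 1 (t + d/2)"
          have b: "t < b" "b \<le> 1" "b - t < d" using t d(1) by (auto simp: b_def)
          have "F b = 1" using mono_onD[OF Fmono, of t b] b t01 Frange[of b] True by auto
          then have "\<bar>F b - F t - g t * (b - t)\<bar> = \<bar>g t\<bar> * (b - t)" using b True by (simp add: abs_mult)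
          moreover have "\<bar>F b - F t - g t * (b - t)\<bar> \<le> \<bar>g t\<bar> / 2 * (b - t)"
            by (intro d(2)) (use b t01 in auto)
          ultimately have "\<bar>g t\<bar> * (b - t) \<le> \<bar>g t\<bar> / 2 * (b - t)" by linarith
          then have "\<bar>g t\<bar> \<le> \<bar>g t\<bar> / 2" using b by (simp only: mult_le_cancel_right)
          then show False using that by simp
        qed
        ultimately show ?thesis by blast
      qed
      then show ?thesis using True dF by (simp add: L_def)
    next
      case False
      then have Ft: "F t < 1" using Frange(2)[OF t01(1)] by linarith
      \<comment> \<open>Below level 1, continuity puts the right end of the cell below 1 for large
        \<open>r\<close>, so the tilt \<open>q k\<close> becomes admissible however negative it
        is.\<close>
      have "ennreal (q k * (g t - 1) - c * (1 - F t) * (exp (q k) - 1)) \<le> liminf (\<lambda>r. G r t)" for k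
      proof -
        have xv: "x r (i r) = F (lo r)" "x r (Suc (i r)) = F (hi r)" for r by (auto simp: x_def lo_def hi_def)
        have "(\<lambda>r. val r (i r) k) \<longlonglongrightarrow> q k * (g t - 1) - c * (1 - F t) * (exp (q k) - 1)"
          unfolding val_def xv by (intro tendsto_intros slope Flo)
        then have "(\<lambda>r. ennreal (val r (i r) k)) \<longlonglongrightarrow> ennreal (q k * (g t - 1) - c * (1 - F t) * (exp (q k) - 1))"
          by (rule tendsto_ennrealI)
        then have "ennreal (q k * (g t - 1) - c * (1 - F t) * (exp (q k) - 1)) = liminf (\<lambda>r. ennreal (val r (i r) k))"
          by (rule lim_imp_Liminf[symmetric, rotated]) simp
        also have "\<dots> \<le> liminf (\<lambda>r. G r t)"
        proof (rule Liminf_mono)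
          have "\<forall>\<^sub>F r in sequentially. F (hi r) < 1" by (rule order_tendstoD(2)[OF Fhi Ft])
          then show "\<forall>\<^sub>F r in sequentially. ennreal (val r (i r) k) \<le> G r t"
            using eventually_ge_at_top[of k]
          proof eventually_elim
            case (elim r)
            have "k \<in> Al r (i r)" using elim by (simp add: Al_def xv)
            then have "ennreal (val r (i r) k) \<le> ennreal (m r (i r))" by (intro ennreal_leI m_ge)
            also have "\<dots> = ennreal (m r (i r)) * indicator {real (i r) / 2^r<..real (Suc (i r)) / 2^r} t"
              using i(2)[of r] by simp
            also have "\<dots> \<le> G r t" unfolding G_def using i(1)[of r] by (intro member_le_sum) auto
            finally show ?case .
          qed
        qed
        finally show ?thesis .
      qed
      then have "(SUP k. ennreal (q k * (g t - 1) - c * (1 - F t) * (exp (q k) - 1))) \<le> liminf (\<lambda>r. G r t)"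
        by (intro SUP_least) auto
      then show ?thesis unfolding dF using L_le_SUP_dual[OF c Ft qrange] by (rule order_trans[rotated])
    qed
  qed
  have "(\<integral>\<^sup>+t. Lagrangian_along c \<phi> t \<partial>lebesgue_on {0..1}) \<le> (\<integral>\<^sup>+t. liminf (\<lambda>r. G r t) \<partial>lebesgue_on {0..1})"
  proof (rule nn_integral_mono_AE, rule AE_lebesgue_on_unit)
    show "AE t in lborel. t \<in> {0<..<1} \<longrightarrow> Lagrangian_along c \<phi> t \<le> liminf (\<lambda>r. G r t)"
      using g0(2,3)
    proof eventually_elim
      case (elim t)
      then show ?case using key[of t] unfolding Lagrangian_along_def F_def by blast
    qed
  qed
  also have "\<dots> = (\<integral>\<^sup>+t. liminf (\<lambda>r. G r t) * indicator {0..1} t \<partial>lborel)"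
    by (rule nn_integral_lebesgue_on_lborel) measurable
  also have "\<dots> \<le> (\<integral>\<^sup>+t. liminf (\<lambda>r. G r t) \<partial>lborel)"
    by (intro nn_integral_mono) (auto split: split_indicator)
  also have "\<dots> \<le> liminf (\<lambda>r. \<integral>\<^sup>+t. G r t \<partial>lborel)" by (rule nn_integral_liminf) measurable
  also have "\<dots> \<le> liminf (\<lambda>r. ennreal (\<alpha> + c / 2^r))" using Gint by (intro Liminf_mono always_eventually allI)
  also have "\<dots> = ennreal \<alpha>"
  proof (rule lim_imp_Liminf)
    have "(\<lambda>r. \<alpha> + c * (1/2) ^ r) \<longlonglongrightarrow> \<alpha> + c * 0" by (intro tendsto_intros LIMSEQ_power_zero) auto
    then show "(\<lambda>r. ennreal (\<alpha> + c / 2^r)) \<longlonglongrightarrow> ennreal \<alpha>" by (intro tendsto_ennrealI) (simp add: power_divide)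
  qed simp
  finally have int: "(\<integral>\<^sup>+t. Lagrangian_along c \<phi> t \<partial>lebesgue_on {0..1}) \<le> ennreal \<alpha>" .
  then have "(\<integral>\<^sup>+t. Lagrangian_along c \<phi> t \<partial>lebesgue_on {0..1}) < \<infinity>" by (rule order_le_less_trans) simp
  then have "\<phi> \<in> H_L c" using acF meas \<phi>[of 0] f0 by (simp add: H_L_def F_def)
  then show ?thesis using int by (simp add: rate_I_def)
qed

section \<open>Compactness of the sublevel sets\<close>

lemma countable_convergent_subsequence:
  fixes f :: "nat \<Rightarrow> 'a \<Rightarrow> real"
  assumes S: "countable S" and bdd: "\<And>n x. x \<in> S \<Longrightarrow> f n x \<in> {A..B}"
  obtains s where "strict_mono (s :: nat \<Rightarrow> nat)" "\<And>x. x \<in> S \<Longrightarrow> convergent (\<lambda>n. f (s n) x)"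
proof (cases "S = {}")
  case True
  then show thesis using that[of id] by (simp add: strict_mono_id)
next
  case False
  define r where "r = from_nat_into S"
  have rS: "r n \<in> S" for n using from_nat_into[OF False] by (simp add: r_def)
  let ?P = "\<lambda>n s. convergent (\<lambda>k. f (s k) (r n))"
  interpret nat: subseqs ?P
  proof
    fix n and s :: "nat \<Rightarrow> nat"
    have "\<And>k. f (s k) (r n) \<in> {A..B}" using bdd[OF rS] by blast
    then obtain l s' where "strict_mono s'" "((\<lambda>k. f (s k) (r n)) \<circ> s') \<longlonglongrightarrow> l"
      using compact_Icc[of A B] compact_imp_seq_compact seq_compactE by metis
    then show "\<exists>s'. strict_mono s' \<and> ?P n (s \<circ> s')" by (auto simp: convergent_def o_def)
  qed
  have P: "?P n nat.diagseq" for n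
  proof -
    have "?P n (nat.diagseq \<circ> ((+) (Suc n)))"
    proof (rule nat.diagseq_holds)
      fix u s :: "nat \<Rightarrow> nat" and m assume "strict_mono u" "?P m s"
      then have "convergent ((\<lambda>k. f (s k) (r m)) \<circ> u)" by (rule convergent_subseq_convergent[rotated])
      then show "?P m (s \<circ> u)" by (simp add: o_def)
    qed
    then have "convergent (\<lambda>k. f (nat.diagseq (k + Suc n)) (r n))" by (simp add: o_def add.commute)
    then show ?thesis by (subst (asm) convergent_ignore_initial_segment)
  qed
  show thesis
  proof (rule that[OF nat.subseq_diagseq])
    fix x assume "x \<in> S"
    then obtain n where "r n = x" unfolding r_def using from_nat_into_surj[OF S] by blast
    then show "convergent (\<lambda>n. f (nat.diagseq n) x)" using P[of n] by simp
  qed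
qed

lemma dyadic_in_unit: "i \<le> 2 ^ r \<Longrightarrow> real i / 2 ^ r \<in> {0..1}"
  by (auto simp: divide_le_eq_1)

lemma monotone_selection:
  fixes y :: "nat \<Rightarrow> real \<Rightarrow> real"
  assumes mono: "\<And>n. mono_on {0..1} (y n)" and rng: "\<And>n t. t \<in> {0..1} \<Longrightarrow> y n t \<in> {0..1}"
  obtains s f where "strict_mono (s :: nat \<Rightarrow> nat)" "mono_on {0..1} f" "\<And>t. t \<in> {0..1} \<Longrightarrow> f t \<in> {0..1}"
    "\<And>t. t \<in> \<rat> \<inter> {0..1} \<Longrightarrow> (\<lambda>n. y (s n) t) \<longlonglongrightarrow> f t"
proof -
  let ?S = "\<rat> \<inter> {0..1::real}"
  have "countable ?S" using countable_rat by blast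
  then obtain s where s: "strict_mono s" "\<And>x. x \<in> ?S \<Longrightarrow> convergent (\<lambda>n. y (s n) x)"
    using countable_convergent_subsequence[of ?S y 0 1] rng by (metis IntD2)
  define l where "l q = lim (\<lambda>n. y (s n) q)" for q
  have l: "(\<lambda>n. y (s n) q) \<longlonglongrightarrow> l q" if "q \<in> ?S" for q
    using s(2)[OF that] by (simp add: l_def convergent_LIMSEQ_iff)
  have lrng: "l q \<in> {0..1}" if "q \<in> ?S" for q
    using LIMSEQ_le_const[OF l[OF that], of 0] LIMSEQ_le_const2[OF l[OF that], of 1] rng[of q] that by auto
  have lmono: "l p \<le> l q" if "p \<in> ?S" "q \<in> ?S" "p \<le> q" for p q
    using that by (intro LIMSEQ_le[OF l[OF that(1)] l[OF that(2)]]) (auto intro!: mono_onD[OF mono])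
  \<comment> \<open>The infimum runs over rationals \<open>q \<ge> t\<close>, not
    \<open>q > t\<close>, so that \<open>f\<close> keeps the value \<open>l\<close> at rational
    points, where alone convergence is claimed.\<close>
  define f where "f t = Inf (l ` {q \<in> ?S. t \<le> q})" for t
  have bdd: "bdd_below (l ` {q \<in> ?S. t \<le> q})" for t
    using lrng by (intro bdd_belowI[of _ 0]) auto
  have ne: "1 \<in> {q \<in> ?S. t \<le> q}" if "t \<in> {0..1}" for t using that by auto
  have fl: "f q = l q" if q: "q \<in> ?S" for q
    unfolding f_def
  proof (rule cInf_eq_minimum)
    show "l q \<in> l ` {qa \<in> ?S. q \<le> qa}" using q by blast
    fix x assume "x \<in> l ` {qa \<in> ?S. q \<le> qa}"
    then show "l q \<le> x" using lmono[OF q] by blast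
  qed
  show thesis
  proof (rule that[OF s(1), of f])
    show "mono_on {0..1} f"
    proof (rule mono_onI)
      fix a b :: real assume ab: "a \<in> {0..1}" "b \<in> {0..1}" "a \<le> b"
      show "f a \<le> f b" unfolding f_def using ne[OF ab(2)] ab(3) by (intro cInf_superset_mono bdd) auto
    qed
    fix t :: real
    { assume t: "t \<in> {0..1}"
      have "0 \<le> f t" unfolding f_def using ne[OF t] lrng by (intro cInf_greatest) auto
      moreover have "f t \<le> l 1" unfolding f_def using ne[OF t] by (intro cInf_lower bdd imageI)
      moreover have "l 1 \<le> 1" using lrng[of 1] by auto
      ultimately show "f t \<in> {0..1}" by auto }
    { assume "t \<in> ?S" then show "(\<lambda>n. y (s n) t) \<longlonglongrightarrow> f t" using l fl by simp }
  qed
qed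

text \<open>Between neighbouring grid points both functions are enclosed by their values there; the
  grid is fine enough for \<open>f\<close> to vary by less than \<open>e / 2\<close> on a cell, and
  finitely many grid values are eventually within \<open>e / 2\<close>.\<close>

lemma monotone_uniform_limit:
  fixes y :: "nat \<Rightarrow> real \<Rightarrow> real"
  assumes mono: "\<And>n. mono_on {0..1} (y n)" and f: "mono_on {0..1} f" "continuous_on {0..1} f"
    and lim: "\<And>r i. i \<le> 2^r \<Longrightarrow> (\<lambda>n. y n (real i / 2^r)) \<longlonglongrightarrow> f (real i / 2^r)"
    and e: "e > 0"
  shows "\<forall>\<^sub>F n in sequentially. \<forall>t\<in>{0..1}. \<bar>y n t - f t\<bar> < e"
proof -
  have "uniformly_continuous_on {0..1} f" using f(2) compact_uniformly_continuous by blast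
  then obtain d where d: "d > 0" "\<And>s t. s \<in> {0..1} \<Longrightarrow> t \<in> {0..1} \<Longrightarrow> dist t s < d \<Longrightarrow> dist (f t) (f s) < e/2"
    unfolding uniformly_continuous_on_def using e by (metis half_gt_zero)
  obtain r where r: "(1/2::real) ^ r < d" using real_arch_pow_inv[OF d(1), of "1/2"] by auto
  have "\<forall>\<^sub>F n in sequentially. \<forall>i\<in>{..2^r}. dist (y n (real i / 2^r)) (f (real i / 2^r)) < e/2"
    using e by (intro eventually_ball_finite ballI tendstoD[OF lim]) auto
  then show ?thesis
  proof eventually_elim
    case (elim n)
    show ?case
    proof
      fix t :: real assume t: "t \<in> {0..1}"
      show "\<bar>y n t - f t\<bar> < e"
      proof (cases "t = 0")
        case True
        then show ?thesis using elim[rule_format, of 0] e by (simp add: dist_real_def)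
      next
        case False
        then obtain i where i: "i < 2 ^ r" "t \<in> {real i / 2 ^ r<..real (Suc i) / 2 ^ r}"
          using ceiling_cell[of t r] t by auto
        let ?a = "real i / 2 ^ r" and ?b = "real (Suc i) / 2 ^ r"
        have ab: "?a \<in> {0..1}" "?b \<in> {0..1}" using i(1) dyadic_in_unit[of i r] dyadic_in_unit[of "Suc i" r] by auto
        have ba: "?b - ?a = (1/2) ^ r" by (simp add: add_divide_distrib power_divide)
        have "y n ?a \<le> y n t" "y n t \<le> y n ?b" using i t ab by (auto intro!: mono_onD[OF mono])
        moreover have "dist (y n ?a) (f ?a) < e/2" "dist (y n ?b) (f ?b) < e/2"
          using elim[rule_format, of i] elim[rule_format, of "Suc i"] i(1) by auto
        moreover have "dist (f t) (f ?a) < e/2" "dist (f t) (f ?b) < e/2"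
          using i(2) ba r t ab by (intro d(2); simp add: dist_real_def)+
        ultimately show ?thesis unfolding dist_real_def by linarith
      qed
    qed
  qed
qed

lemma dist_cadlag_le:
  assumes "0 \<le> e" "\<And>t. t \<in> {0..1} \<Longrightarrow> \<bar>path_of \<phi> t - path_of \<psi> t\<bar> \<le> e"
  shows "dist \<phi> \<psi> \<le> e"
proof -
  have "skorohod_within (path_of \<phi>) (path_of \<psi>) e"
    unfolding skorohod_within_def using assms time_change_id by (intro exI[of _ "\<lambda>t. t"]) auto
  then show ?thesis
    unfolding dist_cadlag_def skorohod_dist_def using skorohod_bdd by (intro cInf_lower) auto
qed

lemma continuous_cadlag:
  assumes f: "continuous_on {0..1} f" "\<And>t. t \<in> {0..1} \<Longrightarrow> f t \<in> {0..1}"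
  obtains \<phi> where "\<And>t. t \<in> {0..1} \<Longrightarrow> path_of \<phi> t = f t"
proof -
  let ?f = "restrict f {0..1}"
  have "?f \<in> cadlag_functions"
    unfolding cadlag_functions_def
  proof (intro CollectI conjI ballI)
    show "?f \<in> {0..1} \<rightarrow>\<^sub>E {0..1}" using f(2) by auto
    have c: "continuous_on {0..1} ?f" using f(1) continuous_on_cong[OF refl, of "{0..1}" ?f f] by auto
    fix t :: real
    { assume t: "t \<in> {0..<1}"
      have "(?f \<longlongrightarrow> ?f t) (at t within {0..1})" by (rule c[unfolded continuous_on_def, rule_format]) (use t in auto)
      then have "(?f \<longlongrightarrow> ?f t) (at t within {t..1})" by (rule tendsto_within_subset) (use t in auto)
      moreover have "at t within {t..1} = at_right t" using t at_within_Icc_at_right[of t 1] by auto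
      ultimately show "(?f \<longlongrightarrow> ?f t) (at_right t)" by simp }
    { assume t: "t \<in> {0<..1}"
      have "(?f \<longlongrightarrow> ?f t) (at t within {0..1})" by (rule c[unfolded continuous_on_def, rule_format]) (use t in auto)
      then have "(?f \<longlongrightarrow> ?f t) (at t within {0..t})" by (rule tendsto_within_subset) (use t in auto)
      moreover have "at t within {0..t} = at_left t" using t at_within_Icc_at_left[of 0 t] by auto
      ultimately show "\<exists>l. (?f \<longlongrightarrow> l) (at_left t)" by auto }
  qed
  then have "path_of (Abs_cadlag ?f) = ?f" by (rule Abs_cadlag_inverse)
  then show thesis using that[of "Abs_cadlag ?f"] by simp
qed

text \<open>The dyadic inequality makes the limit continuous, which upgrades convergence at
  rationals to uniform and hence Skorohod convergence. The approximating paths need only be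
  monotone, so this serves paths of bounded rate as well as the step paths of the process.\<close>

lemma monotone_cadlag_limit:
  assumes c: "c > 0" and a: "\<alpha> \<ge> 0" and mono: "\<And>n. mono_on {0..1} (path_of (\<Phi> n))"
    and lim: "\<And>t. t \<in> \<rat> \<inter> {0..1} \<Longrightarrow> (\<lambda>n. path_of (\<Phi> n) t) \<longlonglongrightarrow> f t"
    and f: "mono_on {0..1} f" "\<And>t. t \<in> {0..1} \<Longrightarrow> f t \<in> {0..1}" "f 0 = 0" and b: "dyadic_bound c f \<alpha>"
  obtains \<phi> where "\<Phi> \<longlonglongrightarrow> \<phi>" "rate_I c \<phi> \<le> ennreal \<alpha>"
proof -
  have cont: "continuous_on {0..1} f" using dyadic_bound_continuous[OF b c a _ f(1)] f(2) by auto
  obtain \<phi> where \<phi>: "\<And>t. t \<in> {0..1} \<Longrightarrow> path_of \<phi> t = f t" using continuous_cadlag[OF cont f(2)] by blast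
  have "rate_I c \<phi> \<le> ennreal \<alpha>"
    using dyadic_bound_imp_rate_I[OF b c a _ f(3,1) \<phi>] f(2) by auto
  moreover have "\<Phi> \<longlonglongrightarrow> \<phi>"
    unfolding tendsto_iff
  proof (intro allI impI)
    fix e :: real assume "e > 0" then have e: "e/2 > 0" by simp
    have "\<forall>\<^sub>F n in sequentially. \<forall>t\<in>{0..1}. \<bar>path_of (\<Phi> n) t - f t\<bar> < e/2"
    proof (rule monotone_uniform_limit[OF mono f(1) cont _ e])
      fix r i :: nat assume "i \<le> 2^r"
      then have "real i / 2^r \<in> \<rat> \<inter> {0..1}" using dyadic_in_unit by auto
      then show "(\<lambda>n. path_of (\<Phi> n) (real i / 2^r)) \<longlonglongrightarrow> f (real i / 2^r)" by (rule lim)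
    qed
    then show "\<forall>\<^sub>F n in sequentially. dist (\<Phi> n) \<phi> < e"
    proof eventually_elim
      case (elim n)
      have "dist (\<Phi> n) \<phi> \<le> e/2" using elim \<phi> e by (intro dist_cadlag_le) (auto intro: less_imp_le)
      then show ?case using e by linarith
    qed
  qed
  ultimately show thesis using that by blast
qed

text \<open>For fixed \<open>r\<close> and \<open>\<theta>\<close> the sums converge. Tilts
  admissible for the limit are eventually admissible for \<open>y n\<close>, because lying below 1
  at a cell end is an open condition.\<close>

lemma dyadic_bound_limit:
  assumes lim: "\<And>t. t \<in> \<rat> \<inter> {0..1} \<Longrightarrow> (\<lambda>n. y n t) \<longlonglongrightarrow> f t"
    and b: "\<And>n. dyadic_bound c (y n) \<alpha>"
  shows "dyadic_bound c f \<alpha>"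
  unfolding dyadic_bound_def
proof (intro allI impI)
  fix r :: nat and \<theta> :: "nat \<Rightarrow> real"
  assume th: "\<forall>i<2^r. f (real (Suc i) / 2^r) < 1 \<or> 0 \<le> \<theta> i"
  have lim': "(\<lambda>n. y n (real i / 2^r)) \<longlonglongrightarrow> f (real i / 2^r)" if "i \<le> 2^r" for i
    using that dyadic_in_unit by (intro lim) auto
  let ?S = "\<lambda>f. \<Sum>i<2^r. \<theta> i * (f (real (Suc i) / 2^r) - f (real i / 2^r) - 1 / 2^r)
         - c / 2^r * (1 - f (real i / 2^r)) * (exp (\<theta> i) - 1)"
  have "(\<lambda>n. ?S (y n)) \<longlonglongrightarrow> ?S f"
    by (intro tendsto_sum tendsto_intros lim') auto
  moreover have "\<forall>\<^sub>F n in sequentially. \<forall>i\<in>{..<2^r}. y n (real (Suc i) / 2^r) < 1 \<or> 0 \<le> \<theta> i"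
  proof (intro eventually_ball_finite ballI)
    fix i :: nat assume i: "i \<in> {..<2^r}"
    show "\<forall>\<^sub>F n in sequentially. y n (real (Suc i) / 2^r) < 1 \<or> 0 \<le> \<theta> i"
    proof (cases "0 \<le> \<theta> i")
      case False
      then have "f (real (Suc i) / 2^r) < 1" using th i by auto
      moreover have "(\<lambda>n. y n (real (Suc i) / 2^r)) \<longlonglongrightarrow> f (real (Suc i) / 2^r)" using i by (intro lim') auto
      ultimately have "\<forall>\<^sub>F n in sequentially. y n (real (Suc i) / 2^r) < 1" by (rule order_tendstoD(2)[rotated])
      then show ?thesis by eventually_elim simp
    qed simp
  qed simp
  then have "\<forall>\<^sub>F n in sequentially. ?S (y n) \<le> \<alpha> + c / 2^r"
  proof eventually_elim
    case (elim n)
    then show ?case by (intro b[unfolded dyadic_bound_def, rule_format]) auto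
  qed
  ultimately show "?S f \<le> \<alpha> + c / 2^r" by (intro tendsto_upperbound) auto
qed

lemma rate_I_sublevel_compact:
  assumes c: "c > 0" and a: "\<alpha> \<ge> 0"
  shows "compact {\<phi>. rate_I c \<phi> \<le> ennreal \<alpha>}"
  unfolding compact_eq_seq_compact_metric
proof (rule seq_compactI)
  fix \<Phi> :: "nat \<Rightarrow> cadlag" assume "\<forall>n. \<Phi> n \<in> {\<phi>. rate_I c \<phi> \<le> ennreal \<alpha>}"
  then have \<Phi>: "rate_I c (\<Phi> n) \<le> ennreal \<alpha>" for n by simp
  note props = rate_I_imp_dyadic_bound[OF c a \<Phi>]
  have rng: "path_of (\<Phi> n) t \<in> {0..1}" if "t \<in> {0..1}" for n t using path_of_props[OF that] by auto
  obtain s f where s: "strict_mono s" and f: "mono_on {0..1} f" "\<And>t. t \<in> {0..1} \<Longrightarrow> f t \<in> {0..1}"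
    and lim: "\<And>t. t \<in> \<rat> \<inter> {0..1} \<Longrightarrow> (\<lambda>n. path_of (\<Phi> (s n)) t) \<longlonglongrightarrow> f t"
    using monotone_selection[of "\<lambda>n. path_of (\<Phi> n)", OF props(1) rng] by metis
  have f0: "f 0 = 0" using lim[of 0] props(2) by (simp add: LIMSEQ_const_iff)
  have "dyadic_bound c f \<alpha>" using lim props(3) by (rule dyadic_bound_limit)
  then obtain \<phi> where "(\<lambda>n. \<Phi> (s n)) \<longlonglongrightarrow> \<phi>" "rate_I c \<phi> \<le> ennreal \<alpha>"
    using monotone_cadlag_limit[of c \<alpha> "\<lambda>n. \<Phi> (s n)" f, OF c a props(1) lim f f0] by blast
  then show "\<exists>l\<in>{\<phi>. rate_I c \<phi> \<le> ennreal \<alpha>}. \<exists>s. strict_mono s \<and> (\<Phi> \<circ> s) \<longlonglongrightarrow> l"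
    using s by (auto simp: o_def)
qed

lemma good_rate_function_rate_I: "c > 0 \<Longrightarrow> good_rate_function (rate_I c)"
  unfolding good_rate_function_def rate_function_def
  using rate_I_sublevel_compact by (auto intro: compact_imp_closed)

section \<open>The upper bound\<close>

lemma run_cons_successive:
  assumes "xs \<in> set_pmf (run_cons K k x)" "\<And>x y. y \<in> set_pmf (K x) \<Longrightarrow> R x y" "i < k"
  shows "R (xs ! i) (xs ! Suc i)"
  using assms(1,3)
proof (induction k arbitrary: x xs i)
  case (Suc k)
  then obtain y ys where y: "y \<in> set_pmf (K x)" "ys \<in> set_pmf (run_cons K k y)" "xs = x # ys" by auto
  show ?case
  proof (cases i)
    case 0
    then show ?thesis using y assms(2) run_cons_nth_0[OF y(2)] by simp
  next
    case (Suc j)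
    then show ?thesis using Suc.IH[OF y(2), of j] Suc.prems y(3) by simp
  qed
qed simp

lemma greedy_support:
  assumes c: "c / real N \<in> {0..1}" and ss: "ss \<in> set_pmf (greedy_exploration N c)"
  shows "Z ss 0 = 0" "\<And>i j. i \<le> j \<Longrightarrow> j \<le> N \<Longrightarrow> Z ss i \<le> Z ss j" "\<And>i. i \<le> N \<Longrightarrow> Z ss i \<le> N"
proof -
  define zs where "zs = map (card \<circ> explored) ss"
  have "zs \<in> set_pmf (map_pmf (map (card \<circ> explored)) (greedy_exploration N c))" using ss by (simp add: zs_def)
  then have zs: "zs \<in> set_pmf (run_cons (explore_step N (c / real N)) N 0)"
    unfolding greedy_exploration_Markov[OF c] .
  have len: "length ss = Suc N" using run_cons_length[OF zs] by (simp add: zs_def)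
  have Zz: "Z ss i = zs ! i" if "i \<le> N" for i using that len by (simp add: zs_def Z_def)
  show "Z ss 0 = 0" using Zz[of 0] run_cons_nth_0[OF zs] by simp
  have step: "zs ! i \<le> zs ! Suc i" if "i < N" for i
  proof (rule run_cons_successive[OF zs _ that])
    fix x y assume "y \<in> set_pmf (explore_step N (c / real N) x)"
    then show "x \<le> y" by (auto simp: explore_step_def split: if_splits)
  qed
  show "Z ss i \<le> Z ss j" if "i \<le> j" "j \<le> N" for i j
  proof -
    have "zs ! i \<le> zs ! j" using that
    proof (induction j rule: dec_induct)
      case (step n) then show ?case using \<open>\<And>i. i < N \<Longrightarrow> zs ! i \<le> zs ! Suc i\<close>[of n] by simp
    qed simp
    then show ?thesis using that Zz by simp
  qed
  show "Z ss i \<le> N" if "i \<le> N" for i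
  proof -
    obtain E where E: "E \<in> set_pmf (random_graph N (c / real N))" "ss \<in> set_pmf (greedy_run N E N)"
      using ss by (auto simp: greedy_exploration_def)
    have *: "length ss = Suc N \<and> (\<forall>s\<in>set ss. explored s \<subseteq> {..<N})"
      using random_graph_edges[OF E(1)] by (intro greedy_run_explored[OF _ E(2)]) blast
    then have "explored (ss ! i) \<subseteq> {..<N}" using that by auto
    then show ?thesis using card_mono[of "{..<N}" "explored (ss ! i)"] by (simp add: Z_def)
  qed
qed

lemma floor_time_le: "t \<le> 1 \<Longrightarrow> nat \<lfloor>real N * t\<rfloor> \<le> N"
proof -
  assume "t \<le> 1"
  then have "real N * t \<le> real N * 1" by (intro mult_left_mono) auto
  then show ?thesis by linarith
qed

lemma floor_time_mono: "s \<le> t \<Longrightarrow> nat \<lfloor>real N * s\<rfloor> \<le> nat \<lfloor>real N * t\<rfloor>"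
  by (intro nat_mono floor_mono mult_left_mono) auto

lemma path_of_Y_props:
  assumes c: "c / real N \<in> {0..1}" and ss: "ss \<in> set_pmf (greedy_exploration N c)"
  shows "\<And>t. t \<in> {0..1} \<Longrightarrow> path_of (Y N ss) t = real (Z ss (nat \<lfloor>real N * t\<rfloor>)) / real N"
    "mono_on {0..1} (path_of (Y N ss))" "path_of (Y N ss) 0 = 0"
proof -
  show 1: "path_of (Y N ss) t = real (Z ss (nat \<lfloor>real N * t\<rfloor>)) / real N" if "t \<in> {0..1}" for t
    using that by (simp add: path_of_Y[OF ss] Y_fun_def)
  show "mono_on {0..1} (path_of (Y N ss))"
  proof (rule mono_onI)
    fix s t :: real assume st: "s \<in> {0..1}" "t \<in> {0..1}" "s \<le> t"
    have "Z ss (nat \<lfloor>real N * s\<rfloor>) \<le> Z ss (nat \<lfloor>real N * t\<rfloor>)"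
      using st by (intro greedy_support(2)[OF c ss] floor_time_mono floor_time_le) auto
    then show "path_of (Y N ss) s \<le> path_of (Y N ss) t" using st by (simp add: 1 divide_right_mono)
  qed
  show "path_of (Y N ss) 0 = 0" using 1[of 0] greedy_support(1)[OF c ss] by simp
qed

lemma grid_probability_upper:
  assumes c: "c / real N \<in> {0..1}" and ss: "ss \<in> set_pmf (greedy_exploration N c)"
    and k: "k 0 = 0" "\<And>i. i < m \<Longrightarrow> k i \<le> k (Suc i)" "k m \<le> N"
    and th: "\<And>i. i < m \<Longrightarrow> Z ss (k (Suc i)) < N \<or> 0 \<le> \<theta> i"
  shows "measure (measure_pmf (greedy_exploration N c)) {ss'. \<forall>i\<le>m. Z ss' (k i) = Z ss (k i)}
     \<le> exp (\<Sum>i<m. - \<theta> i * (real (Z ss (k (Suc i))) - real (Z ss (k i)) - real (k (Suc i) - k i))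
         + real (k (Suc i) - k i) * (c / real N) * ((real N - real (Z ss (k i))) * exp (\<theta> i) - (real N - real (Z ss (k (Suc i))))))"
proof -
  have le: "k i \<le> N" if "i \<le> m" for i
  proof -
    have "k i \<le> k m" using that
    proof (induction rule: inc_induct)
      case (step n) then show ?case using k(2)[of n] by simp
    qed simp
    then show ?thesis using k(3) by simp
  qed
  have ZN: "Z ss (k i) \<le> N" if "i \<le> m" for i using greedy_support(3)[OF c ss le[OF that]] .
  have "measure (measure_pmf (greedy_exploration N c)) {ss'. \<forall>i\<le>m. Z ss' (k i) = Z ss (k i)}
    = (\<Prod>i<m. pmf (kernel_power (explore_step N (c / real N)) (k (Suc i) - k i) (Z ss (k i))) (Z ss (k (Suc i))))"
    by (rule Z_grid_probability[OF c k, where z = "\<lambda>i. Z ss (k i)"]) (simp_all add: k(1) greedy_support(1)[OF c ss])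
  also have "\<dots> \<le> (\<Prod>i<m. exp (- \<theta> i * (real (Z ss (k (Suc i))) - real (Z ss (k i)) - real (k (Suc i) - k i))
         + real (k (Suc i) - k i) * (c / real N) * ((real N - real (Z ss (k i))) * exp (\<theta> i) - (real N - real (Z ss (k (Suc i)))))))"
  proof (intro prod_mono conjI)
    fix i assume "i \<in> {..<m}"
    then have i: "i < m" "i \<le> m" "Suc i \<le> m" by auto
    show "pmf (kernel_power (explore_step N (c / real N)) (k (Suc i) - k i) (Z ss (k i))) (Z ss (k (Suc i)))
      \<le> exp (- \<theta> i * (real (Z ss (k (Suc i))) - real (Z ss (k i)) - real (k (Suc i) - k i))
         + real (k (Suc i) - k i) * (c / real N) * ((real N - real (Z ss (k i))) * exp (\<theta> i) - (real N - real (Z ss (k (Suc i))))))"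
      by (rule kernel_power_upper[OF c ZN[OF i(2)] ZN[OF i(3)] th[OF i(1)]])
  qed simp
  also have "\<dots> = exp (\<Sum>i<m. - \<theta> i * (real (Z ss (k (Suc i))) - real (Z ss (k i)) - real (k (Suc i) - k i))
         + real (k (Suc i) - k i) * (c / real N) * ((real N - real (Z ss (k i))) * exp (\<theta> i) - (real N - real (Z ss (k (Suc i))))))"
    by (simp add: exp_sum)
  finally show ?thesis .
qed

text \<open>The values at the \<open>m + 1\<close> grid times form at most
  \<open>(N + 1) ^ (m + 1)\<close> vectors. If each vector attained by a path in \<open>F\<close>
  had probability at most \<open>\<delta>\<close>, their sum would contradict the assumption. The
  vector found comes from an actual path in \<open>F\<close>, so that closedness of \<open>F\<close>
  can be used in the limit.\<close>

lemma pigeonhole_path: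
  assumes c: "c / real N \<in> {0..1}" and k: "\<And>i. i \<le> m \<Longrightarrow> k i \<le> N"
    and P: "measure (measure_pmf (greedy_exploration N c)) {ss. Y N ss \<in> F} > (real N + 1) ^ Suc m * \<delta>" and d: "\<delta> \<ge> 0"
  obtains ss where "ss \<in> set_pmf (greedy_exploration N c)" "Y N ss \<in> F"
    "measure (measure_pmf (greedy_exploration N c)) {ss'. \<forall>i\<le>m. Z ss' (k i) = Z ss (k i)} > \<delta>"
proof (rule ccontr)
  assume neg: "\<not> thesis"
  let ?M = "measure_pmf (greedy_exploration N c)"
  define S where "S = {ss \<in> set_pmf (greedy_exploration N c). Y N ss \<in> F}"
  have small: "measure ?M {ss'. \<forall>i\<le>m. Z ss' (k i) = Z ss (k i)} \<le> \<delta>" if "ss \<in> S" for ss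
    using neg that \<open>\<And>ss. ss \<in> set_pmf (greedy_exploration N c) \<Longrightarrow> Y N ss \<in> F \<Longrightarrow> \<delta> < measure ?M {ss'. \<forall>i\<le>m. Z ss' (k i) = Z ss (k i)} \<Longrightarrow> thesis\<close>
    unfolding S_def by force
  define v where "v ss = restrict (\<lambda>i. Z ss (k i)) {..m}" for ss
  have vS: "v ` S \<subseteq> {..m} \<rightarrow>\<^sub>E {..N}"
    using greedy_support(3)[OF c] k unfolding v_def S_def image_subset_iff restrict_PiE_iff by auto
  have fin: "finite (v ` S)" using vS by (rule finite_subset) (intro finite_PiE, auto)
  have card: "real (card (v ` S)) \<le> (real N + 1) ^ Suc m"
  proof -
    have "card (v ` S) \<le> card ({..m} \<rightarrow>\<^sub>E {..N})" by (intro card_mono vS finite_PiE) auto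
    also have "\<dots> = (N + 1) ^ Suc m" by (simp add: card_PiE)
    finally have "real (card (v ` S)) \<le> real ((N + 1) ^ Suc m)" by (simp only: of_nat_le_iff)
    then show ?thesis by (simp only: of_nat_power of_nat_add of_nat_1)
  qed
  have "measure ?M {ss. Y N ss \<in> F} = measure ?M S"
    unfolding S_def by (intro measure_pmf.finite_measure_eq_AE) (auto simp: AE_measure_pmf_iff)
  also have "\<dots> \<le> measure ?M (\<Union>z\<in>v ` S. {ss'. \<forall>i\<le>m. Z ss' (k i) = z i})"
    by (intro measure_pmf.finite_measure_mono) (auto simp: v_def)
  also have "\<dots> \<le> (\<Sum>z\<in>v ` S. measure ?M {ss'. \<forall>i\<le>m. Z ss' (k i) = z i})"
    using fin by (intro measure_pmf.finite_measure_subadditive_finite) auto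
  also have "\<dots> \<le> (\<Sum>z\<in>v ` S. \<delta>)"
  proof (intro sum_mono)
    fix z assume "z \<in> v ` S"
    then obtain ss where ss: "ss \<in> S" "z = v ss" by blast
    have "{ss'. \<forall>i\<le>m. Z ss' (k i) = z i} = {ss'. \<forall>i\<le>m. Z ss' (k i) = Z ss (k i)}" using ss by (auto simp: v_def)
    then show "measure ?M {ss'. \<forall>i\<le>m. Z ss' (k i) = z i} \<le> \<delta>" using small[OF ss(1)] by simp
  qed
  also have "\<dots> = real (card (v ` S)) * \<delta>" by simp
  also have "\<dots> \<le> (real N + 1) ^ Suc m * \<delta>" using card d by (intro mult_right_mono)
  finally show False using P by simp
qed

text \<open>The grid times of generation \<open>r\<close> occur exactly among those of any later
  generation \<open>j\<close>, so fixing the path on the finer grid fixes it on the coarser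
  one.\<close>

lemma floor_grid_refine:
  assumes "r \<le> j"
  shows "nat \<lfloor>real N * (real i / 2 ^ r)\<rfloor> = nat \<lfloor>real N * (real (i * 2 ^ (j - r)) / 2 ^ j)\<rfloor>"
proof -
  have "(2::real) ^ j = 2 ^ r * 2 ^ (j - r)" using assms by (simp add: power_add[symmetric])
  then have "real i / 2 ^ r = real (i * 2 ^ (j - r)) / 2 ^ j" by simp
  then show ?thesis by simp
qed

lemma floor_ratio_tendsto:
  fixes t :: real assumes "0 \<le> t" and N: "filterlim N at_top sequentially"
  shows "(\<lambda>j. real (nat \<lfloor>real (N j) * t\<rfloor>) / real (N j)) \<longlonglongrightarrow> t"
proof (rule real_tendsto_sandwich)
  have pos: "\<forall>\<^sub>F j in sequentially. N j > 0" 
  proof -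
    have "\<forall>\<^sub>F j in sequentially. 1 \<le> N j" using N by (simp add: filterlim_at_top)
    then show ?thesis by eventually_elim simp
  qed
  show "\<forall>\<^sub>F j in sequentially. t - 1 / real (N j) \<le> real (nat \<lfloor>real (N j) * t\<rfloor>) / real (N j)"
    using pos
  proof eventually_elim
    case (elim j)
    have "real (N j) * t - 1 \<le> real (nat \<lfloor>real (N j) * t\<rfloor>)" by linarith
    then have "(real (N j) * t - 1) / real (N j) \<le> real (nat \<lfloor>real (N j) * t\<rfloor>) / real (N j)" by (intro divide_right_mono) auto
    then show ?case using elim by (simp add: diff_divide_distrib)
  qed
  show "\<forall>\<^sub>F j in sequentially. real (nat \<lfloor>real (N j) * t\<rfloor>) / real (N j) \<le> t"
    using pos
  proof eventually_elim
    case (elim j)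
    have "0 \<le> real (N j) * t" using assms(1) by simp
    then have "real (nat \<lfloor>real (N j) * t\<rfloor>) \<le> real (N j) * t" by linarith
    then show ?case using elim by (simp add: divide_le_eq mult.commute)
  qed
  have "(\<lambda>j. 1 / real (N j)) \<longlonglongrightarrow> 0"
    using filterlim_compose[OF lim_1_over_n N] by simp
  then show "(\<lambda>j. t - 1 / real (N j)) \<longlonglongrightarrow> t" using tendsto_diff[OF tendsto_const, of _ 0 _ t] by fastforce
qed simp

text \<open>The upper bound in contraposed form, for a decay slower than
  \<open>exp (- \<alpha> * N)\<close> along a subsequence. The grid is refined along that
  subsequence, so the limit path satisfies the inequality for every \<open>r\<close>.\<close>

lemma LDP_upper_core:
  assumes c: "c > 0" and F: "closed F" and a: "\<alpha> \<ge> 0"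
    and freq: "\<exists>\<^sub>F N in sequentially. measure (measure_pmf (greedy_exploration N c)) {ss. Y N ss \<in> F} > exp (- \<alpha> * real N)"
  shows "\<exists>\<phi>\<in>F. rate_I c \<phi> \<le> ennreal \<alpha>"
proof -
  let ?M = "\<lambda>N. measure_pmf (greedy_exploration N c)"
  \<comment> \<open>The values at the \<open>2^j + 1\<close> grid times take at most \<open>(N + 1)^(2^j + 1)\<close> values. With \<open>N\<close> large in
    terms of \<open>j\<close> this is subexponential, so some path in \<open>F\<close> carries almost the whole probability.\<close>
  define Q where "Q j N ss \<longleftrightarrow> N \<ge> j \<and> N > 0 \<and> c / real N \<in> {0..1} \<and> ss \<in> set_pmf (greedy_exploration N c) \<and> Y N ss \<in> F \<and>
     measure (?M N) {ss'. \<forall>i\<le>2^j. Z ss' (nat \<lfloor>real N * (real i / 2 ^ j)\<rfloor>) = Z ss (nat \<lfloor>real N * (real i / 2 ^ j)\<rfloor>)}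
        > exp (- (\<alpha> + 1 / (real j + 1)) * real N)" for j N ss
  have "\<exists>N ss. Q j N ss" for j
  proof -
    have "\<forall>\<^sub>F N in sequentially. N \<ge> Suc j" by (rule eventually_ge_at_top)
    moreover have "\<forall>\<^sub>F N in sequentially. c \<le> real N" by real_asymp
    moreover have "\<forall>\<^sub>F N in sequentially. real (Suc (2^j)) * ln (real N + 1) / real N < 1 / (real j + 1)"
    proof (rule order_tendstoD(2))
      have "(\<lambda>N. ln (real N + 1) / real N) \<longlonglongrightarrow> 0" by real_asymp
      then have "(\<lambda>N. real (Suc (2^j)) * (ln (real N + 1) / real N)) \<longlonglongrightarrow> real (Suc (2^j)) * 0" by (intro tendsto_intros)
      then show "(\<lambda>N. real (Suc (2^j)) * ln (real N + 1) / real N) \<longlonglongrightarrow> 0" by simp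
    qed simp
    ultimately have "\<forall>\<^sub>F N in sequentially. N \<ge> Suc j \<and> c \<le> real N \<and> real (Suc (2^j)) * ln (real N + 1) / real N < 1 / (real j + 1)"
      by eventually_elim auto
    then have "\<exists>\<^sub>F N in sequentially. measure (?M N) {ss. Y N ss \<in> F} > exp (- \<alpha> * real N) \<and>
        (N \<ge> Suc j \<and> c \<le> real N \<and> real (Suc (2^j)) * ln (real N + 1) / real N < 1 / (real j + 1))"
      by (intro frequently_rev_mp[OF freq]) (elim eventually_mono, blast)
    then obtain N where N: "measure (?M N) {ss. Y N ss \<in> F} > exp (- \<alpha> * real N)"
      "N \<ge> Suc j" "c \<le> real N" "real (Suc (2^j)) * ln (real N + 1) / real N < 1 / (real j + 1)"
      by (auto dest: frequently_ex)
    have N0: "real N > 0" using N(2) by simp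
    have cN: "c / real N \<in> {0..1}" using c N(3) N0 by simp
    let ?\<delta> = "exp (- (\<alpha> + 1 / (real j + 1)) * real N)"
    have "(real N + 1) ^ Suc (2^j) * ?\<delta> = exp (real (Suc (2^j)) * ln (real N + 1)) * ?\<delta>"
      using N0 by (subst exp_of_nat_mult) auto
    also have "\<dots> \<le> exp (1 / (real j + 1) * real N) * ?\<delta>"
      using N(4) N0 by (intro mult_right_mono) (auto simp: divide_less_eq mult.commute)
    also have "\<dots> = exp (- \<alpha> * real N)" by (simp add: exp_add[symmetric] algebra_simps)
    finally have "(real N + 1) ^ Suc (2^j) * ?\<delta> < measure (?M N) {ss. Y N ss \<in> F}" using N(1) by linarith
    then obtain ss where "ss \<in> set_pmf (greedy_exploration N c)" "Y N ss \<in> F"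
      "?\<delta> < measure (?M N) {ss'. \<forall>i\<le>2^j. Z ss' (nat \<lfloor>real N * (real i / 2 ^ j)\<rfloor>) = Z ss (nat \<lfloor>real N * (real i / 2 ^ j)\<rfloor>)}"
    proof (rule pigeonhole_path[OF cN, rotated])
      show "0 \<le> ?\<delta>" by simp
      fix i :: nat assume "i \<le> 2^j"
      then show "nat \<lfloor>real N * (real i / 2 ^ j)\<rfloor> \<le> N" using dyadic_in_unit[of i j] by (intro floor_time_le) auto
    qed
    then have "Q j N ss" using N(2) cN unfolding Q_def by simp
    then show ?thesis by blast
  qed
  then obtain N ss where Q: "\<And>j. Q j (N j) (ss j)" by metis
  have N: "N j \<ge> j" "N j > 0" "c / real (N j) \<in> {0..1}"
    and ss: "ss j \<in> set_pmf (greedy_exploration (N j) c)" and YF: "Y (N j) (ss j) \<in> F"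
    and pr: "measure (?M (N j)) {ss'. \<forall>i\<le>2^j. Z ss' (nat \<lfloor>real (N j) * (real i / 2 ^ j)\<rfloor>) = Z (ss j) (nat \<lfloor>real (N j) * (real i / 2 ^ j)\<rfloor>)}
        > exp (- (\<alpha> + 1 / (real j + 1)) * real (N j))" for j
    using Q[of j] unfolding Q_def by blast+
  define \<Phi> where "\<Phi> j = Y (N j) (ss j)" for j
  note props = path_of_Y_props[OF N(3) ss, folded \<Phi>_def]
  have rng: "path_of (\<Phi> n) t \<in> {0..1}" if "t \<in> {0..1}" for n t using path_of_props[OF that] by auto
  obtain s f where s: "strict_mono s" and f: "mono_on {0..1} f" "\<And>t. t \<in> {0..1} \<Longrightarrow> f t \<in> {0..1}"
    and lim: "\<And>t. t \<in> \<rat> \<inter> {0..1} \<Longrightarrow> (\<lambda>n. path_of (\<Phi> (s n)) t) \<longlonglongrightarrow> f t"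
    using monotone_selection[of "\<lambda>n. path_of (\<Phi> n)", OF props(2) rng] by metis
  have f0: "f 0 = 0" using lim[of 0] props(3) by (simp add: LIMSEQ_const_iff)
  have sN: "filterlim (\<lambda>n. N (s n)) at_top sequentially"
  proof -
    have "filterlim s at_top sequentially" using s by (rule filterlim_subseq)
    then show ?thesis by (rule filterlim_at_top_mono) (use N(1) in auto)
  qed
  have db: "dyadic_bound c f \<alpha>"
    unfolding dyadic_bound_def
  proof (intro allI impI)
    fix r :: nat and \<theta> :: "nat \<Rightarrow> real"
    assume th: "\<forall>i<2^r. f (real (Suc i) / 2^r) < 1 \<or> 0 \<le> \<theta> i"
    define k where "k n i = nat \<lfloor>real (N n) * (real i / 2 ^ r)\<rfloor>" for n i
    define y where "y n i = path_of (\<Phi> n) (real i / 2 ^ r)" for n i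
    have yZ: "y n i = real (Z (ss n) (k n i)) / real (N n)" if "i \<le> 2^r" for n i
      unfolding y_def k_def using that dyadic_in_unit by (intro props(1)) auto
    have ylim: "(\<lambda>n. y (s n) i) \<longlonglongrightarrow> f (real i / 2^r)" if "i \<le> 2^r" for i
      unfolding y_def using that dyadic_in_unit by (intro lim) auto
    have k0: "k n 0 = 0" for n by (simp add: k_def)
    have kmono: "k n i \<le> k n (Suc i)" for n i unfolding k_def by (intro floor_time_mono divide_right_mono) auto
    have kN: "k n (2^r) \<le> N n" for n by (simp add: k_def)
    define w where "w n i = real (k n (Suc i) - k n i) / real (N n)" for n i
    have wlim: "(\<lambda>n. w (s n) i) \<longlonglongrightarrow> 1 / 2^r" for i
    proof -
      have "(\<lambda>n. real (k (s n) (Suc i)) / real (N (s n)) - real (k (s n) i) / real (N (s n))) \<longlonglongrightarrow> real (Suc i) / 2^r - real i / 2^r"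
        unfolding k_def by (intro tendsto_diff floor_ratio_tendsto sN) auto
      moreover have "w n i = real (k n (Suc i)) / real (N n) - real (k n i) / real (N n)" for n
        using kmono[of n i] by (simp add: w_def of_nat_diff diff_divide_distrib)
      ultimately show ?thesis by (simp add: add_divide_distrib)
    qed
    \<comment> \<open>The exponent in \<open>grid_probability_upper\<close> equals
      \<open>- N * S n\<close>. It is rearranged by writing the mass
      \<open>(N - z) * exp \<theta> - (N - w)\<close> as
      \<open>(N - z) * (exp \<theta> - 1) + (w - z)\<close>, which isolates the increments.\<close>
    define S where "S n = (\<Sum>i<2^r. \<theta> i * (y n (Suc i) - y n i - w n i) - w n i * c * ((1 - y n i) * (exp (\<theta> i) - 1) + (y n (Suc i) - y n i)))" for n
    have Sbound: "S n \<le> \<alpha> + 1 / (real n + 1)"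
      if n: "r \<le> n" and th': "\<And>i. i < 2^r \<Longrightarrow> y n (Suc i) < 1 \<or> 0 \<le> \<theta> i" for n
    proof -
      let ?z = "\<lambda>i. Z (ss n) (k n i)"
      have N0: "real (N n) > 0" using N(2) by simp
      have "exp (- (\<alpha> + 1 / (real n + 1)) * real (N n))
        < measure (?M (N n)) {ss'. \<forall>i\<le>2^n. Z ss' (nat \<lfloor>real (N n) * (real i / 2 ^ n)\<rfloor>) = Z (ss n) (nat \<lfloor>real (N n) * (real i / 2 ^ n)\<rfloor>)}"
        by (rule pr)
      also have "\<dots> \<le> measure (?M (N n)) {ss'. \<forall>i\<le>2^r. Z ss' (k n i) = ?z i}"
      proof (intro measure_pmf.finite_measure_mono subsetI CollectI allI impI)
        fix ss' i assume h: "ss' \<in> {ss'. \<forall>i\<le>2^n. Z ss' (nat \<lfloor>real (N n) * (real i / 2 ^ n)\<rfloor>) = Z (ss n) (nat \<lfloor>real (N n) * (real i / 2 ^ n)\<rfloor>)}"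
          and i: "i \<le> (2::nat)^r"
        have "i * 2 ^ (n - r) \<le> 2^r * 2 ^ (n - r)" using i by (intro mult_right_mono) auto
        also have "\<dots> = 2^n" using n by (simp add: power_add[symmetric])
        finally show "Z ss' (k n i) = ?z i" using h unfolding k_def floor_grid_refine[OF n] by blast
      qed simp
      also have "\<dots> \<le> exp (\<Sum>i<2^r. - \<theta> i * (real (?z (Suc i)) - real (?z i) - real (k n (Suc i) - k n i))
         + real (k n (Suc i) - k n i) * (c / real (N n)) * ((real (N n) - real (?z i)) * exp (\<theta> i) - (real (N n) - real (?z (Suc i)))))"
      proof (rule grid_probability_upper[OF N(3) ss k0 kmono kN])
        fix i :: nat assume i: "i < 2^r"
        then show "?z (Suc i) < N n \<or> 0 \<le> \<theta> i" using th'[OF i] yZ[of "Suc i" n] N0 by auto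
      qed
      also have "(\<Sum>i<2^r. - \<theta> i * (real (?z (Suc i)) - real (?z i) - real (k n (Suc i) - k n i))
         + real (k n (Suc i) - k n i) * (c / real (N n)) * ((real (N n) - real (?z i)) * exp (\<theta> i) - (real (N n) - real (?z (Suc i)))))
         = - real (N n) * S n"
        unfolding S_def sum_distrib_left
      proof (intro sum.cong refl)
        fix i assume "i \<in> {..<(2::nat)^r}"
        then have i: "i \<le> 2^r" "Suc i \<le> 2^r" by auto
        have e: "real (?z i) = real (N n) * y n i" "real (?z (Suc i)) = real (N n) * y n (Suc i)"
          "real (k n (Suc i) - k n i) = real (N n) * w n i"
          using yZ[OF i(1), of n] yZ[OF i(2), of n] N0 by (simp_all add: w_def)
        show "- \<theta> i * (real (?z (Suc i)) - real (?z i) - real (k n (Suc i) - k n i))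
         + real (k n (Suc i) - k n i) * (c / real (N n)) * ((real (N n) - real (?z i)) * exp (\<theta> i) - (real (N n) - real (?z (Suc i))))
         = - real (N n) * (\<theta> i * (y n (Suc i) - y n i - w n i) - w n i * c * ((1 - y n i) * (exp (\<theta> i) - 1) + (y n (Suc i) - y n i)))"
          unfolding e using N0 by (simp add: field_simps)
      qed
      finally have "- (\<alpha> + 1 / (real n + 1)) * real (N n) < - real (N n) * S n" by simp
      then have "real (N n) * S n < real (N n) * (\<alpha> + 1 / (real n + 1))" by (simp add: algebra_simps)
      then show ?thesis using N0 by simp
    qed
    have ev: "\<forall>\<^sub>F n in sequentially. S (s n) \<le> \<alpha> + 1 / (real (s n) + 1)"
    proof -
      have "\<forall>\<^sub>F n in sequentially. \<forall>i\<in>{..<2^r}. y (s n) (Suc i) < 1 \<or> 0 \<le> \<theta> i"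
      proof (intro eventually_ball_finite ballI)
        fix i :: nat assume i: "i \<in> {..<2^r}"
        show "\<forall>\<^sub>F n in sequentially. y (s n) (Suc i) < 1 \<or> 0 \<le> \<theta> i"
        proof (cases "0 \<le> \<theta> i")
          case False
          then have "f (real (Suc i) / 2^r) < 1" using th i by auto
          moreover have "(\<lambda>n. y (s n) (Suc i)) \<longlonglongrightarrow> f (real (Suc i) / 2^r)" using i by (intro ylim) auto
          ultimately have "\<forall>\<^sub>F n in sequentially. y (s n) (Suc i) < 1" by (rule order_tendstoD(2)[rotated])
          then show ?thesis by eventually_elim simp
        qed simp
      qed simp
      moreover have "\<forall>\<^sub>F n in sequentially. r \<le> s n"
        using filterlim_subseq[OF s] by (simp add: filterlim_at_top)
      ultimately show ?thesis
      proof eventually_elim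
        case (elim n)
        then show ?case by (intro Sbound) auto
      qed
    qed
    have Slim: "(\<lambda>n. S (s n)) \<longlonglongrightarrow> (\<Sum>i<2^r. \<theta> i * (f (real (Suc i) / 2^r) - f (real i / 2^r) - 1 / 2^r)
        - 1 / 2^r * c * ((1 - f (real i / 2^r)) * (exp (\<theta> i) - 1) + (f (real (Suc i) / 2^r) - f (real i / 2^r))))" (is "_ \<longlonglongrightarrow> ?T")
      unfolding S_def by (intro tendsto_sum tendsto_intros ylim wlim) auto
    have "(\<lambda>n. \<alpha> + 1 / (real (s n) + 1)) \<longlonglongrightarrow> \<alpha> + 0"
    proof (intro tendsto_add tendsto_const)
      have "(\<lambda>n. 1 / (real n + 1)) \<longlonglongrightarrow> 0" by real_asymp
      then show "(\<lambda>n. 1 / (real (s n) + 1)) \<longlonglongrightarrow> 0" by (rule filterlim_compose[OF _ filterlim_subseq[OF s]])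
    qed
    then have T: "?T \<le> \<alpha> + 0" using ev by (intro tendsto_le[OF _ _ Slim]) auto
    \<comment> \<open>The isolated increments telescope to \<open>f 1 - f 0\<close>, at most 1. This
      is the probabilistic source of the error \<open>c / 2^r\<close> in
      \<open>dyadic_bound\<close>.\<close>
    have E1: "(\<Sum>i<2^r. \<theta> i * (f (real (Suc i) / 2^r) - f (real i / 2^r) - 1 / 2^r)
         - c / 2^r * (1 - f (real i / 2^r)) * (exp (\<theta> i) - 1)) = ?T + c / 2^r * (\<Sum>i<2^r. f (real (Suc i) / 2^r) - f (real i / 2^r))"
      unfolding sum_distrib_left sum.distrib[symmetric] by (intro sum.cong refl) (simp add: field_simps)
    have E2: "(\<Sum>i<2^r. f (real (Suc i) / 2^r) - f (real i / 2^r)) = f 1 - f 0"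
      using sum_lessThan_telescope[of "\<lambda>i. f (real i / 2^r)" "2^r"] by simp
    have E3: "c / 2^r * (f 1 - f 0) \<le> c / 2^r * 1"
      using f(2)[of 1] f0 c by (intro mult_left_mono) auto
    show "(\<Sum>i<2^r. \<theta> i * (f (real (Suc i) / 2^r) - f (real i / 2^r) - 1 / 2^r)
         - c / 2^r * (1 - f (real i / 2^r)) * (exp (\<theta> i) - 1)) \<le> \<alpha> + c / 2^r"
      using add_mono[OF T E3] unfolding E1 E2 by (simp only: add_0_right mult_1_right)
  qed
  obtain \<phi> where \<phi>: "(\<lambda>n. \<Phi> (s n)) \<longlonglongrightarrow> \<phi>" "rate_I c \<phi> \<le> ennreal \<alpha>"
    by (rule monotone_cadlag_limit[of c \<alpha> "\<lambda>n. \<Phi> (s n)" f, OF c a props(2) lim f f0 db])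
  have "\<phi> \<in> F" by (rule closed_sequentially[OF F _ \<phi>(1)]) (simp add: \<Phi>_def YF)
  then show ?thesis using \<phi>(2) by blast
qed

section \<open>The lower bound\<close>

lemma tendsto_x_ln_x:
  fixes u :: "nat \<Rightarrow> real"
  assumes u: "u \<longlonglongrightarrow> d" and d: "d \<ge> 0" and pos: "\<forall>\<^sub>F n in sequentially. u n > 0"
  shows "(\<lambda>n. u n * ln (u n)) \<longlonglongrightarrow> d * ln d"
proof (cases "d = 0")
  case True
  have "filterlim u (at_right 0) sequentially"
    using u pos True by (intro tendsto_imp_filterlim_at_right) auto
  moreover have "((\<lambda>x::real. x * ln x) \<longlongrightarrow> 0) (at_right 0)" by real_asymp
  ultimately have "(\<lambda>n. u n * ln (u n)) \<longlonglongrightarrow> 0" by (rule filterlim_compose[rotated])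
  then show ?thesis using True by simp
next
  case False
  then show ?thesis using u d by (intro tendsto_intros) auto
qed

text \<open>Vandermonde's lower bound for the transition from \<open>z\<close> to \<open>w = z + n + e\<close> in \<open>n\<close> steps,
  with the factorial replaced by \<open>ln_fact_le\<close>.\<close>

definition block_exponent :: "real \<Rightarrow> nat \<Rightarrow> nat \<Rightarrow> nat \<Rightarrow> nat \<Rightarrow> nat \<Rightarrow> real" where
  "block_exponent c N n z w e =
     real e * ln (real n * (real N - real w) - real e) - ((real e + 1) * ln (real e + 1) - real e)
       + real e * ln (c / real N) + real n * (real N - real z) * ln (1 - c / real N)"

lemma kernel_power_ge_exp:
  assumes c: "0 < c" "c < real N" and w: "w < N" and zn: "z + n \<le> w"
    and e: "e = w - z - n" "e < n * (N - w) \<or> e = 0"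
  shows "exp (block_exponent c N n z w e) \<le> pmf (kernel_power (explore_step N (c / real N)) n z) w"
proof -
  define p where "p = c / real N"
  have p: "0 < p" "p < 1" using c by (auto simp: p_def)
  let ?K = "n * (N - w)"
  have K: "real ?K = real n * (real N - real w)" using w by (simp add: of_nat_diff)
  have eK: "e \<le> ?K" using e(2) by auto
  have "block_exponent c N n z w e = (real e * ln (real ?K - real e) - ((real e + 1) * ln (real e + 1) - real e))
      + real e * ln p + real (n * (N - z)) * ln (1 - p)"
    using w zn by (simp add: block_exponent_def K p_def of_nat_diff)
  also have "\<dots> \<le> ln (real (?K choose e)) + real e * ln p + real (n * (N - z)) * ln (1 - p)"
    using ln_binomial_ge[OF eK e(2)] by simp
  finally have "exp (block_exponent c N n z w e) \<le> exp (ln (real (?K choose e)) + real e * ln p + real (n * (N - z)) * ln (1 - p))" by simp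
  also have "\<dots> = real (?K choose e) * p ^ e * (1 - p) ^ (n * (N - z))"
    using p eK by (simp add: exp_add exp_of_nat_mult del: of_nat_mult)
  also have "\<dots> \<le> pmf (kernel_power (explore_step N p) n z) w"
    unfolding e(1) using p by (intro kernel_power_lower w zn) auto
  finally show ?thesis by (simp add: p_def)
qed

text \<open>With \<open>N^2 * q\<close> for the argument of the first logarithm and
  \<open>N * u\<close> for \<open>e + 1\<close>, the coefficients of \<open>ln N\<close> are
  \<open>2 * e\<close> from the binomial, \<open>- (e + 1)\<close> from the factorial and
  \<open>- e\<close> from \<open>c / N\<close>. Only \<open>- ln N\<close> survives, and it vanishes
  after division by \<open>N\<close>.\<close>

lemma block_exponent_tendsto:
  assumes c: "c > 0" and h: "h > 0" and d: "d \<ge> 0" and w1: "b < 1"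
    and n: "(\<lambda>N. real (n N) / real N) \<longlonglongrightarrow> h" and z: "(\<lambda>N. real (z N) / real N) \<longlonglongrightarrow> a"
    and w: "(\<lambda>N. real (w N) / real N) \<longlonglongrightarrow> b" and e: "(\<lambda>N. real (e N) / real N) \<longlonglongrightarrow> d"
  shows "(\<lambda>N. block_exponent c N (n N) (z N) (w N) (e N) / real N) \<longlonglongrightarrow>
      d * ln (h * c * (1 - b)) - d * ln d + d - h * c * (1 - a)"
    "\<forall>\<^sub>F N in sequentially. real (e N) < real (n N) * (real N - real (w N))"
proof -
  let ?q = "\<lambda>N. (real (n N) / real N) * (1 - real (w N) / real N) - (real (e N) / real N) * (1 / real N)"
  have inv: "(\<lambda>N. 1 / real N) \<longlonglongrightarrow> 0" by (rule lim_1_over_n)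
  have q: "?q \<longlonglongrightarrow> h * (1 - b) - d * 0" by (intro tendsto_intros n w e inv)
  have hb: "h * (1 - b) > 0" using h w1 by simp
  have qpos: "\<forall>\<^sub>F N in sequentially. ?q N > 0" using q hb by (intro order_tendstoD(1)[OF q]) auto
  have Npos: "\<forall>\<^sub>F N in sequentially. N > 0" by (rule eventually_gt_at_top)
  have qeq: "real N ^ 2 * ?q N = real (n N) * (real N - real (w N)) - real (e N)" if "N > 0" for N
    using that by (simp add: field_simps power2_eq_square)
  show "\<forall>\<^sub>F N in sequentially. real (e N) < real (n N) * (real N - real (w N))"
    using qpos Npos
  proof eventually_elim
    case (elim N)
    then have "0 < real N ^ 2 * ?q N" by (intro mult_pos_pos) auto
    then show ?case unfolding qeq[OF elim(2)] by simp
  qed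
  \<comment> \<open>The extra \<open>1 / N\<close> keeps the argument of \<open>x * ln x\<close>
    positive even if \<open>e N = 0\<close>, so that the limit holds also for
    \<open>d = 0\<close>.\<close>
  let ?u = "\<lambda>N. real (e N) / real N + 1 / real N"
  have u: "?u \<longlonglongrightarrow> d + 0" by (intro tendsto_add e inv)
  have upos: "\<forall>\<^sub>F N in sequentially. ?u N > 0" using Npos by eventually_elim (auto intro: add_nonneg_pos)
  have uln: "(\<lambda>N. ?u N * ln (?u N)) \<longlonglongrightarrow> d * ln d" using tendsto_x_ln_x[OF _ d upos] u by simp
  have l1: "(\<lambda>N. ln (real N) / real N) \<longlonglongrightarrow> 0" by real_asymp
  have l2: "(\<lambda>N. real N * ln (1 - c / real N)) \<longlonglongrightarrow> - c" by real_asymp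
  have "(\<lambda>N. (real (e N) / real N) * ln (?q N * c) - ?u N * ln (?u N) - ln (real N) / real N + real (e N) / real N
      + (real (n N) / real N) * (1 - real (z N) / real N) * (real N * ln (1 - c / real N)))
    \<longlonglongrightarrow> d * ln ((h * (1 - b) - d * 0) * c) - d * ln d - 0 + d + h * (1 - a) * (- c)"
    using hb c by (intro tendsto_intros e q uln l1 n z l2) auto
  moreover have "\<forall>\<^sub>F N in sequentially. block_exponent c N (n N) (z N) (w N) (e N) / real N =
     (real (e N) / real N) * ln (?q N * c) - ?u N * ln (?u N) - ln (real N) / real N + real (e N) / real N
      + (real (n N) / real N) * (1 - real (z N) / real N) * (real N * ln (1 - c / real N))"
    using qpos Npos
  proof eventually_elim
    case (elim N)
    have N: "real N > 0" using elim by simp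
    have Q: "real (n N) * (real N - real (w N)) - real (e N) = real N ^ 2 * ?q N" using qeq elim by simp
    have A: "ln (real N ^ 2 * ?q N) = 2 * ln (real N) + ln (?q N)"
      using N elim by (subst ln_mult_pos) (auto simp: ln_realpow)
    have B: "ln (real (e N) + 1) = ln (real N) + ln (?u N)"
    proof -
      have "real (e N) + 1 = real N * ?u N" using N by (simp add: field_simps)
      then show ?thesis using N by (simp add: ln_mult_pos add_nonneg_pos)
    qed
    have C: "ln (c / real N) = ln c - ln (real N)" using N c by (simp add: ln_div)
    have D: "ln (?q N * c) = ln (?q N) + ln c" using elim c by (subst ln_mult_pos) auto
    have "block_exponent c N (n N) (z N) (w N) (e N)
       = real (e N) * (ln (?q N) + ln c) - (real (e N) + 1) * ln (?u N) - ln (real N) + real (e N) + real (n N) * (real N - real (z N)) * ln (1 - c / real N)"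
      unfolding block_exponent_def Q A B C by (simp add: algebra_simps)
    then have "block_exponent c N (n N) (z N) (w N) (e N) / real N
       = (real (e N) * (ln (?q N) + ln c) - (real (e N) + 1) * ln (?u N) - ln (real N) + real (e N) + real (n N) * (real N - real (z N)) * ln (1 - c / real N)) / real N"
      by simp
    also have "\<dots> = (real (e N) / real N) * ln (?q N * c) - ?u N * ln (?u N) - ln (real N) / real N + real (e N) / real N
      + (real (n N) / real N) * (1 - real (z N) / real N) * (real N * ln (1 - c / real N))"
      unfolding D using N by (simp add: add_divide_distrib diff_divide_distrib left_diff_distrib right_diff_distrib distrib_right)
    finally show ?case .
  qed
  ultimately have "(\<lambda>N. block_exponent c N (n N) (z N) (w N) (e N) / real N) \<longlonglongrightarrow> d * ln ((h * (1 - b) - d * 0) * c) - d * ln d - 0 + d + h * (1 - a) * (- c)"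
    by (simp only: tendsto_cong)
  then show "(\<lambda>N. block_exponent c N (n N) (z N) (w N) (e N) / real N) \<longlonglongrightarrow>
      d * ln (h * c * (1 - b)) - d * ln d + d - h * c * (1 - a)" by (simp add: mult_ac)
qed

text \<open>On a cell ending below level 1 the tilt may tend to minus infinity; an increment shorter
  than the cell would then make the left side of the inequality unbounded.\<close>

lemma dyadic_bound_slope:
  assumes b: "dyadic_bound c f \<alpha>" and c: "c > 0" and fi: "f (real i / 2^r) \<le> 1"
    and i: "i < 2^r" and f1: "f (real (Suc i) / 2^r) < 1"
  shows "1 / 2^r \<le> f (real (Suc i) / 2^r) - f (real i / 2^r)"
proof (rule ccontr)
  define d where "d = f (real (Suc i) / 2^r) - f (real i / 2^r) - 1 / 2^r"
  assume "\<not> ?thesis"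
  then have d: "d < 0" by (simp add: d_def)
  have bound: "T * (- d) \<le> \<alpha> + c / 2^r" if T: "T > 0" for T
  proof -
    define \<theta> where "\<theta> j = (if j = i then - T else 0)" for j
    have "(\<Sum>j<2^r. \<theta> j * (f (real (Suc j) / 2^r) - f (real j / 2^r) - 1 / 2^r) - c / 2^r * (1 - f (real j / 2^r)) * (exp (\<theta> j) - 1)) \<le> \<alpha> + c / 2^r"
      using f1 by (intro b[unfolded dyadic_bound_def, rule_format]) (auto simp: \<theta>_def)
    moreover have "(\<Sum>j<2^r. \<theta> j * (f (real (Suc j) / 2^r) - f (real j / 2^r) - 1 / 2^r) - c / 2^r * (1 - f (real j / 2^r)) * (exp (\<theta> j) - 1))
       = (\<Sum>j<2^r. if j = i then - T * d - c / 2^r * (1 - f (real i / 2^r)) * (exp (- T) - 1) else 0)"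
      by (intro sum.cong refl) (simp add: \<theta>_def d_def)
    moreover have "\<dots> = - T * d - c / 2^r * (1 - f (real i / 2^r)) * (exp (- T) - 1)" using i by simp
    moreover have "c / 2^r * (1 - f (real i / 2^r)) * (exp (- T) - 1) \<le> 0"
      using c fi T by (intro mult_nonneg_nonpos) auto
    ultimately show ?thesis by simp
  qed
  define T where "T = (\<bar>\<alpha> + c / 2^r\<bar> + 1) / (- d)"
  have "T > 0" using d unfolding T_def by (intro divide_pos_pos) auto
  moreover have "T * (- d) = \<bar>\<alpha> + c / 2^r\<bar> + 1" using d by (simp add: T_def)
  ultimately show False using bound[of T] by linarith
qed

text \<open>Inserting the optimal tilts \<open>ln (d i / v i)\<close> turns the dual form back into
  the primal one. Where \<open>d i = 0\<close> the optimum is at minus infinity and is approached by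
  the tilts \<open>- T\<close>. Cells from \<open>J\<close> on get tilt 0.\<close>

lemma dyadic_bound_entropy:
  assumes b: "dyadic_bound c f \<alpha>" and c: "c > 0" and J: "J \<le> 2^r"
    and f1: "\<And>i. i \<le> J \<Longrightarrow> f (real i / 2^r) < 1"
  defines "d \<equiv> \<lambda>i. f (real (Suc i) / 2^r) - f (real i / 2^r) - 1 / 2^r"
    and "v \<equiv> \<lambda>i. c / 2^r * (1 - f (real i / 2^r))"
  shows "(\<Sum>i<J. d i * (ln (d i / v i) - 1) + v i) \<le> \<alpha> + c / 2^r"
proof -
  have v: "v i > 0" if "i < J" for i using f1[of i] that c by (simp add: v_def)
  have d: "d i \<ge> 0" if "i < J" for i
    using dyadic_bound_slope[OF b c, of i r] f1[of i] f1[of "Suc i"] that J by (simp add: d_def)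
  have bound: "(\<Sum>i<J. d i * (ln (d i / v i) - 1) + v i - (if d i = 0 then v i * exp (- real T) else 0)) \<le> \<alpha> + c / 2^r" for T :: nat
  proof -
    define \<theta> where "\<theta> i = (if i < J then if d i = 0 then - real T else ln (d i / v i) else 0)" for i
    have "(\<Sum>i<2^r. \<theta> i * d i - v i * (exp (\<theta> i) - 1)) \<le> \<alpha> + c / 2^r"
      unfolding d_def v_def
    proof (intro b[unfolded dyadic_bound_def, rule_format])
      fix i :: nat assume "i < 2^r"
      show "f (real (Suc i) / 2^r) < 1 \<or> 0 \<le> \<theta> i" using f1[of "Suc i"] by (auto simp: \<theta>_def)
    qed
    moreover have "(\<Sum>i<2^r. \<theta> i * d i - v i * (exp (\<theta> i) - 1)) = (\<Sum>i<J. \<theta> i * d i - v i * (exp (\<theta> i) - 1))"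
      using J by (intro sum.mono_neutral_right) (auto simp: \<theta>_def)
    moreover have "(\<Sum>i<J. \<theta> i * d i - v i * (exp (\<theta> i) - 1)) = (\<Sum>i<J. d i * (ln (d i / v i) - 1) + v i - (if d i = 0 then v i * exp (- real T) else 0))"
    proof (intro sum.cong refl)
      fix i assume "i \<in> {..<J}"
      then have i: "i < J" by simp
      show "\<theta> i * d i - v i * (exp (\<theta> i) - 1) = d i * (ln (d i / v i) - 1) + v i - (if d i = 0 then v i * exp (- real T) else 0)"
      proof (cases "d i = 0")
        case True
        then show ?thesis using i by (simp add: \<theta>_def algebra_simps)
      next
        case False
        then have "d i > 0" using d[OF i] by simp
        then show ?thesis using i v[OF i] False by (simp add: \<theta>_def algebra_simps)
      qed
    qed
    ultimately show ?thesis by simp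
  qed
  have "(\<lambda>T::nat. exp (- real T)) \<longlonglongrightarrow> 0" by real_asymp
  then have "(\<lambda>T::nat. \<Sum>i<J. d i * (ln (d i / v i) - 1) + v i - (if d i = 0 then v i * exp (- real T) else 0))
     \<longlonglongrightarrow> (\<Sum>i<J. d i * (ln (d i / v i) - 1) + v i - (if d i = 0 then v i * 0 else 0))"
    by (intro tendsto_sum tendsto_diff tendsto_const) (auto intro!: tendsto_mult_right_zero)
  then have "(\<Sum>i<J. d i * (ln (d i / v i) - 1) + v i - (if d i = 0 then v i * 0 else 0)) \<le> \<alpha> + c / 2^r"
    by (rule LIMSEQ_le_const2) (use bound in auto)
  moreover have "(\<Sum>i<J. d i * (ln (d i / v i) - 1) + v i - (if d i = 0 then v i * 0 else 0)) = (\<Sum>i<J. d i * (ln (d i / v i) - 1) + v i)"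
    by (intro sum.cong) auto
  ultimately show ?thesis by simp
qed

text \<open>The transition bound counts the vertices available at the end \<open>b\<close> of a
  block, the rate those at its beginning \<open>a\<close>. The discrepancy
  \<open>d * ln ((1 - a) / (1 - b))\<close> is at most \<open>d * (\<omega> / \<eta>)\<close>, as
  \<open>1 - b \<ge> \<eta>\<close>: the path has to be left before level 1.\<close>

lemma entropy_shift:
  fixes a b d K \<eta> \<omega> :: real
  assumes d: "d \<ge> 0" and K: "K > 0" and a: "a \<le> b" "b \<le> 1 - \<eta>" "\<eta> > 0" "b - a \<le> \<omega>"
  shows "d * ln (K * (1 - b)) - d * ln d + d - K * (1 - a)
     \<ge> - (d * (ln (d / (K * (1 - a))) - 1) + K * (1 - a)) - d * (\<omega> / \<eta>)"
proof (cases "d = 0")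
  case False
  then have d0: "d > 0" using d by simp
  have pos: "1 - a > 0" "1 - b > 0" using a by auto
  have "ln ((1 - a) / (1 - b)) \<le> (1 - a) / (1 - b) - 1" using pos by (intro ln_le_minus_one) auto
  also have "\<dots> = (b - a) / (1 - b)" using pos by (simp add: field_simps)
  also have "\<dots> \<le> \<omega> / \<eta>" using a pos by (intro frac_le) auto
  finally have "d * (ln (1 - a) - ln (1 - b)) \<le> d * (\<omega> / \<eta>)"
    using pos d by (intro mult_left_mono) (auto simp: ln_div)
  moreover have "ln (K * (1 - b)) = ln K + ln (1 - b)" "ln (d / (K * (1 - a))) = ln d - (ln K + ln (1 - a))"
    using d0 K pos by (simp_all add: ln_div ln_mult_pos del: right_diff_distrib)
  ultimately show ?thesis by (simp only:) (simp add: algebra_simps)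
qed simp

text \<open>Up to grid point \<open>J\<close> both monotone paths are enclosed between neighbouring
  grid values that agree up to \<open>2 / N\<close>. After it both stay between about
  \<open>1 - \<eta> - \<omega>\<close> and 1, though nothing is prescribed there.\<close>

lemma path_of_Y_near:
  assumes c: "c / real N \<in> {0..1}" and ss: "ss \<in> set_pmf (greedy_exploration N c)" and N: "N > 0"
    and f: "mono_on {0..1} f" "\<And>t. t \<in> {0..1} \<Longrightarrow> f t \<le> 1" and J: "J \<le> 2^r"
    and osc: "\<And>i. i < 2^r \<Longrightarrow> f (real (Suc i) / 2^r) - f (real i / 2^r) \<le> \<omega>"
    and last: "J = 2^r \<or> f (real (Suc J) / 2^r) > 1 - \<eta>" and pos: "\<omega> \<ge> 0" "\<eta> \<ge> 0"
    and z: "\<And>i. i \<le> J \<Longrightarrow> \<bar>real (Z ss (nat \<lfloor>real N * (real i / 2^r)\<rfloor>)) - real N * f (real i / 2^r)\<bar> \<le> 2"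
    and t: "t \<in> {0..1}"
  shows "\<bar>path_of (Y N ss) t - f t\<bar> \<le> \<eta> + \<omega> + 2 / real N"
proof -
  let ?y = "path_of (Y N ss)"
  let ?x = "\<lambda>i. real i / 2^r :: real"
  note props = path_of_Y_props[OF c ss]
  have N0: "real N > 0" using N by simp
  have near: "\<bar>?y (?x i) - f (?x i)\<bar> \<le> 2 / real N" if "i \<le> J" for i
  proof -
    have "i \<le> 2^r" using that J by simp
    then have "?y (?x i) = real (Z ss (nat \<lfloor>real N * ?x i\<rfloor>)) / real N" using dyadic_in_unit by (intro props(1)) auto
    then have "real (Z ss (nat \<lfloor>real N * ?x i\<rfloor>)) = real N * ?y (?x i)" using N0 by simp
    then have "real N * \<bar>?y (?x i) - f (?x i)\<bar> = \<bar>real (Z ss (nat \<lfloor>real N * ?x i\<rfloor>)) - real N * f (?x i)\<bar>"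
      using N0 by (metis abs_mult abs_of_pos right_diff_distrib)
    then have "real N * \<bar>?y (?x i) - f (?x i)\<bar> \<le> 2" using z[OF that] by simp
    then show ?thesis using N0 by (simp add: field_simps)
  qed
  have in01: "?x i \<in> {0..1}" if "i \<le> 2^r" for i using dyadic_in_unit[OF that] .
  have y1: "?y t \<le> 1" using path_of_props(2)[OF t] .
  show ?thesis
  proof (cases "t \<le> ?x J")
    case True
    show ?thesis
    proof (cases "t = 0")
      case True
      then show ?thesis using near[of 0] pos by simp
    next
      case False
      then obtain i where i: "i < 2^r" "t \<in> {?x i<..?x (Suc i)}" using ceiling_cell[of t r] t by auto
      have "?x i < ?x J" using i True by auto
      then have iJ: "Suc i \<le> J" by (simp add: divide_less_cancel)
      have ab: "?x i \<in> {0..1}" "?x (Suc i) \<in> {0..1}" using i(1) in01[of i] in01[of "Suc i"] by auto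
      have "?y (?x i) \<le> ?y t" "?y t \<le> ?y (?x (Suc i))" "f (?x i) \<le> f t" "f t \<le> f (?x (Suc i))"
        using i(2) t ab by (auto intro!: mono_onD[OF props(2)] mono_onD[OF f(1)])
      moreover have "\<bar>?y (?x i) - f (?x i)\<bar> \<le> 2 / real N" "\<bar>?y (?x (Suc i)) - f (?x (Suc i))\<bar> \<le> 2 / real N"
        by (rule near, use iJ in simp)+
      ultimately show ?thesis using osc[OF i(1)] pos by linarith
    qed
  next
    case False
    have "t \<le> 1" using t by simp
    then have "?x J < 1" using False by linarith
    then have JJ: "J < 2^r" using J by (cases "J = 2^r") auto
    then have "f (?x (Suc J)) > 1 - \<eta>" using last by auto
    then have fJ: "f (?x J) \<ge> 1 - \<eta> - \<omega>" using osc[OF JJ] by linarith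
    have "?y (?x J) \<le> ?y t" "f (?x J) \<le> f t"
      using False t in01[OF J] by (auto intro!: mono_onD[OF props(2)] mono_onD[OF f(1)])
    moreover have "\<bar>?y (?x J) - f (?x J)\<bar> \<le> 2 / real N" using near by simp
    moreover have "f t \<le> 1" using f(2)[OF t] .
    ultimately show ?thesis using fJ y1 by (auto simp: abs_le_iff)
  qed
qed

lemma LDP_lower_core:
  assumes c: "c > 0" and G: "open G" "\<phi> \<in> G" and a: "\<alpha> \<ge> 0" and I: "rate_I c \<phi> \<le> ennreal \<alpha>" and e: "\<epsilon> > 0"
  shows "\<forall>\<^sub>F N in sequentially. exp (- (\<alpha> + \<epsilon>) * real N) \<le> measure (measure_pmf (greedy_exploration N c)) {ss. Y N ss \<in> G}"
proof -
  define f where "f = path_of \<phi>"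
  note props = rate_I_imp_dyadic_bound[OF c a I, folded f_def]
  have frng: "0 \<le> f t" "f t \<le> 1" if "t \<in> {0..1}" for t using path_of_props[OF that] by (auto simp: f_def)
  obtain \<delta> where \<delta>: "\<delta> > 0" "ball \<phi> \<delta> \<subseteq> G" using G openE by blast
  \<comment> \<open>The distance budget: \<open>\<eta>\<close>, \<open>\<omega>\<close> and
    \<open>2 / N\<close> are at most \<open>\<delta> / 4\<close> each. The exponent budget:
    \<open>\<omega> / \<eta>\<close> from shifting the entropy, \<open>c * h\<close> from the dyadic
    inequality, and the limit in \<open>N\<close>, each at most
    \<open>\<epsilon> / 3\<close>.\<close>
  define \<eta> where "\<eta> = min (\<delta>/4) (1/2)"
  have \<eta>: "\<eta> > 0" "\<eta> \<le> \<delta>/4" "\<eta> < 1" using \<delta> by (auto simp: \<eta>_def)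
  define \<omega> where "\<omega> = min (\<delta>/4) (\<eta> * \<epsilon> / 3)"
  have \<omega>: "\<omega> > 0" "\<omega> \<le> \<delta>/4" "\<omega> / \<eta> \<le> \<epsilon> / 3" using \<delta> \<eta> e by (auto simp: \<omega>_def divide_le_eq mult.commute)
  have "uniformly_continuous_on {0..1} f"
    using absolutely_continuous_fun_continuous[OF props(4)] compact_uniformly_continuous by blast
  then obtain d0 where d0: "d0 > 0" "\<And>s t. s \<in> {0..1} \<Longrightarrow> t \<in> {0..1} \<Longrightarrow> dist t s < d0 \<Longrightarrow> dist (f t) (f s) < \<omega>"
    unfolding uniformly_continuous_on_def using \<omega>(1) by metis
  have "min d0 (\<epsilon> / (3 * c)) > 0" using d0 e c by simp
  then obtain r where r: "(1/2::real) ^ r < min d0 (\<epsilon> / (3 * c))" using real_arch_pow_inv[of "min d0 (\<epsilon> / (3 * c))" "1/2::real"] by auto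
  define h where "h = 1 / (2::real) ^ r"
  have h: "h > 0" "h < d0" "c * h \<le> \<epsilon> / 3" using r c by (auto simp: h_def power_divide field_simps)
  define x where "x i = f (real i / 2 ^ r)" for i
  have x01: "0 \<le> x i" "x i \<le> 1" if "i \<le> 2^r" for i using frng[OF dyadic_in_unit[OF that]] by (auto simp: x_def)
  have x0: "x 0 = 0" using props(2) by (simp add: x_def f_def)
  have xmono: "x i \<le> x j" if "i \<le> j" "j \<le> 2^r" for i j
    unfolding x_def using that dyadic_in_unit[of i r] dyadic_in_unit[of j r]
    by (intro mono_onD[OF props(1)]) (auto intro: divide_right_mono)
  have osc: "x (Suc i) - x i \<le> \<omega>" if "i < 2^r" for i
  proof -
    have "dist (f (real (Suc i) / 2^r)) (f (real i / 2^r)) < \<omega>"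
      using that dyadic_in_unit[of i r] dyadic_in_unit[of "Suc i" r] h
      by (intro d0(2)) (auto simp: dist_real_def h_def add_divide_distrib)
    then show ?thesis by (simp add: x_def dist_real_def)
  qed
  define J where "J = Max {i. i \<le> 2^r \<and> x i \<le> 1 - \<eta>}"
  have fin: "finite {i. i \<le> 2^r \<and> x i \<le> 1 - \<eta>}" by auto
  have "0 \<in> {i. i \<le> 2^r \<and> x i \<le> 1 - \<eta>}" using x0 \<eta> by auto
  then have "J \<in> {i. i \<le> 2^r \<and> x i \<le> 1 - \<eta>}" unfolding J_def using fin by (intro Max_in) auto
  then have J: "J \<le> 2^r" "x J \<le> 1 - \<eta>" by auto
  have last: "J = 2^r \<or> x (Suc J) > 1 - \<eta>"
  proof (rule ccontr)
    assume "\<not> ?thesis"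
    then have "Suc J \<in> {i. i \<le> 2^r \<and> x i \<le> 1 - \<eta>}" using J by auto
    then have "Suc J \<le> J" unfolding J_def using fin by (intro Max_ge) auto
    then show False by simp
  qed
  have xJ: "x i \<le> 1 - \<eta>" if "i \<le> J" for i using xmono[OF that J(1)] J(2) by linarith
  \<comment> \<open>The excess over the line of slope 1, that is, the share of vertices that get
    blocked. Rounding \<open>N * A i\<close> separately from the time \<open>k N i\<close> makes
    \<open>z\<close> increase by at least the number of steps in each block and leaves a nonnegative
    number \<open>ee\<close> of vertices to be blocked.\<close>
  define A where "A i = x i - real i * h" for i
  define d where "d i = x (Suc i) - x i - h" for i
  have dA: "A (Suc i) = A i + d i" for i by (simp add: A_def d_def algebra_simps)
  have dpos: "d i \<ge> 0" if "i < J" for i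
  proof -
    have "1 / 2^r \<le> f (real (Suc i) / 2^r) - f (real i / 2^r)"
      using that J xJ[of i] xJ[of "Suc i"] \<eta> by (intro dyadic_bound_slope[OF props(3) c]) (auto simp: x_def)
    then show ?thesis by (simp add: d_def x_def h_def)
  qed
  have A0: "A 0 = 0" by (simp add: A_def x0)
  have Apos: "A i \<ge> 0" if "i \<le> J" for i
    using that by (induction i) (auto simp: A0 dA intro!: add_nonneg_nonneg dpos)
  define k where "k N i = nat \<lfloor>real N * (real i / 2^r)\<rfloor>" for N i
  define z where "z N i = k N i + nat \<lfloor>real N * A i\<rfloor>" for N i
  define n where "n N i = k N (Suc i) - k N i" for N i
  define ee where "ee N i = z N (Suc i) - z N i - n N i" for N i
  have kmono: "k N i \<le> k N (Suc i)" for N i unfolding k_def by (intro floor_time_mono divide_right_mono) auto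
  have Bmono: "nat \<lfloor>real N * A i\<rfloor> \<le> nat \<lfloor>real N * A (Suc i)\<rfloor>" if "i < J" for N i
    using dpos[OF that] by (intro nat_mono floor_mono mult_left_mono) (auto simp: dA)
  have zn: "z N i + n N i \<le> z N (Suc i)" if "i < J" for N i
    using kmono[of N i] Bmono[OF that, of N] by (simp add: z_def n_def)
  have ee: "ee N i = nat \<lfloor>real N * A (Suc i)\<rfloor> - nat \<lfloor>real N * A i\<rfloor>" if "i < J" for N i
    using kmono[of N i] Bmono[OF that, of N] by (simp add: ee_def z_def n_def)
  have kN: "k N i \<le> N" if "i \<le> 2^r" for N i unfolding k_def using dyadic_in_unit[OF that] by (intro floor_time_le) auto
  \<comment> \<open>Two floors are taken, each off by at most 1. Both round down, which later keeps
    the prescribed values strictly below \<open>N\<close>.\<close>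
  have zclose: "\<bar>real (z N i) - real N * x i\<bar> \<le> 2" "real (z N i) \<le> real N * x i" if "i \<le> J" for N i
  proof -
    have e: "real N * x i = real N * (real i / 2^r) + real N * A i" by (simp add: A_def h_def algebra_simps)
    have p: "0 \<le> real N * (real i / 2^r)" "0 \<le> real N * A i" using Apos[OF that] by simp_all
    then show "\<bar>real (z N i) - real N * x i\<bar> \<le> 2" "real (z N i) \<le> real N * x i"
      unfolding e z_def k_def of_nat_add by linarith+
  qed
  have zlim: "(\<lambda>N. real (z N i) / real N) \<longlonglongrightarrow> x i" if "i \<le> J" for i
  proof -
    have "(\<lambda>N. real (nat \<lfloor>real N * (real i / 2^r)\<rfloor>) / real N + real (nat \<lfloor>real N * A i\<rfloor>) / real N) \<longlonglongrightarrow> real i / 2^r + A i"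
      using Apos[OF that] by (intro tendsto_add floor_ratio_tendsto filterlim_ident) auto
    then show ?thesis by (simp add: z_def k_def add_divide_distrib A_def h_def)
  qed
  have nlim: "(\<lambda>N. real (n N i) / real N) \<longlonglongrightarrow> h" for i
  proof -
    have "(\<lambda>N. real (k N (Suc i)) / real N - real (k N i) / real N) \<longlonglongrightarrow> real (Suc i) / 2^r - real i / 2^r"
      unfolding k_def by (intro tendsto_diff floor_ratio_tendsto filterlim_ident) auto
    moreover have "real (n N i) / real N = real (k N (Suc i)) / real N - real (k N i) / real N" for N
      using kmono[of N i] by (simp add: n_def of_nat_diff diff_divide_distrib)
    ultimately show ?thesis by (simp add: add_divide_distrib h_def)
  qed
  have elim: "(\<lambda>N. real (ee N i) / real N) \<longlonglongrightarrow> d i" if "i < J" for i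
  proof -
    have "(\<lambda>N. real (nat \<lfloor>real N * A (Suc i)\<rfloor>) / real N - real (nat \<lfloor>real N * A i\<rfloor>) / real N) \<longlonglongrightarrow> A (Suc i) - A i"
      using Apos[of i] Apos[of "Suc i"] that by (intro tendsto_diff floor_ratio_tendsto filterlim_ident) auto
    moreover have "real (ee N i) / real N = real (nat \<lfloor>real N * A (Suc i)\<rfloor>) / real N - real (nat \<lfloor>real N * A i\<rfloor>) / real N" for N
      using Bmono[OF that, of N] by (simp add: ee[OF that] of_nat_diff diff_divide_distrib)
    ultimately show ?thesis by (simp add: dA)
  qed
  define T where "T N i = block_exponent c N (n N i) (z N i) (z N (Suc i)) (ee N i)" for N i
  define \<tau> where "\<tau> i = d i * ln (h * c * (1 - x (Suc i))) - d i * ln (d i) + d i - h * c * (1 - x i)" for i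
  have Tlim: "(\<lambda>N. T N i / real N) \<longlonglongrightarrow> \<tau> i" and eK: "\<forall>\<^sub>F N in sequentially. real (ee N i) < real (n N i) * (real N - real (z N (Suc i)))"
    if i: "i < J" for i
  proof -
    have b1: "x (Suc i) < 1" using xJ[of "Suc i"] i \<eta> by auto
    have zl: "(\<lambda>N. real (z N i) / real N) \<longlonglongrightarrow> x i" "(\<lambda>N. real (z N (Suc i)) / real N) \<longlonglongrightarrow> x (Suc i)"
      using zlim i by auto
    show "(\<lambda>N. T N i / real N) \<longlonglongrightarrow> \<tau> i"
      unfolding T_def \<tau>_def by (rule block_exponent_tendsto(1)[OF c h(1) dpos[OF i] b1 nlim zl elim[OF i]])
    show "\<forall>\<^sub>F N in sequentially. real (ee N i) < real (n N i) * (real N - real (z N (Suc i)))"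
      by (rule block_exponent_tendsto(2)[OF c h(1) dpos[OF i] b1 nlim zl elim[OF i]])
  qed
  have sum\<tau>: "(\<Sum>i<J. \<tau> i) \<ge> - (\<alpha> + 2 * \<epsilon> / 3)"
  proof -
    have "(\<Sum>i<J. d i * (ln (d i / (c / 2^r * (1 - x i))) - 1) + c / 2^r * (1 - x i)) \<le> \<alpha> + c / 2^r"
      unfolding d_def x_def h_def
    proof (rule dyadic_bound_entropy[OF props(3) c J(1)])
      fix i assume "i \<le> J"
      then show "f (real i / 2^r) < 1" using xJ[of i] \<eta> by (auto simp: x_def)
    qed
    then have 1: "(\<Sum>i<J. d i * (ln (d i / (h * c * (1 - x i))) - 1) + h * c * (1 - x i)) \<le> \<alpha> + c * h"
      by (simp add: h_def)
    have 2: "\<tau> i \<ge> - (d i * (ln (d i / (h * c * (1 - x i))) - 1) + h * c * (1 - x i)) - d i * (\<omega> / \<eta>)" if i: "i < J" for i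
      unfolding \<tau>_def using i h c \<eta> J(1) dpos[OF i] xmono[of i "Suc i"] xJ[of "Suc i"] osc[of i] by (intro entropy_shift) auto
    \<comment> \<open>The total excess is at most 1, so the shifts of the entropy sum to at most
      \<open>\<omega> / \<eta>\<close>, however many blocks there are.\<close>
    have "(\<Sum>i<J. d i) = A J"
      using sum_lessThan_telescope[of A J] by (simp add: dA A0)
    also have "\<dots> \<le> 1" using x01(2)[OF J(1)] h by (simp add: A_def) (smt (verit) mult_nonneg_nonneg of_nat_0_le_iff)
    finally have 3: "(\<Sum>i<J. d i) * (\<omega> / \<eta>) \<le> 1 * (\<omega> / \<eta>)" using \<omega> \<eta> by (intro mult_right_mono) auto
    have "(\<Sum>i<J. \<tau> i) \<ge> (\<Sum>i<J. - (d i * (ln (d i / (h * c * (1 - x i))) - 1) + h * c * (1 - x i)) - d i * (\<omega> / \<eta>))"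
      using 2 by (intro sum_mono) auto
    also have "(\<Sum>i<J. - (d i * (ln (d i / (h * c * (1 - x i))) - 1) + h * c * (1 - x i)) - d i * (\<omega> / \<eta>))
      = - (\<Sum>i<J. d i * (ln (d i / (h * c * (1 - x i))) - 1) + h * c * (1 - x i)) - (\<Sum>i<J. d i) * (\<omega> / \<eta>)"
      by (simp only: sum_subtractf sum_negf sum_distrib_right)
    finally show ?thesis using 1 3 h(3) \<omega>(3) by linarith
  qed
  have "(\<lambda>N. \<Sum>i<J. T N i / real N) \<longlonglongrightarrow> (\<Sum>i<J. \<tau> i)" by (intro tendsto_sum Tlim) auto
  moreover have "(\<Sum>i<J. \<tau> i) > - (\<alpha> + \<epsilon>)" using sum\<tau> e by linarith
  ultimately have ev1: "\<forall>\<^sub>F N in sequentially. (\<Sum>i<J. T N i / real N) > - (\<alpha> + \<epsilon>)" by (rule order_tendstoD(1))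
  have ev2: "\<forall>\<^sub>F N in sequentially. \<forall>i\<in>{..<J}. real (ee N i) < real (n N i) * (real N - real (z N (Suc i)))"
    by (intro eventually_ball_finite ballI eK) auto
  have ev3: "\<forall>\<^sub>F N in sequentially. real N > max c (8 / \<delta>)"
    using filterlim_real_sequentially unfolding filterlim_at_top_dense by blast
  show ?thesis
    using ev1 ev2 ev3
  proof eventually_elim
    case (elim N)
    have N: "real N > c" "real N > 8 / \<delta>" "real N > 0" "N > 0" using elim(3) c by auto
    have cN: "c / real N \<in> {0..1}" using N c by simp
    let ?M = "measure_pmf (greedy_exploration N c)"
    have "exp (- (\<alpha> + \<epsilon>) * real N) \<le> exp (real N * (\<Sum>i<J. T N i / real N))"
      using elim(1) N by (simp add: mult.commute)
    also have "\<dots> = (\<Prod>i<J. exp (T N i))"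
      using N by (simp add: sum_distrib_left exp_sum)
    also have "\<dots> \<le> (\<Prod>i<J. pmf (kernel_power (explore_step N (c / real N)) (k N (Suc i) - k N i) (z N i)) (z N (Suc i)))"
    proof (intro prod_mono conjI)
      fix i assume "i \<in> {..<J}"
      then have i: "i < J" "Suc i \<le> J" by auto
      have "real (z N (Suc i)) \<le> real N * (1 - \<eta>)"
        using zclose(2)[OF i(2), of N] xJ[OF i(2)] N by (smt (verit) mult_left_mono)
      also have "\<dots> < real N * 1" using N \<eta> by (intro mult_strict_left_mono) auto
      finally have zN: "z N (Suc i) < N" by simp
      have "real (ee N i) < real (n N i * (N - z N (Suc i)))"
        using elim(2) i zN by (simp add: of_nat_diff)
      then have "ee N i < n N i * (N - z N (Suc i))" by (simp only: of_nat_less_iff)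
      then have "exp (T N i) \<le> pmf (kernel_power (explore_step N (c / real N)) (n N i) (z N i)) (z N (Suc i))"
        unfolding T_def by (intro kernel_power_ge_exp c N zN zn i) (auto simp: ee_def)
      then show "exp (T N i) \<le> pmf (kernel_power (explore_step N (c / real N)) (k N (Suc i) - k N i) (z N i)) (z N (Suc i))"
        by (simp add: n_def)
    qed simp
    also have "\<dots> = measure ?M {ss. \<forall>i\<le>J. Z ss (k N i) = z N i}"
      by (rule Z_grid_probability[OF cN, symmetric]) (use kmono kN J(1) in \<open>auto simp: k_def z_def A0\<close>)
    also have "\<dots> \<le> measure ?M {ss. Y N ss \<in> G}"
    proof (rule measure_pmf.finite_measure_mono_AE)
      show "AE ss in ?M. ss \<in> {ss. \<forall>i\<le>J. Z ss (k N i) = z N i} \<longrightarrow> ss \<in> {ss. Y N ss \<in> G}"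
        unfolding AE_measure_pmf_iff
      proof (intro ballI impI CollectI)
        fix ss assume ss: "ss \<in> set_pmf (greedy_exploration N c)" and "ss \<in> {ss. \<forall>i\<le>J. Z ss (k N i) = z N i}"
        then have Zz: "Z ss (k N i) = z N i" if "i \<le> J" for i using that by simp
        have "\<bar>path_of (Y N ss) t - f t\<bar> \<le> \<eta> + \<omega> + 2 / real N" if t: "t \<in> {0..1}" for t
        proof (rule path_of_Y_near[OF cN ss N(4) props(1) frng(2) J(1) _ _ _ _ _ t])
          show "\<bar>real (Z ss (nat \<lfloor>real N * (real i / 2^r)\<rfloor>)) - real N * f (real i / 2^r)\<bar> \<le> 2" if "i \<le> J" for i
            using zclose(1)[OF that, of N] Zz[OF that] by (simp add: k_def x_def)
        qed (use osc last \<omega> \<eta> in \<open>auto simp: x_def\<close>)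
        moreover have "2 / real N < \<delta> / 4" using N \<delta> by (simp add: field_simps)
        ultimately have "\<bar>path_of (Y N ss) t - path_of \<phi> t\<bar> \<le> 3/4 * \<delta>" if "t \<in> {0..1}" for t
          using that \<eta>(2) \<omega>(2) unfolding f_def by fastforce
        then have "dist (Y N ss) \<phi> \<le> 3/4 * \<delta>" using \<delta> by (intro dist_cadlag_le) auto
        then have "Y N ss \<in> ball \<phi> \<delta>" using \<delta>(1) by (simp add: dist_commute)
        then show "Y N ss \<in> G" using \<delta>(2) by blast
      qed
    qed simp
    finally show ?case .
  qed
qed

section \<open>Passage to the logarithmic limits\<close>

lemma law_Y_props:
  "prob_space (law_Y c N)" "sets (law_Y c N) = sets borel"
  "A \<in> sets borel \<Longrightarrow> measure (law_Y c N) A = measure (measure_pmf (greedy_exploration N c)) {ss. Y N ss \<in> A}"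
  by (simp_all add: law_Y_def prob_space.prob_space_distr[OF measure_pmf.prob_space_axioms] measure_distr vimage_def)

lemma scaled_log_gt_imp:
  assumes "n > 0" "0 \<le> p" "ereal (- a) < ereal (1 / real n) * ereal_log p"
  shows "exp (- a * real n) < p"
proof -
  have p: "p \<noteq> 0" using assms by (auto simp: ereal_log_def)
  then have "- a < ln p / real n" using assms by (simp add: ereal_log_def)
  then have "- a * real n < ln p" using assms(1) by (simp add: less_divide_eq)
  then show ?thesis using p assms(2) by (metis exp_less_cancel_iff exp_ln order_le_less)
qed

lemma scaled_log_ge:
  assumes "n > 0" "exp (- a * real n) \<le> p"
  shows "ereal (- a) \<le> ereal (1 / real n) * ereal_log p"
proof -
  have p: "p > 0" using assms(2) exp_gt_zero[of "- a * real n"] by linarith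
  then have "- a * real n \<le> ln p" using assms(2) by (simp add: ln_ge_iff)
  then have "- a \<le> ln p / real n" using assms(1) by (simp add: le_divide_eq)
  then show ?thesis using p by (simp add: ereal_log_def)
qed

lemma scaled_log_nonpos:
  assumes "0 \<le> p" "p \<le> 1"
  shows "ereal (1 / real n) * ereal_log p \<le> 0"
proof (cases "p = 0")
  case True
  then show ?thesis by (cases "n = 0") (auto simp: ereal_log_def)
next
  case False
  then have "ln p \<le> 0" using assms by (simp add: ln_le_zero_iff)
  then show ?thesis using False by (simp add: ereal_log_def mult_nonneg_nonpos divide_nonpos_nonneg)
qed

text \<open>If one of the bounds failed, a level \<open>b\<close> would lie strictly between its two
  sides. This \<open>b\<close> is a finite negative number, so that the core lemmas with real
  exponents apply.\<close>

theorem theorem2p1: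
  fixes c :: real
  assumes "c > 0"
  shows "large_deviation_principle (\<lambda>N. real N) (\<lambda>N. law_Y c N) (rate_I c)
         \<and> good_rate_function (rate_I c)"
proof
  show good: "good_rate_function (rate_I c)" by (rule good_rate_function_rate_I[OF assms])
  let ?a = "\<lambda>A n. ereal (1 / real n) * ereal_log (measure (law_Y c n) A)"
  have upper: "limsup (?a F) \<le> - enn2ereal (INF x\<in>F. rate_I c x)" if F: "closed F" for F
  proof (rule ccontr)
    let ?I = "INF x\<in>F. rate_I c x"
    assume "\<not> ?thesis"
    then obtain b where b: "- enn2ereal ?I < b" "b < limsup (?a F)" using dense by (auto simp: not_le)
    \<comment> \<open>Logarithms of probabilities are at most 0, hence \<open>b < 0\<close>; only
      then is \<open>a = - b\<close> a level of the nonnegative rate function.\<close>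
    have "limsup (?a F) \<le> 0"
      using prob_space.prob_le_1[OF law_Y_props(1)]
      by (intro Limsup_bounded always_eventually allI scaled_log_nonpos) auto
    then have "b < 0" using b(2) by order
    moreover have "b \<noteq> - \<infinity>" using b(1) by auto
    ultimately obtain a where a: "b = ereal (- a)" "a > 0"
      by (cases b) (auto, metis minus_minus neg_0_less_iff_less)
    have "\<not> (\<forall>\<^sub>F n in sequentially. ?a F n \<le> b)"
      using b(2) Limsup_bounded[of "?a F" b sequentially] by (auto simp: not_le)
    then have "\<exists>\<^sub>F n in sequentially. b < ?a F n" by (simp add: not_eventually not_le)
    then have "\<exists>\<^sub>F n in sequentially. exp (- a * real n) < measure (measure_pmf (greedy_exploration n c)) {ss. Y n ss \<in> F}"
    proof (rule frequently_rev_mp)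
      show "\<forall>\<^sub>F n in sequentially. b < ?a F n \<longrightarrow> exp (- a * real n) < measure (measure_pmf (greedy_exploration n c)) {ss. Y n ss \<in> F}"
        using eventually_gt_at_top[of 0]
      proof eventually_elim
        case (elim n)
        have "F \<in> sets borel" using F by (rule borel_closed)
        then show ?case
          using scaled_log_gt_imp[OF elim, of "measure (law_Y c n) F" a] by (simp add: law_Y_props(3) a)
      qed
    qed
    then obtain \<phi> where \<phi>: "\<phi> \<in> F" "rate_I c \<phi> \<le> ennreal a"
      using LDP_upper_core[OF assms F, of a] a by auto
    have "?I \<le> ennreal a" using INF_lower[OF \<phi>(1), of "rate_I c"] \<phi>(2) by order
    then have "enn2ereal ?I \<le> ereal a" using a by (metis enn2ereal_ennreal less_eq_ennreal.rep_eq less_imp_le)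
    then have "b \<le> - enn2ereal ?I" unfolding a by (simp add: ereal_uminus_le_reorder flip: uminus_ereal.simps(1))
    then show False using b(1) by order
  qed
  have lower: "- enn2ereal (INF x\<in>G. rate_I c x) \<le> liminf (?a G)" if G: "open G" for G
  proof (rule ccontr)
    let ?I = "INF x\<in>G. rate_I c x"
    assume "\<not> ?thesis"
    then obtain b where b: "liminf (?a G) < b" "b < - enn2ereal ?I" using dense by (auto simp: not_le)
    have "b < 0" using b(2) enn2ereal_nonneg[of ?I] by (metis ereal_uminus_le_0_iff order_less_le_trans)
    moreover have "b \<noteq> - \<infinity>" using b(1) by auto
    ultimately obtain a where a: "b = ereal (- a)" "a > 0"
      by (cases b) (auto, metis minus_minus neg_0_less_iff_less)
    have "enn2ereal ?I < ereal a" using b(2) unfolding a by (metis ereal_minus_less_minus uminus_ereal.simps(1))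
    then have "?I < ennreal a" using a by (simp add: less_ennreal.rep_eq)
    then obtain \<phi> where \<phi>: "\<phi> \<in> G" "rate_I c \<phi> < ennreal a" by (auto simp: INF_less_iff)
    then obtain s where s: "rate_I c \<phi> = ennreal s" "s \<ge> 0" by (cases "rate_I c \<phi>") auto
    have sa: "s < a" using \<phi>(2) s by (simp add: ennreal_less_iff)
    \<comment> \<open>Half of the gap between \<open>s\<close> and \<open>a\<close> leaves
      \<open>b\<close> strictly below \<open>- (s + e)\<close>.\<close>
    define e where "e = (a - s) / 2"
    have e: "e > 0" "s + e < a" using sa by (auto simp: e_def field_simps)
    have "\<forall>\<^sub>F n in sequentially. ereal (- (s + e)) \<le> ?a G n"
      using LDP_lower_core[OF assms G \<phi>(1) s(2) eq_refl[OF s(1)] e(1)] eventually_gt_at_top[of 0]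
    proof eventually_elim
      case (elim n)
      have "G \<in> sets borel" using G by (rule borel_open)
      then show ?case using elim by (intro scaled_log_ge) (auto simp: law_Y_props(3))
    qed
    then have "ereal (- (s + e)) \<le> liminf (?a G)" by (rule Liminf_bounded)
    moreover have "b < ereal (- (s + e))" using a e by simp
    ultimately show False using b(1) by order
  qed
  show "large_deviation_principle (\<lambda>N. real N) (\<lambda>N. law_Y c N) (rate_I c)"
    unfolding large_deviation_principle_def
    using good upper lower law_Y_props(1,2) filterlim_real_sequentially by (auto simp: good_rate_function_def)
qed

end
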